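(* Let $(M^{2n},\omega)$ be a symplectic manifold, let $L\subset M$ be an embedded Lagrangian submanifold with a Lagrangian (i.e. $n$-dimensional isotropic) surgery disc $D$ for an embedded $(n-1)$-sphere $S\subset L$, let $L'$ be the result of Lagrangian $(n-1)$-antisurgery on $L$ along $D$, with double point $p\in L'$, and let $V^\sharp:L^\sharp\leadsto L$ be the corresponding desingularized antisurgery cobordism. Then the two ends $L$ and $L^\sharp$ of $V^\sharp$ belong to distinct families of resolutions of $p\in L'$ by Lagrangian 0-surgery.
   Context: Families of resolutions. Let $\gamma=(a,b):\mathbb R\to T^*\mathbb R$ be an embedded smooth curve with $\gamma(t)=(t,0)$ for $t\le-\kappa$, $a(t)<0<b(t)$ for $|t|<\kappa$, $\gamma(t)=(0,t)$ for $t\ge\kappa$ ($\kappa>0$ small). The image of $h_\gamma:\mathbb R\times S^{n-1}\to T^*\mathbb R^n$, $(t,\mathbf x)\mapsto(a(t)\mathbf x,b(t)\mathbf x)$, is an embedded Lagrangian coinciding with $\mathbb R^n\times\{0\}\cup\{0\}\times\mathbb R^n$ outside the ball of radius $\kappa$. Given an ordering $(\lambda_1,\lambda_2)$ of the two sheets at a transverse double point, implanting this model by a Darboux chart taking $\mathbb R^n\times\{0\}$ to the first and $\{0\}\times\mathbb R^n$ to the second sheet gives a resolution, said to be locally modelled on $\lambda_1\#\lambda_2$. Resolutions for a given ordering form one family (they are related by local Lagrangian isotopies); the two orderings give two families. A Lagrangian is said to belong to a family if it is Lagrangian isotopic, by an isotopy induced from a Lagrangian isotopy in the local antisurgery/0-surgery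 model near $D$, to a resolution in that family. Cobordisms: $V:L'\leadsto L$ is a Lagrangian in $T^*\mathbb R\times M$, cylindrical over $L$ for $x_0\le\delta$ (negative end) and over $L'$ for $x_0\ge1-\delta$ (positive end). Surgery disc (case $k=n-1$): an embedded Lagrangian $n$-disc $D\subset M$ with $\partial D=S$, $\mathrm{int}\,D\cap L=\emptyset$, and such that outward-pointing normal vector fields to $S=\partial D$ in $TD|_S$ are nowhere contained in $TL$. Local model (case $k=n-1$). For small $\varepsilon,\delta>0$ choose smooth $\sigma:\mathbb R\to\mathbb R_{\ge0}$ with $\sigma=0$ for $x_0\le\delta$, $\sigma=1+\varepsilon$ for $x_0\ge1-\delta$, $\sigma'>0$ on $(\delta,1-\delta)$; and smooth $\rho:\mathbb R_{\ge0}\to\mathbb R_{\ge0}$ with $\rho=1$ near $0$, $\rho(r^2)=0$ for $r^2\ge1+2\varepsilon$, $-1/(1+\varepsilon)<\rho'\le0$. With $r^2=x_1^2+\dots+x_n^2$ set $f(x_0,\mathbf x)=r^2+\sigma(x_0)\rho(r^2)-1$, $\mathfrak U=\{f\ge0\}\subset\mathbb R\times\mathbb R^n$, $F=f^{3/2}$, $\Gamma=\mathrm{graph}(dF)\cup\mathrm{graph}(-dF)\subset T^*\mathbb R\times T^*\mathbb R^n$ (form $\sum_{i=0}^n dx_i\wedge dy_i$; $dF$ extended by $0$ to $\partial\mathfrak U$). With $F_j=F(j,\cdot)$, $\mathfrak U_j=\{\mathbf x:(j,\mathbf x)\in\mathfrak U\}$, set $\Lambda=\{(\mathbf x,\pm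 dF_0(\mathbf x)):\mathbf x\in\mathfrak U_0\}$, $\Lambda'_\pm=\{(\mathbf x,\pm dF_1(\mathbf x)):\mathbf x\in\mathfrak U_1\}$, $\Lambda'=\Lambda'_+\cup\Lambda'_-$, and $\lambda_\pm=T_{(0,0)}\Lambda'_\pm$. $\Lambda'$ has a unique double point, at the origin; the singular locus of $\Gamma$ is $\Gamma^s=\{((x_0,0),(0,0)):x_0\ge1-\delta\}$. Let $D_0=\{r^2\le1,\mathbf y=0\}$. Antisurgery: choose a symplectomorphism $\chi:\mathcal W_0\to\mathcal W$ between neighbourhoods of $D_0\subset T^*\mathbb R^n$ and $D\subset M$ with $\chi(D_0)=D$ and $\chi(\Lambda\cap\mathcal W_0)=L\cap\mathcal W$, with $\varepsilon$ so small that $\mathcal W_0$ contains the closure of $\{r^2<1+2\varepsilon,\ \|\mathbf y\|^2<6\sqrt{2\varepsilon}(1+4\varepsilon)\}$. Then $L'=(L\cap\mathcal W^c)\cup\chi(\Lambda'\cap\mathcal W_0)$, $V=\mathbb R\times(L\cap\mathcal W^c)\cup(\mathrm{id}\times\chi)(\Gamma\cap(T^*\mathbb R\times\mathcal W_0))$, and $p=\chi(0)$. Desingularized cobordism: in suitable Darboux coordinates a neighbourhood of $\Gamma^s$ in $\Gamma$ is $(\eta_-\times B_r(\lambda_-))\cup(\eta_+\times B_r(\lambda_+))$, where $B_r(\lambda_\pm)$ are balls and $\eta_\pm(x)=(x,\pm\tfrac32(\sigma(x)-1)^{1/2}\sigma'(x))$. A smaller neighbourhood of $\Gamma^s$ is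 cut out and replaced by the corresponding part of an embedded Lagrangian 1-handle $W^\sharp:\lambda_-\#\lambda_+\leadsto(\lambda_-,\lambda_+)$ in $T^*\mathbb R\times T^*\mathbb R^n$ which coincides with $\eta_+\times\lambda_+\cup\eta_-\times\lambda_-$ outside a small neighbourhood of its singular locus and has positive cylindrical end over a (small) 0-surgery $\lambda_-\#\lambda_+$. This gives an embedded cobordism $\Gamma^\sharp:\Lambda^\sharp\leadsto\Lambda$; implanting $\Gamma^\sharp$, $\Lambda^\sharp$ via $\chi$ in place of $\Gamma$, $\Lambda'$ yields $V^\sharp:L^\sharp\leadsto L$. *)

theory Defs
  imports "HOL-Analysis.Analysis"
begin

section \<open>Smooth maps\<close>

text \<open>\<open>Ck_on k f S\<close>: \<open>f\<close> is \<open>k\<close> times continuously differentiable on \<open>S\<close>. It is only used for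
  open \<open>S\<close>.\<close>

primrec Ck_on :: "nat \<Rightarrow> ('a::real_normed_vector \<Rightarrow> 'b::real_normed_vector) \<Rightarrow> 'a set \<Rightarrow> bool" where
  "Ck_on 0 f S \<longleftrightarrow> continuous_on S f"
| "Ck_on (Suc k) f S \<longleftrightarrow>
     f differentiable_on S \<and> (\<forall>v. Ck_on k (\<lambda>x. frechet_derivative f (at x) v) S)"

text \<open>On an arbitrary subset, smooth means locally extendable to a smooth map on an open set.\<close>

definition smooth_on :: "'a::real_normed_vector set \<Rightarrow> ('a \<Rightarrow> 'b::real_normed_vector) \<Rightarrow> bool" where
  "smooth_on S f \<longleftrightarrow> (\<forall>x\<in>S. \<exists>U g. open U \<and> x \<in> U \<and> (\<forall>k. Ck_on k g U) \<and> (\<forall>y\<in>S \<inter> U. f y = g y))"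

text \<open>Velocities at \<open>z\<close> of smooth curves running in \<open>A\<close>; the tangent space when \<open>A\<close> is a
  submanifold.\<close>

definition tangent_at :: "'a::real_normed_vector set \<Rightarrow> 'a \<Rightarrow> 'a set" where
  "tangent_at A z = {v. \<exists>c e. e > (0::real) \<and> smooth_on {-e<..<e} c \<and> c 0 = z \<and>
     (\<forall>t\<in>{-e<..<e}. c t \<in> A) \<and> (c has_vector_derivative v) (at 0)}"


section \<open>Manifolds\<close>

text \<open>An atlas is a set of charts \<open>(U, \<phi>)\<close>; the manifold is the whole type \<open>'m\<close>, with its
  topology, and \<open>'e\<close> is the model space.\<close>

type_synonym ('m, 'e) atlas = "('m set \<times> ('m \<Rightarrow> 'e)) set"

definition smooth_atlas :: "('m::topological_space, 'e::euclidean_space) atlas \<Rightarrow> bool" where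
  "smooth_atlas \<A> \<longleftrightarrow>
     (\<forall>(U, \<phi>)\<in>\<A>. open U \<and> open (\<phi> ` U) \<and> homeomorphism U (\<phi> ` U) \<phi> (inv_into U \<phi>)) \<and>
     (\<Union>(U, \<phi>)\<in>\<A>. U) = UNIV \<and>
     (\<forall>(U, \<phi>)\<in>\<A>. \<forall>(V, \<psi>)\<in>\<A>. smooth_on (\<phi> ` (U \<inter> V)) (\<psi> \<circ> inv_into U \<phi>))"

definition euclid :: "('e::euclidean_space, 'e) atlas" where
  "euclid = {(UNIV, id)}"

definition smooth_map ::
  "('m::topological_space, 'e::euclidean_space) atlas \<Rightarrow>
   ('p::topological_space, 'f::euclidean_space) atlas \<Rightarrow> 'm set \<Rightarrow> ('m \<Rightarrow> 'p) \<Rightarrow> bool" where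
  "smooth_map \<A> \<B> S f \<longleftrightarrow>
     (\<forall>x\<in>S. \<exists>(U, \<phi>)\<in>\<A>. \<exists>(V, \<psi>)\<in>\<B>. \<exists>N. open N \<and> x \<in> N \<and> N \<subseteq> U \<and> f ` (S \<inter> N) \<subseteq> V \<and>
        smooth_on (\<phi> ` (S \<inter> N)) (\<psi> \<circ> f \<circ> inv_into U \<phi>))"

definition diffeomorphism ::
  "('m::topological_space, 'e::euclidean_space) atlas \<Rightarrow>
   ('p::topological_space, 'f::euclidean_space) atlas \<Rightarrow> 'm set \<Rightarrow> 'p set \<Rightarrow> ('m \<Rightarrow> 'p) \<Rightarrow> bool" where
  "diffeomorphism \<A> \<B> S T f \<longleftrightarrow>
     bij_betw f S T \<and> smooth_map \<A> \<B> S f \<and> smooth_map \<B> \<A> T (inv_into S f)"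

definition embedded_submanifold ::
  "('m::topological_space, 'e::euclidean_space) atlas \<Rightarrow> nat \<Rightarrow> 'm set \<Rightarrow> bool" where
  "embedded_submanifold \<A> k L \<longleftrightarrow>
     (\<forall>x\<in>L. \<exists>U (\<phi> :: 'm \<Rightarrow> 'e) T. open U \<and> x \<in> U \<and> open (\<phi> ` U) \<and>
        diffeomorphism \<A> euclid U (\<phi> ` U) \<phi> \<and>
        subspace T \<and> dim T = k \<and> \<phi> ` (L \<inter> U) = \<phi> ` U \<inter> T)"


section \<open>Symplectic manifolds\<close>

text \<open>A manifold with a 2-form is given by charts which also carry the coordinate expression
  \<open>\<Omega> z u v\<close> of the form (at the point \<open>z\<close>, on the vectors \<open>u\<close> and \<open>v\<close>).\<close>

record ('m, 'e) form_chart =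
  ch_dom :: "'m set"
  ch_map :: "'m \<Rightarrow> 'e"
  ch_form :: "'e \<Rightarrow> 'e \<Rightarrow> 'e \<Rightarrow> real"

definition atlas_of :: "('m, 'e) form_chart set \<Rightarrow> ('m, 'e) atlas" where
  "atlas_of X = (\<lambda>c. (ch_dom c, ch_map c)) ` X"

text \<open>The last conjunct is \<open>d\<Omega> = 0\<close>, evaluated on constant vector fields.\<close>

definition symplectic_form_on ::
  "'e::euclidean_space set \<Rightarrow> ('e \<Rightarrow> 'e \<Rightarrow> 'e \<Rightarrow> real) \<Rightarrow> bool" where
  "symplectic_form_on U \<Omega> \<longleftrightarrow>
     (\<forall>z\<in>U. bilinear (\<Omega> z) \<and> (\<forall>u. \<Omega> z u u = 0) \<and> (\<forall>u. (\<forall>v. \<Omega> z u v = 0) \<longrightarrow> u = 0)) \<and>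
     (\<forall>u v. smooth_on U (\<lambda>z. \<Omega> z u v)) \<and>
     (\<forall>z\<in>U. \<forall>u v w. frechet_derivative (\<lambda>z. \<Omega> z v w) (at z) u +
        frechet_derivative (\<lambda>z. \<Omega> z w u) (at z) v + frechet_derivative (\<lambda>z. \<Omega> z u v) (at z) w = 0)"

definition preserves_form ::
  "('m, 'e::euclidean_space) form_chart set \<Rightarrow> ('p, 'f::euclidean_space) form_chart set \<Rightarrow>
   'm set \<Rightarrow> ('m \<Rightarrow> 'p) \<Rightarrow> bool" where
  "preserves_form X Y S f \<longleftrightarrow>
     (\<forall>c\<in>X. \<forall>d\<in>Y. \<forall>x\<in>S \<inter> ch_dom c. f x \<in> ch_dom d \<longrightarrow>
        (let T = frechet_derivative (ch_map d \<circ> f \<circ> inv_into (ch_dom c) (ch_map c)) (at (ch_map c x))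
         in \<forall>u v. ch_form d (ch_map d (f x)) (T u) (T v) = ch_form c (ch_map c x) u v))"

text \<open>The last conjunct says that the coordinate expressions define one global form.\<close>

definition symplectic_manifold ::
  "('m::{t2_space,second_countable_topology}, 'e::euclidean_space) form_chart set \<Rightarrow> bool" where
  "symplectic_manifold X \<longleftrightarrow>
     smooth_atlas (atlas_of X) \<and>
     (\<forall>c\<in>X. symplectic_form_on (ch_map c ` ch_dom c) (ch_form c)) \<and>
     preserves_form X X UNIV id"

definition symplectomorphism ::
  "('m::topological_space, 'e::euclidean_space) form_chart set \<Rightarrow>
   ('p::topological_space, 'f::euclidean_space) form_chart set \<Rightarrow>
   'm set \<Rightarrow> 'p set \<Rightarrow> ('m \<Rightarrow> 'p) \<Rightarrow> bool" where
  "symplectomorphism X Y U V f \<longleftrightarrow>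
     open U \<and> open V \<and> diffeomorphism (atlas_of X) (atlas_of Y) U V f \<and> preserves_form X Y U f"

definition isotropic ::
  "('m, 'e::euclidean_space) form_chart set \<Rightarrow> 'm set \<Rightarrow> bool" where
  "isotropic X L \<longleftrightarrow>
     (\<forall>c\<in>X. \<forall>x\<in>L \<inter> ch_dom c.
        \<forall>u\<in>tangent_at (ch_map c ` (L \<inter> ch_dom c)) (ch_map c x).
        \<forall>v\<in>tangent_at (ch_map c ` (L \<inter> ch_dom c)) (ch_map c x). ch_form c (ch_map c x) u v = 0)"

definition lagrangian ::
  "('m::topological_space, 'e::euclidean_space) form_chart set \<Rightarrow> 'm set \<Rightarrow> bool" where
  "lagrangian X L \<longleftrightarrow>
     embedded_submanifold (atlas_of X) (DIM('e) div 2) L \<and> isotropic X L"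

text \<open>The cotangent bundle of a Euclidean space \<open>'a\<close>, with points \<open>(x, y)\<close> and the form
  \<open>\<Sum> dx\<^sub>i \<and> dy\<^sub>i\<close>.\<close>

definition cotangent :: "('a::euclidean_space \<times> 'a, 'a \<times> 'a) form_chart set" where
  "cotangent = {\<lparr>ch_dom = UNIV, ch_map = id,
     ch_form = (\<lambda>z u v. fst u \<bullet> snd v - snd u \<bullet> fst v)\<rparr>}"

definition prod_symplectic ::
  "('m, 'e) form_chart set \<Rightarrow> ('p, 'f) form_chart set \<Rightarrow> ('m \<times> 'p, 'e \<times> 'f) form_chart set" where
  "prod_symplectic X Y =
     (\<lambda>(c, d). \<lparr>ch_dom = ch_dom c \<times> ch_dom d, ch_map = map_prod (ch_map c) (ch_map d),
        ch_form = (\<lambda>z u v. ch_form c (fst z) (fst u) (fst v) + ch_form d (snd z) (snd u) (snd v))\<rparr>)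
     ` (X \<times> Y)"

type_synonym 'n phase = "(real, 'n) vec \<times> (real, 'n) vec"


section \<open>Cobordisms\<close>

text \<open>\<open>V : L' \<leadsto> L\<close>. A point of \<open>T\<^sup>*\<real> \<times> M\<close> is \<open>((x\<^sub>0, y\<^sub>0), m)\<close>.\<close>

definition lagrangian_cobordism ::
  "('m::topological_space, 'e::euclidean_space) form_chart set \<Rightarrow>
   ((real \<times> real) \<times> 'm) set \<Rightarrow> 'm set \<Rightarrow> 'm set \<Rightarrow> bool" where
  "lagrangian_cobordism X V L' L \<longleftrightarrow>
     lagrangian (prod_symplectic cotangent X) V \<and>
     (\<exists>d. 0 < d \<and> d < 1/2 \<and>
        V \<inter> ({..d} \<times> UNIV) \<times> UNIV = ({..d} \<times> {0}) \<times> L \<and>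
        V \<inter> ({1 - d..} \<times> UNIV) \<times> UNIV = ({1 - d..} \<times> {0}) \<times> L')"


section \<open>Resolutions of a double point\<close>

text \<open>The final conjunct makes the handle below agree with the two axes outside the ball of
  radius \<open>\<kappa>\<close>.\<close>

definition handle_curve :: "real \<Rightarrow> (real \<Rightarrow> real \<times> real) \<Rightarrow> bool" where
  "handle_curve \<kappa> \<gamma> \<longleftrightarrow>
     0 < \<kappa> \<and> smooth_on UNIV \<gamma> \<and> inj \<gamma> \<and> (\<forall>t. vector_derivative \<gamma> (at t) \<noteq> 0) \<and>
     (\<forall>t\<le>-\<kappa>. \<gamma> t = (t, 0)) \<and> (\<forall>t\<ge>\<kappa>. \<gamma> t = (0, t)) \<and>
     (\<forall>t. \<bar>t\<bar> < \<kappa> \<longrightarrow> fst (\<gamma> t) < 0 \<and> 0 < snd (\<gamma> t)) \<and>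
     (\<forall>t. \<bar>t\<bar> \<le> \<kappa> \<longrightarrow> norm (\<gamma> t) \<le> \<kappa>)"

definition handle :: "(real \<Rightarrow> real \<times> real) \<Rightarrow> 'n::finite phase set" where
  "handle \<gamma> = {(fst (\<gamma> t) *\<^sub>R x, snd (\<gamma> t) *\<^sub>R x) | t x. x \<in> sphere 0 1}"

text \<open>The family of resolutions of \<open>L'\<close> at \<open>p\<close> locally modelled on \<open>\<Sigma>\<^sub>1 # \<Sigma>\<^sub>2\<close>, where the sheets
  \<open>(\<Sigma>\<^sub>1, \<Sigma>\<^sub>2)\<close> are given by sets whose union is \<open>L'\<close> near \<open>p\<close>. The set \<open>B\<close> restricts the size of
  the Darboux chart. Transversality of the sheets follows from the existence of the chart.\<close>

definition resolution_family ::
  "('m::topological_space, 'n::finite phase) form_chart set \<Rightarrow> 'm set \<Rightarrow>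
   'm set \<Rightarrow> 'm \<Rightarrow> 'm set \<times> 'm set \<Rightarrow> 'm set set" where
  "resolution_family X B L' p = (\<lambda>(\<Sigma>\<^sub>1, \<Sigma>\<^sub>2). {R. \<exists>\<theta> (U::'n phase set) U' \<kappa> \<gamma>.
     symplectomorphism cotangent X U U' \<theta> \<and> 0 \<in> U \<and> \<theta> 0 = p \<and> U' \<subseteq> B \<and>
     L' \<inter> U' = (\<Sigma>\<^sub>1 \<union> \<Sigma>\<^sub>2) \<inter> U' \<and>
     \<theta> ` (U \<inter> UNIV \<times> {0}) = \<Sigma>\<^sub>1 \<inter> U' \<and> \<theta> ` (U \<inter> {0} \<times> UNIV) = \<Sigma>\<^sub>2 \<inter> U' \<and>
     handle_curve \<kappa> \<gamma> \<and> cball 0 \<kappa> \<subseteq> U \<and>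
     R = (L' - U') \<union> \<theta> ` (U \<inter> handle \<gamma>)})"


section \<open>Surgery discs\<close>

text \<open>The disc \<open>D\<close> is parametrized by the closed unit ball through \<open>e\<close>. At a boundary point \<open>e x\<close>
  the outward-pointing vectors are the images under the derivative of \<open>e\<close> of the \<open>v\<close> with
  \<open>v \<bullet> x > 0\<close>.\<close>

definition surgery_disc ::
  "('m::topological_space, 'n::finite phase) form_chart set \<Rightarrow> 'm set \<Rightarrow> 'm set \<Rightarrow> 'm set \<Rightarrow> bool"
  where
  "surgery_disc X L S D \<longleftrightarrow> S \<subseteq> L \<and>
     (\<exists>e :: (real, 'n) vec \<Rightarrow> 'm.
        diffeomorphism euclid (atlas_of X) (cball 0 1) D e \<and>
        e ` sphere 0 1 = S \<and> e ` ball 0 1 \<inter> L = {} \<and>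
        lagrangian X (e ` ball 0 1) \<and>
        (\<forall>x\<in>sphere 0 1. \<forall>c\<in>X. e x \<in> ch_dom c \<longrightarrow>
           (\<forall>T. ((ch_map c \<circ> e) has_derivative T) (at x within cball 0 1) \<longrightarrow>
              (\<forall>v. v \<bullet> x > 0 \<longrightarrow>
                 T v \<notin> tangent_at (ch_map c ` (L \<inter> ch_dom c)) (ch_map c (e x))))))"


section \<open>The local model\<close>

text \<open>The bound \<open>\<epsilon> < 1/2\<close> is all that is needed of smallness of \<open>\<epsilon>\<close>: it is equivalent to
  \<open>18 \<epsilon> (1 + 2\<epsilon>) < 6 sqrt (2\<epsilon>) (1 + 4\<epsilon>)\<close>, so that the parts of \<open>\<Lambda>\<close> and \<open>\<Lambda>'\<close> over
  \<open>r\<^sup>2 < 1 + 2\<epsilon>\<close> lie in \<open>model_box \<epsilon>\<close> below.\<close>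

definition model_parameters ::
  "real \<Rightarrow> real \<Rightarrow> (real \<Rightarrow> real) \<Rightarrow> (real \<Rightarrow> real) \<Rightarrow> bool" where
  "model_parameters \<epsilon> \<delta> \<sigma> \<rho> \<longleftrightarrow>
     0 < \<epsilon> \<and> \<epsilon> < 1/2 \<and> 0 < \<delta> \<and> \<delta> < 1/2 \<and>
     smooth_on UNIV \<sigma> \<and> (\<forall>t. 0 \<le> \<sigma> t) \<and>
     (\<forall>t\<le>\<delta>. \<sigma> t = 0) \<and> (\<forall>t\<ge>1 - \<delta>. \<sigma> t = 1 + \<epsilon>) \<and> (\<forall>t\<in>{\<delta><..<1 - \<delta>}. 0 < deriv \<sigma> t) \<and>
     smooth_on {0..} \<rho> \<and> (\<forall>u\<ge>0. 0 \<le> \<rho> u) \<and>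
     (\<exists>u\<^sub>0>0. \<forall>u\<in>{0..u\<^sub>0}. \<rho> u = 1) \<and> (\<forall>u\<ge>1 + 2 * \<epsilon>. \<rho> u = 0) \<and>
     (\<forall>u>0. -1 / (1 + \<epsilon>) < deriv \<rho> u \<and> deriv \<rho> u \<le> 0)"

definition model_f ::
  "(real \<Rightarrow> real) \<Rightarrow> (real \<Rightarrow> real) \<Rightarrow> real \<Rightarrow> (real, 'n::finite) vec \<Rightarrow> real" where
  "model_f \<sigma> \<rho> x\<^sub>0 x = (norm x)\<^sup>2 + \<sigma> x\<^sub>0 * \<rho> ((norm x)\<^sup>2) - 1"

text \<open>The graph of \<open>s dF\<close> over \<open>{g \<ge> 0}\<close>, where \<open>F = g\<^bsup>3/2\<^esup>\<close>; covectors are identified with vectors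
  by the inner product, and \<open>dF\<close> is extended by 0 to \<open>{g = 0}\<close>.\<close>

definition graph_d32 :: "('a::euclidean_space \<Rightarrow> real) \<Rightarrow> real \<Rightarrow> ('a \<times> 'a) set" where
  "graph_d32 g s =
     {(x, y). g x > 0 \<and> ((\<lambda>z. s * g z powr (3/2)) has_derivative (\<lambda>h. y \<bullet> h)) (at x) \<or>
              g x = 0 \<and> y = 0}"

text \<open>The sign \<open>s\<close> is 1 or -1 throughout.\<close>

definition Gamma_sheet ::
  "(real \<Rightarrow> real) \<Rightarrow> (real \<Rightarrow> real) \<Rightarrow> real \<Rightarrow> ((real \<times> real) \<times> 'n::finite phase) set" where
  "Gamma_sheet \<sigma> \<rho> s =
     (\<lambda>((x\<^sub>0, x), (y\<^sub>0, y)). ((x\<^sub>0, y\<^sub>0), (x, y))) ` graph_d32 (\<lambda>(x\<^sub>0, x). model_f \<sigma> \<rho> x\<^sub>0 x) s"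

definition Gamma_model ::
  "(real \<Rightarrow> real) \<Rightarrow> (real \<Rightarrow> real) \<Rightarrow> ((real \<times> real) \<times> 'n::finite phase) set" where
  "Gamma_model \<sigma> \<rho> = Gamma_sheet \<sigma> \<rho> 1 \<union> Gamma_sheet \<sigma> \<rho> (-1)"

definition Lambda :: "(real \<Rightarrow> real) \<Rightarrow> (real \<Rightarrow> real) \<Rightarrow> 'n::finite phase set" where
  "Lambda \<sigma> \<rho> = graph_d32 (model_f \<sigma> \<rho> 0) 1 \<union> graph_d32 (model_f \<sigma> \<rho> 0) (-1)"

definition Lambda'_sheet :: "(real \<Rightarrow> real) \<Rightarrow> (real \<Rightarrow> real) \<Rightarrow> real \<Rightarrow> 'n::finite phase set" where
  "Lambda'_sheet \<sigma> \<rho> s = graph_d32 (model_f \<sigma> \<rho> 1) s"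

definition Lambda' :: "(real \<Rightarrow> real) \<Rightarrow> (real \<Rightarrow> real) \<Rightarrow> 'n::finite phase set" where
  "Lambda' \<sigma> \<rho> = Lambda'_sheet \<sigma> \<rho> 1 \<union> Lambda'_sheet \<sigma> \<rho> (-1)"

definition lambda_tangent ::
  "(real \<Rightarrow> real) \<Rightarrow> (real \<Rightarrow> real) \<Rightarrow> real \<Rightarrow> 'n::finite phase set" where
  "lambda_tangent \<sigma> \<rho> s = tangent_at (Lambda'_sheet \<sigma> \<rho> s) 0"

definition singular_locus :: "real \<Rightarrow> ((real \<times> real) \<times> 'n::finite phase) set" where
  "singular_locus \<delta> = ({1 - \<delta>..} \<times> {0}) \<times> {0}"

definition model_box :: "real \<Rightarrow> 'n::finite phase set" where
  "model_box \<epsilon> = {(x, y). (norm x)\<^sup>2 < 1 + 2 * \<epsilon> \<and> (norm y)\<^sup>2 < 6 * sqrt (2 * \<epsilon>) * (1 + 4 * \<epsilon>)}"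

definition model_disc :: "'n::finite phase set" where
  "model_disc = cball 0 1 \<times> {0}"


section \<open>Antisurgery\<close>

definition implant ::
  "'m set \<Rightarrow> ('n::finite phase \<Rightarrow> 'm) \<Rightarrow> 'n phase set \<Rightarrow> 'm set \<Rightarrow> 'n phase set \<Rightarrow> 'm set" where
  "implant L \<xi> W\<^sub>0 W A = (L - W) \<union> \<xi> ` (A \<inter> W\<^sub>0)"

definition implant_cobordism ::
  "'m set \<Rightarrow> ('n::finite phase \<Rightarrow> 'm) \<Rightarrow> 'n phase set \<Rightarrow> 'm set \<Rightarrow>
   ((real \<times> real) \<times> 'n phase) set \<Rightarrow> ((real \<times> real) \<times> 'm) set" where
  "implant_cobordism L \<xi> W\<^sub>0 W G =
     (UNIV \<times> {0}) \<times> (L - W) \<union> map_prod id \<xi> ` (G \<inter> UNIV \<times> W\<^sub>0)"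

text \<open>\<open>L'\<close> is the result of antisurgery on \<open>L\<close> along \<open>D\<close> for the auxiliary choices
  \<open>\<epsilon>, \<delta>, \<sigma>, \<rho>, \<xi>, W\<^sub>0, W\<close>, and \<open>p\<close> is its double point; \<open>\<xi>\<close> is the
  symplectomorphism usually called chi, a symbol taken by the vector binder.\<close>

definition antisurgery ::
  "('m::topological_space, 'n::finite phase) form_chart set \<Rightarrow> 'm set \<Rightarrow> 'm set \<Rightarrow>
   real \<Rightarrow> real \<Rightarrow> (real \<Rightarrow> real) \<Rightarrow> (real \<Rightarrow> real) \<Rightarrow>
   ('n phase \<Rightarrow> 'm) \<Rightarrow> 'n phase set \<Rightarrow> 'm set \<Rightarrow> 'm set \<Rightarrow> 'm \<Rightarrow> bool" where
  "antisurgery X L D \<epsilon> \<delta> \<sigma> \<rho> \<xi> W\<^sub>0 W L' p \<longleftrightarrow>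
     model_parameters \<epsilon> \<delta> \<sigma> \<rho> \<and>
     symplectomorphism cotangent X W\<^sub>0 W \<xi> \<and>
     model_disc \<subseteq> W\<^sub>0 \<and> \<xi> ` model_disc = D \<and>
     \<xi> ` (Lambda \<sigma> \<rho> \<inter> W\<^sub>0) = L \<inter> W \<and>
     closure (model_box \<epsilon>) \<subseteq> W\<^sub>0 \<and>
     L' = implant L \<xi> W\<^sub>0 W (Lambda' \<sigma> \<rho>) \<and> p = \<xi> 0"


section \<open>The desingularized cobordism\<close>

text \<open>The curve \<open>\<eta>\<^sub>s\<close>, used for \<open>x > t\<^sub>0\<close> with \<open>\<sigma> t\<^sub>0 \<ge> 1\<close>, where the root is defined.\<close>

definition eta_curve :: "(real \<Rightarrow> real) \<Rightarrow> real \<Rightarrow> real \<Rightarrow> (real \<times> real) set" where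
  "eta_curve \<sigma> t\<^sub>0 s = {(t, s * (3/2) * sqrt (\<sigma> t - 1) * deriv \<sigma> t) | t. t > t\<^sub>0}"

definition eta_lambda ::
  "(real \<Rightarrow> real) \<Rightarrow> (real \<Rightarrow> real) \<Rightarrow> real \<Rightarrow> real \<Rightarrow> ((real \<times> real) \<times> 'n::finite phase) set" where
  "eta_lambda \<sigma> \<rho> t\<^sub>0 s = eta_curve \<sigma> t\<^sub>0 s \<times> lambda_tangent \<sigma> \<rho> s"

text \<open>\<open>H : \<lambda>\<^sub>- # \<lambda>\<^sub>+ \<leadsto> (\<lambda>\<^sub>-, \<lambda>\<^sub>+)\<close>, an embedded Lagrangian 1-handle, which agrees with
  \<open>\<eta>\<^sub>+ \<times> \<lambda>\<^sub>+ \<union> \<eta>\<^sub>- \<times> \<lambda>\<^sub>-\<close> outside the neighbourhood \<open>C\<close> of the singular locus, and whose positive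
  end is a 0-surgery \<open>K\<close> performed inside \<open>B\<close>. As a manifold it is an open 1-handle
  \<open>\<real> \<times> \<real>\<^sup>n\<close>. The positive end begins at some \<open>c < 1\<close>, so that it is visible in a cobordism.\<close>

definition lagrangian_one_handle ::
  "(real \<Rightarrow> real) \<Rightarrow> (real \<Rightarrow> real) \<Rightarrow> real \<Rightarrow> ((real \<times> real) \<times> 'n::finite phase) set \<Rightarrow>
   'n phase set \<Rightarrow> ((real \<times> real) \<times> 'n phase) set \<Rightarrow> bool" where
  "lagrangian_one_handle \<sigma> \<rho> t\<^sub>0 C B H \<longleftrightarrow>
     lagrangian (prod_symplectic cotangent cotangent) H \<and>
     (\<exists>h :: real \<times> (real, 'n) vec \<Rightarrow> _. diffeomorphism euclid euclid UNIV H h) \<and>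
     H - C = (eta_lambda \<sigma> \<rho> t\<^sub>0 1 \<union> eta_lambda \<sigma> \<rho> t\<^sub>0 (-1)) - C \<and>
     (\<exists>c<1. \<exists>K \<in> resolution_family cotangent B
          (lambda_tangent \<sigma> \<rho> (-1) \<union> lambda_tangent \<sigma> \<rho> 1) 0
          (lambda_tangent \<sigma> \<rho> (-1), lambda_tangent \<sigma> \<rho> 1).
        H \<inter> ({c..} \<times> UNIV) \<times> UNIV = ({c..} \<times> {0}) \<times> K)"

text \<open>The Darboux coordinates \<open>\<Phi> : N \<rightarrow> N'\<close> split \<open>\<Gamma>\<close> near the singular locus. Over the
  cylindrical end \<open>x\<^sub>0 \<ge> 1 - \<delta>\<close> of \<open>\<Gamma>\<close> they are a product \<open>id \<times> \<psi>\<close>, which is what makes the end of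
  the modified cobordism cylindrical. \<open>C\<close> is the smaller neighbourhood, outside which nothing
  changes; it is closed in the whole space in both coordinate systems.\<close>

definition darboux_splitting ::
  "real \<Rightarrow> real \<Rightarrow> (real \<Rightarrow> real) \<Rightarrow> (real \<Rightarrow> real) \<Rightarrow> real \<Rightarrow>
   ((real \<times> real) \<times> 'n::finite phase \<Rightarrow> (real \<times> real) \<times> 'n phase) \<Rightarrow>
   ((real \<times> real) \<times> 'n phase) set \<Rightarrow> ((real \<times> real) \<times> 'n phase) set \<Rightarrow>
   ((real \<times> real) \<times> 'n phase) set \<Rightarrow> 'n phase set \<Rightarrow> bool" where
  "darboux_splitting \<epsilon> \<delta> \<sigma> \<rho> t\<^sub>0 \<Phi> N N' C B \<longleftrightarrow>
     \<delta> < t\<^sub>0 \<and> t\<^sub>0 < 1 - \<delta> \<and> 1 \<le> \<sigma> t\<^sub>0 \<and>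
     symplectomorphism (prod_symplectic cotangent cotangent) (prod_symplectic cotangent cotangent)
       N N' \<Phi> \<and>
     singular_locus \<delta> \<subseteq> N \<and> N \<subseteq> ({\<delta><..} \<times> UNIV) \<times> model_box \<epsilon> \<and>
     (\<forall>z\<in>singular_locus \<delta>. \<Phi> z = z) \<and>
     (\<exists>r>0. \<forall>s\<in>{1, -1}.
        \<Phi> ` (Gamma_sheet \<sigma> \<rho> s \<inter> N) = eta_curve \<sigma> t\<^sub>0 s \<times> (lambda_tangent \<sigma> \<rho> s \<inter> ball 0 r) \<and>
        eta_lambda \<sigma> \<rho> t\<^sub>0 s \<inter> N' = eta_curve \<sigma> t\<^sub>0 s \<times> (lambda_tangent \<sigma> \<rho> s \<inter> ball 0 r)) \<and>
     (\<exists>J Q \<psi>. 0 \<in> J \<and> symplectomorphism cotangent cotangent Q B \<psi> \<and>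
        N \<inter> ({1 - \<delta>..} \<times> UNIV) \<times> UNIV = ({1 - \<delta>..} \<times> J) \<times> Q \<and>
        N' \<inter> ({1 - \<delta>..} \<times> UNIV) \<times> UNIV = ({1 - \<delta>..} \<times> J) \<times> B \<and>
        (\<forall>a\<in>{1 - \<delta>..} \<times> J. \<forall>w\<in>Q. \<Phi> (a, w) = (a, \<psi> w))) \<and>
     singular_locus \<delta> \<subseteq> interior C \<and> C \<subseteq> N' \<and> closed C \<and> closed {z\<in>N. \<Phi> z \<in> C} \<and>
     bounded (snd ` C)"

definition desingularized_model ::
  "real \<Rightarrow> real \<Rightarrow> (real \<Rightarrow> real) \<Rightarrow> (real \<Rightarrow> real) \<Rightarrow>
   ((real \<times> real) \<times> 'n::finite phase) set \<Rightarrow> 'n phase set \<Rightarrow> bool" where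
  "desingularized_model \<epsilon> \<delta> \<sigma> \<rho> Gs Ls \<longleftrightarrow>
     (\<exists>t\<^sub>0 \<Phi> N N' C B H.
        darboux_splitting \<epsilon> \<delta> \<sigma> \<rho> t\<^sub>0 \<Phi> N N' C B \<and>
        lagrangian_one_handle \<sigma> \<rho> t\<^sub>0 C B H \<and>
        Gs = (Gamma_model \<sigma> \<rho> - N) \<union> {z\<in>N. \<Phi> z \<in> H}) \<and>
     lagrangian_cobordism cotangent Gs Ls (Lambda \<sigma> \<rho>)"

definition desingularized_cobordism ::
  "('m::topological_space, 'n::finite phase) form_chart set \<Rightarrow> 'm set \<Rightarrow>
   real \<Rightarrow> real \<Rightarrow> (real \<Rightarrow> real) \<Rightarrow> (real \<Rightarrow> real) \<Rightarrow>
   ('n phase \<Rightarrow> 'm) \<Rightarrow> 'n phase set \<Rightarrow> 'm set \<Rightarrow>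
   ((real \<times> real) \<times> 'm) set \<Rightarrow> 'm set \<Rightarrow> bool" where
  "desingularized_cobordism X L \<epsilon> \<delta> \<sigma> \<rho> \<xi> W\<^sub>0 W Vs Ls \<longleftrightarrow>
     (\<exists>\<Gamma>s \<Lambda>s. desingularized_model \<epsilon> \<delta> \<sigma> \<rho> \<Gamma>s \<Lambda>s \<and>
        Vs = implant_cobordism L \<xi> W\<^sub>0 W \<Gamma>s \<and> Ls = implant L \<xi> W\<^sub>0 W \<Lambda>s) \<and>
     lagrangian_cobordism X Vs Ls L"


section \<open>Belonging to a family\<close>

text \<open>A smooth isotopy from \<open>A\<close> to \<open>A'\<close> through embedded Lagrangians of \<open>T\<^sup>*\<real>\<^sup>n\<close>, supported in a
  compact subset of \<open>W\<^sub>0\<close>.\<close>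

definition local_lagrangian_isotopy ::
  "'n::finite phase set \<Rightarrow> 'n phase set \<Rightarrow> 'n phase set \<Rightarrow> bool" where
  "local_lagrangian_isotopy W\<^sub>0 A A' \<longleftrightarrow>
     (\<exists>(j :: real \<Rightarrow> 'n phase \<Rightarrow> 'n phase) K. compact K \<and> K \<subseteq> W\<^sub>0 \<and>
        smooth_on ({0..1} \<times> A) (\<lambda>(t, z). j t z) \<and>
        (\<forall>t\<in>{0..1}. diffeomorphism euclid euclid A (j t ` A) (j t) \<and> lagrangian cotangent (j t ` A) \<and>
           (\<forall>z\<in>A - K. j t z = z) \<and> j t ` (A \<inter> K) \<subseteq> K) \<and>
        (\<forall>z\<in>A. j 0 z = z) \<and> j 1 ` A = A')"

definition belongs_to_family ::
  "('m::topological_space, 'n::finite phase) form_chart set \<Rightarrow> 'm set \<Rightarrow>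
   ('n phase \<Rightarrow> 'm) \<Rightarrow> 'n phase set \<Rightarrow> 'm set \<Rightarrow> 'm set \<Rightarrow> 'm \<Rightarrow>
   'm set \<times> 'm set \<Rightarrow> 'm set \<Rightarrow> bool" where
  "belongs_to_family X L \<xi> W\<^sub>0 W L' p sheets K \<longleftrightarrow>
     lagrangian X K \<and>
     (\<exists>A A'. K = implant L \<xi> W\<^sub>0 W A \<and> local_lagrangian_isotopy W\<^sub>0 A A' \<and>
        implant L \<xi> W\<^sub>0 W A' \<in> resolution_family X UNIV L' p sheets)"

definition sheet ::
  "(real \<Rightarrow> real) \<Rightarrow> (real \<Rightarrow> real) \<Rightarrow> ('n::finite phase \<Rightarrow> 'm) \<Rightarrow> 'n phase set \<Rightarrow> real \<Rightarrow> 'm set" where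
  "sheet \<sigma> \<rho> \<xi> W\<^sub>0 s = \<xi> ` (Lambda'_sheet \<sigma> \<rho> s \<inter> W\<^sub>0)"

text \<open>The two families of resolutions of \<open>p\<close> are indexed by the two orderings of the sheets.\<close>

definition sheet_orderings ::
  "(real \<Rightarrow> real) \<Rightarrow> (real \<Rightarrow> real) \<Rightarrow> ('n::finite phase \<Rightarrow> 'm) \<Rightarrow> 'n phase set \<Rightarrow>
   ('m set \<times> 'm set) set" where
  "sheet_orderings \<sigma> \<rho> \<xi> W\<^sub>0 =
     {(sheet \<sigma> \<rho> \<xi> W\<^sub>0 1, sheet \<sigma> \<rho> \<xi> W\<^sub>0 (-1)), (sheet \<sigma> \<rho> \<xi> W\<^sub>0 (-1), sheet \<sigma> \<rho> \<xi> W\<^sub>0 1)}"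

end

theory Submission
  imports Defs
begin

text \<open>Everything in the local model is invariant under rotation: \<open>\<Lambda>\<close>, the handles and the small
  resolutions of \<open>\<Lambda>'\<close> are all of the form \<open>{(a x, b x) | (a, b) on a plane curve, |x| = 1}\<close>, and any
  such set is Lagrangian. Hence Lagrangian isotopies can be read off from isotopies of profile curves,
  with no area constraint. Near the origin \<open>\<Lambda>'\<close> has profile \<open>y = \<plusminus>3 r sqrt (\<epsilon> + r\<^sup>2)\<close>, a cross; the
  profile of \<open>\<Lambda>\<close> runs through its right quadrant, which is the quadrant filled by a handle for
  the ordering \<open>(\<lambda>\<^sub>+, \<lambda>\<^sub>-)\<close>. After division by the positive factor \<open>f\<^sub>1'\<close>, where \<open>F\<^sub>1 = f\<^sub>1\<^bsup>3/2\<^esup>\<close>, the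
  slope \<open>y / r\<close> is monotone along a small resolution as well as along \<open>\<Lambda>\<close>, so that the two can be joined by
  interpolating \<open>r\<^sup>2\<close> as a function of the slope. The other end of the cobordism is by construction
  a resolution for the ordering \<open>(\<lambda>\<^sub>-, \<lambda>\<^sub>+)\<close>, once the Darboux splitting is restricted to the
  slice \<open>x\<^sub>0 = 1\<close>.\<close>

section \<open>Calculus of smooth maps\<close>

text \<open>The reduced slope \<open>m\<close>, not the radius, is the parameter: each profile comes
  in along one arm and leaves along the other, so neither is a graph over r. The division by
  \<open>f1'\<close> is forced, since the bare slope along an arm of \<Lambda>' is 3 sqrt(f1) f1' up
  to sign, and the model says nothing about monotonicity of f1', whereas f1 is increasing. In terms
  of \<open>m\<close> the profile of \<Lambda> is r^2 = 1 + m^2; beyond r^2 = 1 + 2\<epsilon> the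
  resolution satisfies the same equation, so the interpolation is stationary there and the isotopy
  has compact support. The delicate point is monotonicity of \<open>m\<close> in the bend of the
  handle, a polynomial inequality that holds for handles small compared with \<epsilon>. At the
  other end, isotropy is inherited from the cobordism but embeddedness has to be proved. Near the
  double point it comes from the handle; elsewhere from the remark that \<Lambda>' coincides, off
  any small ball around the origin, with a resolution that is itself a rotated plane curve.\<close>

lemma Ck_on_cong:
  assumes "open S" "\<And>x. x \<in> S \<Longrightarrow> f x = g x"
  shows "Ck_on k f S \<longleftrightarrow> Ck_on k g S"
  using assms(2)
proof (induction k arbitrary: f g)
  case 0
  then show ?case by (auto cong: continuous_on_cong)
next
  case (Suc k)
  have ev: "eventually (\<lambda>y. f y = g y) (at x)" if "x \<in> S" for x
    using that Suc.prems assms(1) eventually_at_topological by blast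
  have hd: "(f has_derivative D) (at x) \<longleftrightarrow> (g has_derivative D) (at x)" if "x \<in> S" for x D
    using that Suc.prems assms(1) by (metis has_derivative_transform_within_open)
  have "f differentiable_on S \<longleftrightarrow> g differentiable_on S"
    unfolding differentiable_on_eq_differentiable_at[OF assms(1)]
    unfolding differentiable_def using hd by blast
  moreover have "frechet_derivative f (at x) = frechet_derivative g (at x)" if "x \<in> S" for x
    unfolding frechet_derivative_def using hd[OF that] by simp
  then have "Ck_on k (\<lambda>x. frechet_derivative f (at x) v) S \<longleftrightarrow>
      Ck_on k (\<lambda>x. frechet_derivative g (at x) v) S" for v
    by (intro Suc.IH) auto
  ultimately show ?case by simp
qed

lemma Ck_on_subset:
  assumes "Ck_on k f S" "T \<subseteq> S"
  shows "Ck_on k f T"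
  using assms(1)
proof (induction k arbitrary: f)
  case 0
  then show ?case using assms(2) continuous_on_subset by auto
next
  case (Suc k)
  then show ?case using assms(2) differentiable_on_subset by auto
qed

lemma Ck_on_Suc_imp: "Ck_on (Suc k) f S \<Longrightarrow> Ck_on k f S"
proof (induction k arbitrary: f)
  case 0
  then show ?case by (simp add: differentiable_imp_continuous_on)
next
  case (Suc k)
  then show ?case by simp
qed

text \<open>Replaces the \<open>frechet_derivative\<close> of the definition by a derivative formula
  of one's choice; the inductions below go through it.\<close>

lemma Ck_on_SucI:
  assumes "open S" "\<And>x. x \<in> S \<Longrightarrow> (f has_derivative D x) (at x)"
    "\<And>v. Ck_on k (\<lambda>x. D x v) S"
  shows "Ck_on (Suc k) f S"
proof -
  have "f differentiable_on S"
    using assms(1,2) differentiable_on_eq_differentiable_at differentiable_def by blast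
  moreover have "Ck_on k (\<lambda>x. frechet_derivative f (at x) v) S" for v
    using assms(3) Ck_on_cong[OF assms(1), of "\<lambda>x. frechet_derivative f (at x) v" "\<lambda>x. D x v"]
      frechet_derivative_at[OF assms(2)] by simp
  ultimately show ?thesis by simp
qed

lemma Ck_on_SucD:
  assumes "open S" "Ck_on (Suc k) f S" "x \<in> S"
  shows "(f has_derivative frechet_derivative f (at x)) (at x)"
  using assms by (metis Ck_on.simps(2) differentiable_on_eq_differentiable_at frechet_derivative_works)

lemma Ck_on_const: "open S \<Longrightarrow> Ck_on k (\<lambda>x. c) S"
proof (induction k arbitrary: c)
  case (Suc k)
  then show ?case by (intro Ck_on_SucI[where D="\<lambda>x v. 0"]) auto
qed auto

lemma Ck_on_bounded_linear: "open S \<Longrightarrow> bounded_linear f \<Longrightarrow> Ck_on k f S"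
proof (cases k)
  case (Suc k')
  assume "open S" "bounded_linear f"
  then show ?thesis unfolding Suc
    by (intro Ck_on_SucI[where D="\<lambda>x. f"] Ck_on_const) (auto intro: bounded_linear_imp_has_derivative)
qed (auto intro: linear_continuous_on)

lemma Ck_on_linear_compose:
  assumes "open S" "bounded_linear h" "Ck_on k f S"
  shows "Ck_on k (\<lambda>x. h (f x)) S"
  using assms(3)
proof (induction k arbitrary: f)
  case 0
  then show ?case using assms(2) by (simp add: bounded_linear.continuous_on)
next
  case (Suc k)
  show ?case
  proof (rule Ck_on_SucI[OF assms(1)])
    show "((\<lambda>x. h (f x)) has_derivative (\<lambda>v. h (frechet_derivative f (at x) v))) (at x)" if "x \<in> S" for x
      using bounded_linear.has_derivative[OF assms(2) Ck_on_SucD[OF assms(1) Suc.prems that]] .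
    show "Ck_on k (\<lambda>x. h (frechet_derivative f (at x) v)) S" for v
      using Suc by simp
  qed
qed

lemma Ck_on_add:
  assumes "open S" "Ck_on k f S" "Ck_on k g S"
  shows "Ck_on k (\<lambda>x. f x + g x) S"
  using assms(2,3)
proof (induction k arbitrary: f g)
  case 0
  then show ?case by (simp add: continuous_on_add)
next
  case (Suc k)
  show ?case
  proof (rule Ck_on_SucI[OF assms(1)])
    show "((\<lambda>x. f x + g x) has_derivative
       (\<lambda>v. frechet_derivative f (at x) v + frechet_derivative g (at x) v)) (at x)" if "x \<in> S" for x
      using Ck_on_SucD[OF assms(1) Suc.prems(1) that] Ck_on_SucD[OF assms(1) Suc.prems(2) that]
      by (rule has_derivative_add)
    show "Ck_on k (\<lambda>x. frechet_derivative f (at x) v + frechet_derivative g (at x) v) S" for v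
      using Suc by simp
  qed
qed

lemma Ck_on_sum:
  assumes "open S" "\<And>i. i \<in> I \<Longrightarrow> Ck_on k (f i) S"
  shows "Ck_on k (\<lambda>x. \<Sum>i\<in>I. f i x) S"
  using assms(2)
  by (induction I rule: infinite_finite_induct) (auto intro!: Ck_on_const Ck_on_add assms(1))

lemma Ck_on_bilinear:
  assumes "open S" "bounded_bilinear h" "Ck_on k f S" "Ck_on k g S"
  shows "Ck_on k (\<lambda>x. h (f x) (g x)) S"
  using assms(3,4)
proof (induction k arbitrary: f g)
  case 0
  then show ?case using assms(2) by (simp add: bounded_bilinear.continuous_on)
next
  case (Suc k)
  show ?case
  proof (rule Ck_on_SucI[OF assms(1)])
    show "((\<lambda>x. h (f x) (g x)) has_derivative
       (\<lambda>v. h (f x) (frechet_derivative g (at x) v) + h (frechet_derivative f (at x) v) (g x))) (at x)"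
      if "x \<in> S" for x
      using bounded_bilinear.FDERIV[OF assms(2) Ck_on_SucD[OF assms(1) Suc.prems(1) that]
          Ck_on_SucD[OF assms(1) Suc.prems(2) that]] .
    show "Ck_on k (\<lambda>x. h (f x) (frechet_derivative g (at x) v) + h (frechet_derivative f (at x) v) (g x)) S" for v
      using Suc Ck_on_Suc_imp[OF Suc.prems(1)] Ck_on_Suc_imp[OF Suc.prems(2)]
      by (intro Ck_on_add assms(1)) auto
  qed
qed

lemma linear_sum_Basis:
  fixes v :: "'b::euclidean_space"
  assumes "linear T"
  shows "T v = (\<Sum>b\<in>Basis. (v \<bullet> b) *\<^sub>R T b)"
proof -
  have "T v = T (\<Sum>b\<in>Basis. (v \<bullet> b) *\<^sub>R b)" by (simp add: euclidean_representation)
  also have "\<dots> = (\<Sum>b\<in>Basis. (v \<bullet> b) *\<^sub>R T b)"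
    using assms by (simp add: linear_sum linear_scale)
  finally show ?thesis .
qed

text \<open>In the chain rule the outer derivative is applied to a direction that depends on x,
  while \<open>Ck_on\<close> speaks of fixed directions. Expanding that direction over the basis of
  the middle space leaves fixed directions and smooth coefficients.\<close>

lemma Ck_on_compose:
  fixes f :: "'a::real_normed_vector \<Rightarrow> 'b::euclidean_space" and g :: "'b \<Rightarrow> 'c::real_normed_vector"
  assumes "open S" "open T" "Ck_on k f S" "Ck_on k g T" "f ` S \<subseteq> T"
  shows "Ck_on k (\<lambda>x. g (f x)) S"
  using assms(3,4)
proof (induction k arbitrary: g)
  case 0
  then show ?case using assms(5) by (simp add: continuous_on_compose2)
next
  case (Suc k)
  let ?D = "\<lambda>x v. \<Sum>b\<in>Basis. (frechet_derivative f (at x) v \<bullet> b) *\<^sub>R frechet_derivative g (at (f x)) b"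
  show ?case
  proof (rule Ck_on_SucI[OF assms(1), where D="?D"])
    fix x assume x: "x \<in> S"
    note df = Ck_on_SucD[OF assms(1) Suc.prems(1) x]
    have dg: "(g has_derivative frechet_derivative g (at (f x))) (at (f x))"
      using Ck_on_SucD[OF assms(2) Suc.prems(2)] x assms(5) by auto
    have "frechet_derivative g (at (f x)) (frechet_derivative f (at x) v) = ?D x v" for v
      using linear_sum_Basis has_derivative_linear[OF dg] by blast
    then show "((\<lambda>x. g (f x)) has_derivative ?D x) (at x)"
      using has_derivative_compose[OF df dg] by presburger
  next
    fix v
    show "Ck_on k (\<lambda>x. ?D x v) S"
    proof (intro Ck_on_sum Ck_on_bilinear[OF _ bounded_bilinear_scaleR] assms(1))
      fix b :: 'b
      show "Ck_on k (\<lambda>x. frechet_derivative f (at x) v \<bullet> b) S"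
        using Suc.prems by (intro Ck_on_linear_compose[OF assms(1) bounded_linear_inner_left]) auto
      show "Ck_on k (\<lambda>x. frechet_derivative g (at (f x)) b) S"
        using Suc.prems by (intro Suc.IH) (auto intro: Ck_on_Suc_imp[OF Suc.prems(1)])
    qed
  qed
qed

lemma Ck_on_local:
  assumes "\<And>x. x \<in> S \<Longrightarrow> \<exists>U. open U \<and> x \<in> U \<and> Ck_on k f U"
  shows "Ck_on k f S"
proof -
  show ?thesis
    using assms
  proof (induction k arbitrary: f)
    case 0
    show ?case
      unfolding Ck_on.simps continuous_on_eq_continuous_within
    proof
      fix x assume "x \<in> S"
      then obtain U where "open U" "x \<in> U" "continuous_on U f" using 0 by auto
      then have "isCont f x" by (simp add: continuous_on_eq_continuous_at)
      then show "continuous (at x within S) f" by (rule continuous_at_imp_continuous_at_within)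
    qed
  next
    case (Suc k)
    have "f differentiable_on S"
      unfolding differentiable_on_def
    proof
      fix x assume "x \<in> S"
      then obtain U where "open U" "x \<in> U" "Ck_on (Suc k) f U" using Suc.prems by blast
      then have "f differentiable (at x)"
        using differentiable_on_eq_differentiable_at by auto
      then show "f differentiable (at x within S)" by (rule differentiable_at_withinI)
    qed
    moreover have "Ck_on k (\<lambda>x. frechet_derivative f (at x) v) S" for v
    proof (rule Suc.IH)
      fix x assume "x \<in> S"
      then obtain U where "open U" "x \<in> U" "Ck_on (Suc k) f U" using Suc.prems by blast
      then show "\<exists>U. open U \<and> x \<in> U \<and> Ck_on k (\<lambda>x. frechet_derivative f (at x) v) U"
        by (intro exI[of _ U]) simp
    qed
    ultimately show ?case by simp
  qed
qed

section \<open>Smoothness on arbitrary sets\<close>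

lemma smooth_on_open:
  assumes "open S"
  shows "smooth_on S f \<longleftrightarrow> (\<forall>k. Ck_on k f S)"
proof
  assume f: "smooth_on S f"
  show "\<forall>k. Ck_on k f S"
  proof
    fix k show "Ck_on k f S"
    proof (rule Ck_on_local)
      fix x assume "x \<in> S"
      then obtain U g where U: "open U" "x \<in> U" "\<And>k. Ck_on k g U" "\<forall>y\<in>S \<inter> U. f y = g y"
        using f unfolding smooth_on_def by blast
      then have "Ck_on k f (S \<inter> U)"
        using assms by (subst Ck_on_cong[where g=g]) (auto intro: Ck_on_subset)
      then show "\<exists>U. open U \<and> x \<in> U \<and> Ck_on k f U"
        using U \<open>x \<in> S\<close> assms by blast
    qed
  qed
qed (use assms in \<open>auto simp: smooth_on_def\<close>)

lemma smooth_on_subset: "smooth_on S f \<Longrightarrow> T \<subseteq> S \<Longrightarrow> smooth_on T f"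
  unfolding smooth_on_def by (intro ballI, drule bspec, erule subsetD, assumption) blast

lemma smooth_on_cong:
  assumes "\<And>x. x \<in> S \<Longrightarrow> f x = g x"
  shows "smooth_on S f \<longleftrightarrow> smooth_on S g"
  unfolding smooth_on_def using assms by (metis IntD1)

lemma smooth_on_local:
  assumes "\<And>x. x \<in> S \<Longrightarrow> \<exists>U. open U \<and> x \<in> U \<and> smooth_on (S \<inter> U) f"
  shows "smooth_on S f"
  unfolding smooth_on_def
proof
  fix x assume x: "x \<in> S"
  then obtain U where U: "open U" "x \<in> U" "smooth_on (S \<inter> U) f" using assms by blast
  then obtain V g where "open V" "x \<in> V" "\<forall>k. Ck_on k g V" "\<forall>y\<in>S \<inter> U \<inter> V. f y = g y"
    using x unfolding smooth_on_def by blast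
  with U show "\<exists>U g. open U \<and> x \<in> U \<and> (\<forall>k. Ck_on k g U) \<and> (\<forall>y\<in>S \<inter> U. f y = g y)"
    by (intro exI[of _ "U \<inter> V"] exI[of _ g]) (auto intro: Ck_on_subset)
qed

text \<open>Transfers a closure rule from open sets to arbitrary ones: the two local extensions have
  different domains, and the rule is applied on their intersection.\<close>

lemma smooth_on_lift2:
  fixes f :: "'a::real_normed_vector \<Rightarrow> 'b::real_normed_vector" and g :: "'a \<Rightarrow> 'c::real_normed_vector"
  assumes "\<And>(U::'a set) F G. open U \<Longrightarrow> \<forall>k. Ck_on k F U \<Longrightarrow> \<forall>k. Ck_on k G U \<Longrightarrow> \<forall>k. Ck_on k (\<lambda>x. h (F x) (G x)) U"
    and "smooth_on S f" "smooth_on S g"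
  shows "smooth_on S (\<lambda>x. h (f x) (g x))"
  unfolding smooth_on_def
proof
  fix x assume x: "x \<in> S"
  obtain U F where U: "open U" "x \<in> U" "\<forall>k. Ck_on k F U" "\<forall>y\<in>S \<inter> U. f y = F y"
    using assms(2) x unfolding smooth_on_def by blast
  obtain V G where V: "open V" "x \<in> V" "\<forall>k. Ck_on k G V" "\<forall>y\<in>S \<inter> V. g y = G y"
    using assms(3) x unfolding smooth_on_def by blast
  have "\<forall>k. Ck_on k (\<lambda>x. h (F x) (G x)) (U \<inter> V)"
    by (rule assms(1)) (use U V in \<open>auto intro: Ck_on_subset\<close>)
  then show "\<exists>U k. open U \<and> x \<in> U \<and> (\<forall>j. Ck_on j k U) \<and> (\<forall>y\<in>S \<inter> U. h (f y) (g y) = k y)"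
    using U V by (intro exI[of _ "U \<inter> V"] exI[of _ "\<lambda>x. h (F x) (G x)"]) auto
qed

lemma smooth_on_bilinear:
  "bounded_bilinear h \<Longrightarrow> smooth_on S f \<Longrightarrow> smooth_on S g \<Longrightarrow> smooth_on S (\<lambda>x. h (f x) (g x))"
  by (rule smooth_on_lift2) (auto intro: Ck_on_bilinear)

lemma smooth_on_const: "smooth_on S (\<lambda>x. c)"
  unfolding smooth_on_def by (auto intro!: exI[of _ UNIV] exI[of _ "\<lambda>x. c"] Ck_on_const)

lemma smooth_on_linear: "bounded_linear f \<Longrightarrow> smooth_on S f"
  unfolding smooth_on_def by (auto intro!: exI[of _ UNIV] exI[of _ f] Ck_on_bounded_linear)

lemma smooth_on_imp_continuous_on:
  assumes "smooth_on S f" shows "continuous_on S f"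
  unfolding continuous_on_eq_continuous_within
proof
  fix x assume x: "x \<in> S"
  then obtain U g where U: "open U" "x \<in> U" "\<forall>k. Ck_on k g U" "\<forall>y\<in>S \<inter> U. f y = g y"
    using assms unfolding smooth_on_def by blast
  then have "continuous_on U g" by (metis Ck_on.simps(1))
  then have "continuous (at x within S) g"
    using U continuous_on_eq_continuous_at continuous_at_imp_continuous_at_within by blast
  moreover have "eventually (\<lambda>y. g y = f y) (at x within S)"
    using U eventually_at_topological by (metis (mono_tags, lifting) IntI)
  ultimately show "continuous (at x within S) f"
    using U x by (auto simp: continuous_within intro: Lim_transform_eventually)
qed

lemma smooth_on_compose:
  fixes f :: "'a::real_normed_vector \<Rightarrow> 'b::euclidean_space" and g :: "'b \<Rightarrow> 'c::real_normed_vector"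
  assumes "smooth_on S f" "smooth_on T g" "f ` S \<subseteq> T"
  shows "smooth_on S (\<lambda>x. g (f x))"
  unfolding smooth_on_def
proof
  fix x assume x: "x \<in> S"
  then obtain U F where U: "open U" "x \<in> U" "\<forall>k. Ck_on k F U" "\<forall>y\<in>S \<inter> U. f y = F y"
    using assms(1) unfolding smooth_on_def by blast
  have "f x \<in> T" using assms(3) x by blast
  then obtain V G where V: "open V" "f x \<in> V" "\<forall>k. Ck_on k G V" "\<forall>y\<in>T \<inter> V. g y = G y"
    using assms(2) unfolding smooth_on_def by blast
  let ?N = "U \<inter> F -` V"
  have "continuous_on U F" using U by (metis Ck_on.simps(1))
  then have N: "open ?N" using U V by (simp add: continuous_open_preimage)
  have "x \<in> ?N" using U V x by auto
  moreover have "Ck_on k (\<lambda>x. G (F x)) ?N" for k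
    using Ck_on_compose[OF N V(1) Ck_on_subset[OF U(3)[rule_format]] V(3)[rule_format]] by auto
  moreover have "\<forall>y\<in>S \<inter> ?N. g (f y) = G (F y)"
  proof
    fix y assume y: "y \<in> S \<inter> ?N"
    then have fy: "f y = F y" using U by auto
    then have "f y \<in> T \<inter> V" using y assms(3) by auto
    then show "g (f y) = G (F y)" using V fy by auto
  qed
  ultimately show "\<exists>U h. open U \<and> x \<in> U \<and> (\<forall>k. Ck_on k h U) \<and> (\<forall>y\<in>S \<inter> U. g (f y) = h y)"
    using N by (intro exI[of _ ?N] exI[of _ "\<lambda>x. G (F x)"]) auto
qed

lemma smooth_on_linear_compose:
  assumes "bounded_linear h" "smooth_on S f"
  shows "smooth_on S (\<lambda>x. h (f x))"
  by (rule smooth_on_lift2[where h="\<lambda>a b. h a" and g=f])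
    (use assms in \<open>auto intro: Ck_on_linear_compose\<close>)

named_theorems smooth_intros

lemma smooth_on_add[smooth_intros]:
  "smooth_on S f \<Longrightarrow> smooth_on S g \<Longrightarrow> smooth_on S (\<lambda>x. f x + g x)"
  by (rule smooth_on_lift2) (auto intro: Ck_on_add)

lemma smooth_on_scaleR[smooth_intros]:
  "smooth_on S f \<Longrightarrow> smooth_on S g \<Longrightarrow> smooth_on S (\<lambda>x. f x *\<^sub>R g x)"
  by (rule smooth_on_bilinear[OF bounded_bilinear_scaleR])

lemma smooth_on_mult[smooth_intros]:
  fixes f g :: "_ \<Rightarrow> real"
  shows "smooth_on S f \<Longrightarrow> smooth_on S g \<Longrightarrow> smooth_on S (\<lambda>x. f x * g x)"
  by (rule smooth_on_bilinear[OF bounded_bilinear_mult])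

lemma smooth_on_inner[smooth_intros]:
  "smooth_on S f \<Longrightarrow> smooth_on S g \<Longrightarrow> smooth_on S (\<lambda>x. f x \<bullet> g x)"
  by (rule smooth_on_bilinear[OF bounded_bilinear_inner])

lemma smooth_on_minus[smooth_intros]: "smooth_on S f \<Longrightarrow> smooth_on S (\<lambda>x. - f x)"
  by (rule smooth_on_linear_compose[OF bounded_linear_minus[OF bounded_linear_ident]])

lemma smooth_on_diff[smooth_intros]:
  "smooth_on S f \<Longrightarrow> smooth_on S g \<Longrightarrow> smooth_on S (\<lambda>x. f x - g x)"
  using smooth_on_add[OF _ smooth_on_minus] by fastforce

lemma smooth_on_ident[smooth_intros]: "smooth_on S (\<lambda>x. x)"
  by (rule smooth_on_linear[OF bounded_linear_ident])

lemma smooth_on_fst[smooth_intros]: "smooth_on S f \<Longrightarrow> smooth_on S (\<lambda>x. fst (f x))"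
  by (rule smooth_on_linear_compose[OF bounded_linear_fst])

lemma smooth_on_snd[smooth_intros]: "smooth_on S f \<Longrightarrow> smooth_on S (\<lambda>x. snd (f x))"
  by (rule smooth_on_linear_compose[OF bounded_linear_snd])

lemma smooth_on_Pair[smooth_intros]:
  assumes "smooth_on S f" "smooth_on S g"
  shows "smooth_on S (\<lambda>x. (f x, g x))"
proof -
  have "smooth_on S (\<lambda>x. (f x, 0) + (0, g x))"
    by (intro smooth_on_add smooth_on_linear_compose[OF _ assms(1)] smooth_on_linear_compose[OF _ assms(2)]
        bounded_linear_Pair bounded_linear_ident bounded_linear_zero)
  then show ?thesis by simp
qed

lemmas [smooth_intros] = smooth_on_const

text \<open>The derivative is a product of copies of the function itself, so being C^k gives being
  C^(k+1). The square root below is bootstrapped in the same way.\<close>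

lemma smooth_on_inverse_real: "smooth_on {x::real. x \<noteq> 0} inverse"
proof -
  have op: "open {x::real. x \<noteq> 0}"
    by (simp add: open_Collect_neq)
  have "Ck_on k (inverse :: real \<Rightarrow> real) {x. x \<noteq> 0}" for k
  proof (induction k)
    case (Suc k)
    show ?case
    proof (rule Ck_on_SucI[OF op, where D="\<lambda>x v. - (inverse x * v * inverse x)"])
      show "(inverse has_derivative (\<lambda>v. - (inverse x * v * inverse x))) (at x)" if "x \<in> {x. x \<noteq> 0}" for x :: real
        using that has_derivative_inverse'[of x UNIV] by auto
      show "Ck_on k (\<lambda>x. - (inverse x * v * inverse x)) {x. x \<noteq> 0}" for v :: real
        by (intro Ck_on_linear_compose[OF op bounded_linear_minus[OF bounded_linear_ident]]
            Ck_on_bilinear[OF op bounded_bilinear_mult] Suc Ck_on_const op)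
    qed
  qed (auto intro: continuous_intros)
  then show ?thesis using smooth_on_open op by blast
qed

lemma smooth_on_inverse[smooth_intros]:
  fixes f :: "_ \<Rightarrow> real"
  assumes "smooth_on S f" "\<And>x. x \<in> S \<Longrightarrow> f x \<noteq> 0"
  shows "smooth_on S (\<lambda>x. inverse (f x))"
  by (rule smooth_on_compose[OF assms(1) smooth_on_inverse_real]) (use assms(2) in auto)

lemma smooth_on_divide[smooth_intros]:
  fixes f g :: "_ \<Rightarrow> real"
  assumes "smooth_on S f" "smooth_on S g" "\<And>x. x \<in> S \<Longrightarrow> g x \<noteq> 0"
  shows "smooth_on S (\<lambda>x. f x / g x)"
  unfolding divide_inverse by (intro smooth_intros assms)

lemma smooth_on_sqrt_real: "smooth_on {0<..} sqrt"
proof -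
  have op: "open {0::real<..}" by simp
  have "Ck_on k sqrt {0<..}" for k
  proof (induction k)
    case (Suc k)
    show ?case
    proof (rule Ck_on_SucI[OF op, where D="\<lambda>x v. v * (inverse (sqrt x) / 2)"])
      show "(sqrt has_derivative (\<lambda>v. v * (inverse (sqrt x) / 2))) (at x)" if "x \<in> {0<..}" for x :: real
        using that DERIV_real_sqrt[of x] by (auto simp: has_field_derivative_def elim!: has_derivative_eq_rhs)
      have "Ck_on k (\<lambda>x. inverse (sqrt x)) {0<..}"
      proof (rule Ck_on_compose[OF op _ Suc])
        show "open {x::real. x \<noteq> 0}" by (simp add: open_Collect_neq)
        then show "Ck_on k (inverse :: real \<Rightarrow> real) {x. x \<noteq> 0}"
          using smooth_on_inverse_real smooth_on_open by blast
      qed auto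
      then show "Ck_on k (\<lambda>x. v * (inverse (sqrt x) / 2)) {0<..}" for v :: real
        by (intro Ck_on_bilinear[OF op bounded_bilinear_mult] Ck_on_const op
            Ck_on_linear_compose[OF op bounded_linear_divide])
    qed
  qed (auto intro: continuous_intros)
  then show ?thesis using smooth_on_open op by blast
qed

lemma smooth_on_sqrt[smooth_intros]:
  assumes "smooth_on S f" "\<And>x. x \<in> S \<Longrightarrow> f x > 0"
  shows "smooth_on S (\<lambda>x. sqrt (f x))"
  by (rule smooth_on_compose[OF assms(1) smooth_on_sqrt_real]) (use assms(2) in auto)

lemma smooth_on_power2[smooth_intros]:
  fixes f :: "_ \<Rightarrow> real"
  shows "smooth_on S f \<Longrightarrow> smooth_on S (\<lambda>x. (f x)\<^sup>2)"
  unfolding power2_eq_square by (intro smooth_intros)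

lemma smooth_on_norm[smooth_intros]:
  fixes f :: "_ \<Rightarrow> 'b::real_inner"
  assumes "smooth_on S f" "\<And>x. x \<in> S \<Longrightarrow> f x \<noteq> 0"
  shows "smooth_on S (\<lambda>x. norm (f x))"
  unfolding norm_eq_sqrt_inner by (intro smooth_intros assms) (simp add: assms(2))

lemma smooth_on_imp_differentiable:
  "smooth_on S f \<Longrightarrow> open S \<Longrightarrow> x \<in> S \<Longrightarrow> f differentiable (at x)"
  by (metis Ck_on.simps(2) differentiable_on_eq_differentiable_at smooth_on_open)

lemma smooth_on_frechet_derivative:
  "smooth_on S f \<Longrightarrow> open S \<Longrightarrow> smooth_on S (\<lambda>x. frechet_derivative f (at x) v)"
  using smooth_on_open by (metis Ck_on.simps(2))

lemma smooth_on_deriv: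
  fixes f :: "real \<Rightarrow> real"
  assumes "smooth_on S f" "open S"
  shows "smooth_on S (deriv f)"
proof -
  have "deriv f x = frechet_derivative f (at x) 1" if "x \<in> S" for x
    using smooth_on_imp_differentiable[OF assms that]
    by (metis DERIV_deriv_iff_real_differentiable frechet_derivative_at has_field_derivative_def mult.right_neutral)
  then show ?thesis
    using smooth_on_cong[of S "deriv f" "\<lambda>x. frechet_derivative f (at x) 1"]
      smooth_on_frechet_derivative[OF assms, of 1] by simp
qed

section \<open>The inverse function theorem for smooth maps\<close>

text \<open>Because f vanishes at x, continuity of g suffices: f y (g y - g x) is a product of an
  O(|y - x|) and an o(1). This is how inverse matrices are differentiated, where only their
  continuity is known at first.\<close>

lemma has_derivative_vanishing_scaleR:
  fixes f :: "'a::real_normed_vector \<Rightarrow> real" and g :: "'a \<Rightarrow> 'b::real_normed_vector"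
  assumes "(f has_derivative f') (at x)" "f x = 0" "isCont g x"
  shows "((\<lambda>y. f y *\<^sub>R g y) has_derivative (\<lambda>v. f' v *\<^sub>R g x)) (at x)"
proof -
  have bl: "bounded_linear f'" using assms(1) by (rule has_derivative_bounded_linear)
  have "((\<lambda>y. f y *\<^sub>R g x) has_derivative (\<lambda>v. f' v *\<^sub>R g x)) (at x)"
    using bounded_linear.has_derivative[OF bounded_linear_scaleR_left assms(1)] .
  moreover have "((\<lambda>y. f y *\<^sub>R (g y - g x)) has_derivative (\<lambda>v. 0)) (at x)"
  proof -
    \<comment> \<open>With \<open>f'\<close> bounded by \<open>B\<close>, |f y| is at most (o(1) +
      B) |y - x|; the other factor g y - g x tends to 0.\<close>
    obtain B where B: "B > 0" "\<And>v. norm (f' v) \<le> norm v * B"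
      using bounded_linear.pos_bounded[OF bl] by blast
    have lim0: "(\<lambda>y. norm (f y - f x - f' (y - x)) / norm (y - x)) \<midarrow>x\<rightarrow> 0"
      using assms(1) unfolding has_derivative_iff_norm by blast
    have gl: "(\<lambda>y. norm (g y - g x)) \<midarrow>x\<rightarrow> 0"
      using assms(3) by (simp add: isCont_def LIM_zero tendsto_norm_zero)
    have "(\<lambda>y. (norm (f y - f x - f' (y - x)) / norm (y - x) + B) * norm (g y - g x)) \<midarrow>x\<rightarrow> (0 + B) * 0"
      by (intro tendsto_intros lim0 gl)
    then have "(\<lambda>y. (norm (f y - f x - f' (y - x)) / norm (y - x) + B) * norm (g y - g x)) \<midarrow>x\<rightarrow> 0"
      by simp
    then have "(\<lambda>y. norm (f y *\<^sub>R (g y - g x)) / norm (y - x)) \<midarrow>x\<rightarrow> 0"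
    proof (rule tendsto_sandwich[OF _ _ tendsto_const, rotated 2])
      show "\<forall>\<^sub>F y in at x. norm (f y *\<^sub>R (g y - g x)) / norm (y - x)
        \<le> (norm (f y - f x - f' (y - x)) / norm (y - x) + B) * norm (g y - g x)"
      proof (rule eventually_at_topological[THEN iffD2], intro exI[of _ UNIV] conjI ballI impI)
        fix y assume "y \<noteq> x"
        have "\<bar>f y\<bar> \<le> norm (f y - f x - f' (y - x)) + norm (f' (y - x))"
          using assms(2) norm_triangle_ineq[of "f y - f' (y - x)" "f' (y - x)"] by simp
        also have "\<dots> \<le> norm (f y - f x - f' (y - x)) + norm (y - x) * B" using B by simp
        finally have "\<bar>f y\<bar> / norm (y - x) \<le> norm (f y - f x - f' (y - x)) / norm (y - x) + B"
          using \<open>y \<noteq> x\<close> by (simp add: field_simps)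
        then have "\<bar>f y\<bar> / norm (y - x) * norm (g y - g x) \<le>
          (norm (f y - f x - f' (y - x)) / norm (y - x) + B) * norm (g y - g x)"
          by (rule mult_right_mono) simp
        then show "norm (f y *\<^sub>R (g y - g x)) / norm (y - x)
          \<le> (norm (f y - f x - f' (y - x)) / norm (y - x) + B) * norm (g y - g x)" by simp
      qed auto
    qed auto
    then show ?thesis by (simp add: has_derivative_iff_norm assms(2))
  qed
  ultimately have "((\<lambda>y. f y *\<^sub>R g x + f y *\<^sub>R (g y - g x)) has_derivative (\<lambda>v. f' v *\<^sub>R g x + 0)) (at x)"
    by (rule has_derivative_add)
  then show ?thesis by (simp add: scaleR_right_diff_distrib)
qed

text \<open>For fixed x one has B y v = B x v - B y (k y) with k y = A y (B x v) - v, and k x = 0.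
  By the product rule for a vanishing factor, continuity of the columns of B at x already yields the
  derivative.\<close>

lemma has_derivative_linear_inverse:
  fixes A B :: "'a::real_normed_vector \<Rightarrow> 'b::euclidean_space \<Rightarrow> 'b"
  assumes "open S" and lin: "\<And>x. x \<in> S \<Longrightarrow> linear (A x)"
    and inv: "\<And>x w. x \<in> S \<Longrightarrow> B x (A x w) = w" "\<And>x w. x \<in> S \<Longrightarrow> A x (B x w) = w"
    and der: "\<And>x w. x \<in> S \<Longrightarrow> ((\<lambda>x. A x w) has_derivative D x w) (at x)"
    and x: "x \<in> S"
  shows "((\<lambda>x. B x v) has_derivative
    (\<lambda>h. - (\<Sum>b\<in>Basis. (D x (B x v) h \<bullet> b) *\<^sub>R B x b))) (at x)"
proof -
  have linB: "linear (B y)" if "y \<in> S" for y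
  proof
    show "B y (u + w) = B y u + B y w" for u w
      using inv(1)[OF that, of "B y u + B y w"] inv(2)[OF that] linear_add[OF lin[OF that]] by simp
    show "B y (r *\<^sub>R u) = r *\<^sub>R B y u" for r u
      using inv(1)[OF that, of "r *\<^sub>R B y u"] inv(2)[OF that] linear_scale[OF lin[OF that]] by simp
  qed
  obtain c where c: "c > 0" "\<And>w. norm w \<ge> c * norm (B x w)"
  proof -
    obtain c where "c > 0" "\<And>w. norm (B x w) \<le> norm w * c"
      using bounded_linear.pos_bounded linB[OF x] linear_conv_bounded_linear by blast
    then show ?thesis using that[of "1/c"] by (simp add: field_simps)
  qed
  have Aw: "norm (A x w) \<ge> c * norm w" for w using c(2)[of "A x w"] inv(1)[OF x] by simp
  have contA: "isCont (\<lambda>y. A y w) x" for w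
    using der[OF x] has_derivative_continuous by blast
  have "(\<lambda>y. \<Sum>b\<in>Basis. norm (A y b - A x b)) \<midarrow>x\<rightarrow> (\<Sum>b\<in>(Basis::'b set). norm (A x b - A x b))"
    using contA by (intro tendsto_intros) (auto simp: isCont_def)
  then have "\<forall>\<^sub>F y in at x. (\<Sum>b\<in>Basis. norm (A y b - A x b)) < c/2"
    using c(1) by (intro order_tendstoD(2)) auto
  moreover have "\<forall>\<^sub>F y in at x. y \<in> S" using assms(1) x by (simp add: eventually_at_topological) blast
  ultimately have ev: "\<forall>\<^sub>F y in at x. y \<in> S \<and> (\<Sum>b\<in>Basis. norm (A y b - A x b)) < c/2"
    by (simp add: eventually_conj)
  \<comment> \<open>\<open>A x\<close> expands lengths by at least \<open>c\<close>. On the basis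
    \<open>A y\<close> differs from it by less than c/2 in total, so it still expands by c/2, which
    bounds the inverses uniformly near x.\<close>
  have bnd: "norm (B y w) \<le> (2/c) * norm w" if y: "y \<in> S \<and> (\<Sum>b\<in>Basis. norm (A y b - A x b)) < c/2" for y w
  proof -
    define u where "u = B y w"
    have "A y u - A x u = (\<Sum>b\<in>Basis. (u \<bullet> b) *\<^sub>R (A y b - A x b))"
      using linear_sum_Basis[OF lin, of y u] linear_sum_Basis[OF lin, of x u] x y
      by (simp add: sum_subtractf scaleR_right_diff_distrib)
    also have "norm \<dots> \<le> (\<Sum>b\<in>Basis. norm u * norm (A y b - A x b))"
      by (rule sum_norm_le) (auto simp: Basis_le_norm intro: mult_right_mono)
    also have "\<dots> \<le> norm u * (c/2)"
      unfolding sum_distrib_left[symmetric] using y by (intro mult_left_mono) auto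
    finally have "norm (A x u) \<le> norm (A y u) + norm u * (c/2)"
      using norm_triangle_ineq3 by (smt (verit) norm_triangle_sub norm_minus_commute)
    with Aw[of u] have "c * norm u \<le> norm w + norm u * (c/2)"
      using inv(2) y unfolding u_def by (metis order_trans)
    then show ?thesis using c(1) by (simp add: u_def field_simps)
  qed
  have contB: "isCont (\<lambda>y. B y w) x" for w
    unfolding isCont_def
  proof (rule Lim_transform_eventually[THEN LIM_zero_cancel, rotated])
    show "\<forall>\<^sub>F y in at x. - B y (A y (B x w) - w) = B y w - B x w"
      using ev
    proof eventually_elim
      case (elim y)
      then show ?case using inv linear_diff[OF linB, of y] by auto
    qed
    have "(\<lambda>y. A y (B x w) - w) \<midarrow>x\<rightarrow> A x (B x w) - w"
      using contA[of "B x w"] by (intro tendsto_intros) (auto simp: isCont_def)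
    then have l: "(\<lambda>y. A y (B x w) - w) \<midarrow>x\<rightarrow> 0" using inv(2)[OF x] by simp
    show "(\<lambda>y. - B y (A y (B x w) - w)) \<midarrow>x\<rightarrow> 0"
    proof (rule Lim_null_comparison)
      show "\<forall>\<^sub>F y in at x. norm (- B y (A y (B x w) - w)) \<le> (2/c) * norm (A y (B x w) - w)"
        using ev by eventually_elim (use bnd in auto)
      show "(\<lambda>y. (2/c) * norm (A y (B x w) - w)) \<midarrow>x\<rightarrow> 0"
        using tendsto_mult_right_zero[OF tendsto_norm_zero[OF l]] by blast
    qed
  qed
  define k where "k y = A y (B x v) - v" for y
  have dk: "((\<lambda>y. k y \<bullet> b) has_derivative (\<lambda>h. D x (B x v) h \<bullet> b)) (at x)" for b
    unfolding k_def by (rule derivative_eq_intros der[OF x] refl)+ simp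
  have "((\<lambda>y. B x v - (\<Sum>b\<in>Basis. (k y \<bullet> b) *\<^sub>R B y b)) has_derivative
    (\<lambda>h. 0 - (\<Sum>b\<in>Basis. (D x (B x v) h \<bullet> b) *\<^sub>R B x b))) (at x)"
    by (intro has_derivative_diff has_derivative_const has_derivative_sum
        has_derivative_vanishing_scaleR dk contB) (auto simp: k_def inv(2)[OF x])
  then have "((\<lambda>y. B x v - (\<Sum>b\<in>Basis. (k y \<bullet> b) *\<^sub>R B y b)) has_derivative
    (\<lambda>h. - (\<Sum>b\<in>Basis. (D x (B x v) h \<bullet> b) *\<^sub>R B x b))) (at x)" by simp
  then show ?thesis
  proof (rule has_derivative_transform_within_open[OF _ assms(1) x])
    fix y assume y: "y \<in> S"
    have "(\<Sum>b\<in>Basis. (k y \<bullet> b) *\<^sub>R B y b) = B y (k y)"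
      by (rule linear_sum_Basis[OF linB[OF y], symmetric])
    also have "\<dots> = B x v - B y v"
      by (simp only: k_def linear_diff[OF linB[OF y]] inv(1)[OF y])
    finally show "B x v - (\<Sum>b\<in>Basis. (k y \<bullet> b) *\<^sub>R B y b) = B y v" by simp
  qed
qed

text \<open>The derivative of \<open>x \<mapsto> A(x)\<^sup>-\<^sup>1 v\<close> is a polynomial in entries of \<open>A\<^sup>-\<^sup>1\<close> and derivatives of
  \<open>A\<close>, so smoothness is a bootstrap.\<close>

lemma smooth_on_linear_inverse:
  fixes A B :: "'a::real_normed_vector \<Rightarrow> 'b::euclidean_space \<Rightarrow> 'b"
  assumes "open S" and lin: "\<And>x. x \<in> S \<Longrightarrow> linear (A x)"
    and inv: "\<And>x w. x \<in> S \<Longrightarrow> B x (A x w) = w" "\<And>x w. x \<in> S \<Longrightarrow> A x (B x w) = w"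
    and sm: "\<And>w. smooth_on S (\<lambda>x. A x w)"
  shows "smooth_on S (\<lambda>x. B x v)"
proof -
  define D where "D x w = frechet_derivative (\<lambda>x. A x w) (at x)" for x w
  have der: "((\<lambda>x. A x w) has_derivative D x w) (at x)" if "x \<in> S" for x w
    unfolding D_def using smooth_on_imp_differentiable[OF sm assms(1) that] frechet_derivative_works by blast
  note dB = has_derivative_linear_inverse[of S A B D, OF assms(1) lin inv der]
  \<comment> \<open>The derivative of A is evaluated at \<open>B x v\<close>, which moves with x;
    the expansion reduces it to derivatives of A on fixed vectors.\<close>
  have Dlin: "D x u h = (\<Sum>c\<in>Basis. (u \<bullet> c) *\<^sub>R D x c h)" if "x \<in> S" for x u h
  proof -
    have "((\<lambda>x. \<Sum>c\<in>Basis. (u \<bullet> c) *\<^sub>R A x c) has_derivative (\<lambda>h. \<Sum>c\<in>Basis. (u \<bullet> c) *\<^sub>R D x c h)) (at x)"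
      using der[OF that] by (intro has_derivative_sum has_derivative_scaleR_right)
    then have "((\<lambda>x. A x u) has_derivative (\<lambda>h. \<Sum>c\<in>Basis. (u \<bullet> c) *\<^sub>R D x c h)) (at x)"
      by (rule has_derivative_transform_within_open[OF _ assms(1) that]) (simp add: linear_sum_Basis[OF lin, symmetric])
    then have "D x u = (\<lambda>h. \<Sum>c\<in>Basis. (u \<bullet> c) *\<^sub>R D x c h)"
      by (rule has_derivative_unique[OF der[OF that]])
    then show ?thesis by (rule fun_cong)
  qed
  have smD: "smooth_on S (\<lambda>x. D x c h)" for c h
    unfolding D_def by (rule smooth_on_frechet_derivative[OF sm assms(1)])
  have "Ck_on k (\<lambda>x. B x v) S" for k v
  proof (induction k arbitrary: v)
    case 0
    show ?case unfolding Ck_on.simps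
      using dB by (meson assms(1) continuous_at_imp_continuous_on has_derivative_continuous)
  next
    case (Suc k)
    let ?D = "\<lambda>x h. - (\<Sum>b\<in>Basis. ((\<Sum>c\<in>Basis. (B x v \<bullet> c) *\<^sub>R D x c h) \<bullet> b) *\<^sub>R B x b)"
    show ?case
    proof (rule Ck_on_SucI[OF assms(1), where D="?D"])
      show "((\<lambda>x. B x v) has_derivative ?D x) (at x)" if "x \<in> S" for x
        using dB[OF _ _ _ _ that, where v=v] unfolding Dlin[OF that, of "B x v"] by simp
      have smDk: "Ck_on k (\<lambda>x. D x c h) S" for c h using smD smooth_on_open[OF assms(1)] by blast
      show "Ck_on k (\<lambda>x. ?D x h) S" for h
        by (intro Ck_on_linear_compose[OF assms(1) bounded_linear_minus[OF bounded_linear_ident]]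
            Ck_on_sum Ck_on_bilinear[OF assms(1) bounded_bilinear_scaleR] assms(1) Suc smDk
            Ck_on_linear_compose[OF assms(1) bounded_linear_inner_left])
    qed
  qed
  then show ?thesis using smooth_on_open[OF assms(1)] by blast
qed

text \<open>The C^1 theorem supplies g with derivative \<open>B (g y)\<close>, where
  \<open>B x\<close> is the inverse of the derivative of f at x. As B is smooth, g being C^k makes
  its derivative C^k and hence g itself C^(k+1).\<close>

theorem smooth_inverse_function:
  fixes f :: "'a::euclidean_space \<Rightarrow> 'a"
  assumes "open S" "smooth_on S f" "x0 \<in> S"
    and der: "(f has_derivative T) (at x0)" and inj: "\<And>v. T v = 0 \<Longrightarrow> v = 0"
  obtains U V g where "open U" "U \<subseteq> S" "x0 \<in> U" "open V" "homeomorphism U V f g" "smooth_on V g"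
proof -
  define f' where "f' x = Blinfun (frechet_derivative f (at x))" for x
  have d: "(f has_derivative frechet_derivative f (at x)) (at x)" if "x \<in> S" for x
    using smooth_on_imp_differentiable[OF assms(2,1) that] frechet_derivative_works by blast
  have f'_app: "blinfun_apply (f' x) = frechet_derivative f (at x)" if "x \<in> S" for x
    unfolding f'_def by (rule bounded_linear_Blinfun_apply[OF has_derivative_bounded_linear[OF d[OF that]]])
  have smf': "smooth_on S (\<lambda>x. frechet_derivative f (at x) v)" for v
    by (rule smooth_on_frechet_derivative[OF assms(2,1)])
  have "continuous_on S (\<lambda>x. blinfun_apply (f' x) v)" for v
    using smooth_on_imp_continuous_on[OF smf'[of v]]
    by (rule continuous_on_eq) (simp add: f'_app)
  then have contf: "continuous_on S f'"
    by (rule continuous_on_blinfun_componentwise)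
  have Tx0: "T = blinfun_apply (f' x0)"
    using der d[OF assms(3)] f'_app[OF assms(3)] has_derivative_unique by metis
  have linT: "linear T" using der has_derivative_linear by blast
  then have "inj T" using inj linear_injective_0 by blast
  then obtain Ti where Ti: "linear Ti" "\<And>v. Ti (T v) = v"
    using linear_injective_left_inverse[OF linT] by (metis comp_apply id_apply)
  define invf where "invf = Blinfun Ti"
  have "blinfun_apply invf = Ti"
    unfolding invf_def using Ti(1) by (simp add: bounded_linear_Blinfun_apply linear_conv_bounded_linear)
  then have i: "invf o\<^sub>L f' x0 = id_blinfun"
    using Ti Tx0 by (intro blinfun_eqI) simp
  obtain U V g g' where *: "open U" "U \<subseteq> S" "x0 \<in> U" "open V" "homeomorphism U V f g"
    "\<And>y. y \<in> V \<Longrightarrow> (g has_derivative (g' y)) (at y)"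
    "\<And>y. y \<in> V \<Longrightarrow> g' y = inv (blinfun_apply (f'(g y)))"
    "\<And>y. y \<in> V \<Longrightarrow> bij (blinfun_apply (f'(g y)))"
    using inverse_function_theorem[OF assms(1) _ contf assms(3) i] d f'_app by metis
  have gV: "g ` V = U" and gU: "\<And>y. y \<in> V \<Longrightarrow> g y \<in> U" using *(5) by (auto simp: homeomorphism_def)
  define B where "B x = inv (frechet_derivative f (at x))" for x
  have bij: "bij (frechet_derivative f (at x))" if "x \<in> U" for x
    using that *(8) gV f'_app *(2) by (metis image_iff subsetD)
  have smB: "smooth_on U (\<lambda>x. B x v)" for v
  proof (rule smooth_on_linear_inverse[OF *(1), where A="\<lambda>x. frechet_derivative f (at x)"])
    show "linear (frechet_derivative f (at x))" if "x \<in> U" for x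
      using that *(2) d has_derivative_linear by blast
    show "B x (frechet_derivative f (at x) w) = w" if "x \<in> U" for x w
      unfolding B_def using bij[OF that] by (simp add: bij_is_inj inv_f_f)
    show "frechet_derivative f (at x) (B x w) = w" if "x \<in> U" for x w
      unfolding B_def using bij[OF that] by (simp add: bij_is_surj surj_f_inv_f)
    show "smooth_on U (\<lambda>x. frechet_derivative f (at x) w)" for w
      using smooth_on_subset[OF smf' *(2)] .
  qed
  have dg: "(g has_derivative (\<lambda>v. B (g y) v)) (at y)" if "y \<in> V" for y
    using *(6,7)[OF that] f'_app[of "g y"] gU[OF that] *(2) unfolding B_def by auto
  have "Ck_on k g V" for k
  proof (induction k)
    case 0
    then show ?case using *(5) by (simp add: homeomorphism_def)
  next
    case (Suc k)
    show ?case
    proof (rule Ck_on_SucI[OF *(4) dg])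
      show "Ck_on k (\<lambda>y. B (g y) v) V" for v
        using smB smooth_on_open[OF *(1)] gU by (intro Ck_on_compose[OF *(4) *(1) Suc]) auto
    qed
  qed
  then have "smooth_on V g" using smooth_on_open[OF *(4)] by blast
  with * that show ?thesis by blast
qed

section \<open>Smooth maps between manifolds\<close>

lemma smooth_map_euclid: "smooth_map euclid euclid S f \<longleftrightarrow> smooth_on S f"
proof
  assume "smooth_map euclid euclid S f"
  then show "smooth_on S f"
    by (intro smooth_on_local) (auto simp: smooth_map_def euclid_def)
next
  assume "smooth_on S f"
  then show "smooth_map euclid euclid S f"
    by (auto simp: smooth_map_def euclid_def intro!: exI[of _ UNIV])
qed

lemma smooth_map_subset:
  assumes "smooth_map A B S f" "T \<subseteq> S"
  shows "smooth_map A B T f"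
  unfolding smooth_map_def
proof
  fix x assume "x \<in> T"
  then have "x \<in> S" using assms(2) by blast
  with assms(1) obtain U \<phi> V \<psi> N where *: "(U, \<phi>) \<in> A" "(V, \<psi>) \<in> B" "open N" "x \<in> N" "N \<subseteq> U"
    "f ` (S \<inter> N) \<subseteq> V" "smooth_on (\<phi> ` (S \<inter> N)) (\<psi> \<circ> f \<circ> inv_into U \<phi>)"
    unfolding smooth_map_def by (blast dest!: bspec)
  have "smooth_on (\<phi> ` (T \<inter> N)) (\<psi> \<circ> f \<circ> inv_into U \<phi>)"
    by (rule smooth_on_subset[OF *(7)]) (use assms(2) in blast)
  moreover have "f ` (T \<inter> N) \<subseteq> V" using *(6) assms(2) by blast
  ultimately show "\<exists>(U, \<phi>)\<in>A. \<exists>(V, \<psi>)\<in>B. \<exists>N. open N \<and> x \<in> N \<and> N \<subseteq> U \<and> f ` (T \<inter> N) \<subseteq> V \<and>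
        smooth_on (\<phi> ` (T \<inter> N)) (\<psi> \<circ> f \<circ> inv_into U \<phi>)"
    using * by (intro bexI[OF _ *(1)] bexI[OF _ *(2)] case_prodI exI[of _ N]) simp
qed

lemma smooth_atlas_inj: "smooth_atlas A \<Longrightarrow> (U, \<phi>) \<in> A \<Longrightarrow> inj_on \<phi> U"
  unfolding smooth_atlas_def homeomorphism_def by (fastforce intro: inj_on_inverseI)

lemma smooth_atlas_euclid: "smooth_atlas euclid"
  by (auto simp: smooth_atlas_def euclid_def homeomorphism_def smooth_on_ident[unfolded id_def[symmetric]])

lemma smooth_map_cong:
  assumes A: "smooth_atlas A" and eq: "\<And>x. x \<in> S \<Longrightarrow> f x = g x" and f: "smooth_map A B S f"
  shows "smooth_map A B S g"
  unfolding smooth_map_def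
proof
  fix x assume "x \<in> S"
  with f obtain U \<phi> V \<psi> N where *: "(U, \<phi>) \<in> A" "(V, \<psi>) \<in> B" "open N" "x \<in> N" "N \<subseteq> U"
    "f ` (S \<inter> N) \<subseteq> V" "smooth_on (\<phi> ` (S \<inter> N)) (\<psi> \<circ> f \<circ> inv_into U \<phi>)"
    unfolding smooth_map_def by (blast dest!: bspec)
  have inj: "inj_on \<phi> U" using A *(1) by (rule smooth_atlas_inj)
  have "smooth_on (\<phi> ` (S \<inter> N)) (\<psi> \<circ> g \<circ> inv_into U \<phi>) \<longleftrightarrow> smooth_on (\<phi> ` (S \<inter> N)) (\<psi> \<circ> f \<circ> inv_into U \<phi>)"
    by (rule smooth_on_cong) (use inj *(5) eq in \<open>auto simp: inv_into_f_f[OF inj] subset_iff\<close>)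
  moreover have "g ` (S \<inter> N) = f ` (S \<inter> N)" using eq by (auto intro!: image_cong)
  ultimately show "\<exists>(U, \<phi>)\<in>A. \<exists>(V, \<psi>)\<in>B. \<exists>N. open N \<and> x \<in> N \<and> N \<subseteq> U \<and> g ` (S \<inter> N) \<subseteq> V \<and>
        smooth_on (\<phi> ` (S \<inter> N)) (\<psi> \<circ> g \<circ> inv_into U \<phi>)"
    using * by (intro bexI[OF _ *(1)] bexI[OF _ *(2)] case_prodI exI[of _ N]) auto
qed

lemma smooth_map_compose_left:
  assumes "smooth_map A euclid S f" "smooth_on T g" "f ` S \<subseteq> T"
    and A: "smooth_atlas A"
  shows "smooth_map A euclid S (\<lambda>x. g (f x))"
  unfolding smooth_map_def
proof
  fix x assume "x \<in> S"
  with assms(1) obtain U \<phi> N where *: "(U, \<phi>) \<in> A" "open N" "x \<in> N" "N \<subseteq> U"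
    "smooth_on (\<phi> ` (S \<inter> N)) (id \<circ> f \<circ> inv_into U \<phi>)"
    unfolding smooth_map_def euclid_def by (blast dest!: bspec)
  have inj: "inj_on \<phi> U" using A *(1) by (rule smooth_atlas_inj)
  have "smooth_on (\<phi> ` (S \<inter> N)) (\<lambda>y. g ((id \<circ> f \<circ> inv_into U \<phi>) y))"
    by (rule smooth_on_compose[OF *(5) assms(2)])
      (use inj *(4) assms(3) in \<open>auto simp: inv_into_f_f[OF inj] subset_iff\<close>)
  then have "smooth_on (\<phi> ` (S \<inter> N)) (id \<circ> (\<lambda>x. g (f x)) \<circ> inv_into U \<phi>)"
    by (simp add: o_def)
  then show "\<exists>(U, \<phi>)\<in>A. \<exists>(V, \<psi>)\<in>euclid. \<exists>N. open N \<and> x \<in> N \<and> N \<subseteq> U \<and> (\<lambda>x. g (f x)) ` (S \<inter> N) \<subseteq> V \<and>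
        smooth_on (\<phi> ` (S \<inter> N)) (\<psi> \<circ> (\<lambda>x. g (f x)) \<circ> inv_into U \<phi>)"
    using * by (intro bexI[OF _ *(1)] bexI[of _ "(UNIV, id)"] case_prodI exI[of _ N]) (auto simp: euclid_def)
qed

lemma smooth_map_compose_right:
  assumes "smooth_map euclid A T f" "smooth_on S g" "g ` S \<subseteq> T"
  shows "smooth_map euclid A S (\<lambda>x. f (g x))"
  unfolding smooth_map_def
proof
  fix x assume x: "x \<in> S"
  then have "g x \<in> T" using assms(3) by blast
  with assms(1) obtain V \<psi> N where *: "(V, \<psi>) \<in> A" "open N" "g x \<in> N"
    "f ` (T \<inter> N) \<subseteq> V" "smooth_on (T \<inter> N) (\<psi> \<circ> f)"
    unfolding smooth_map_def euclid_def by (force dest!: bspec)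
  obtain N' where N': "open N'" "N' \<inter> S = g -` N \<inter> S"
    using smooth_on_imp_continuous_on[OF assms(2)] *(2) unfolding continuous_on_open_invariant by blast
  have "smooth_on (S \<inter> N') (\<lambda>y. (\<psi> \<circ> f) (g y))"
    by (rule smooth_on_compose[OF smooth_on_subset[OF assms(2)] *(5)]) (use N' assms(3) in auto)
  then have "smooth_on (id ` (S \<inter> N')) (\<psi> \<circ> (\<lambda>x. f (g x)) \<circ> inv_into UNIV id)"
    by (simp add: o_def)
  moreover have "(\<lambda>x. f (g x)) ` (S \<inter> N') \<subseteq> V" using N' assms(3) *(4) by blast
  moreover have "x \<in> N'" using N' x *(3) by blast
  ultimately show "\<exists>(U, \<phi>)\<in>euclid. \<exists>(V, \<psi>)\<in>A. \<exists>N. open N \<and> x \<in> N \<and> N \<subseteq> U \<and> (\<lambda>x. f (g x)) ` (S \<inter> N) \<subseteq> V \<and>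
        smooth_on (\<phi> ` (S \<inter> N)) (\<psi> \<circ> (\<lambda>x. f (g x)) \<circ> inv_into U \<phi>)"
    using N'(1) by (intro bexI[of _ "(UNIV, id)"] bexI[OF _ *(1)] case_prodI exI[of _ N']) (auto simp: euclid_def)
qed

lemma smooth_map_imp_continuous_on:
  assumes A: "smooth_atlas A" and B: "smooth_atlas B" and f: "smooth_map A B S f"
  shows "continuous_on S f"
  unfolding continuous_on_topological
proof (intro ballI allI impI)
  fix x B' assume x: "x \<in> S" and B': "open B'" "f x \<in> B'"
  with f obtain U \<phi> V \<psi> N where *: "(U, \<phi>) \<in> A" "(V, \<psi>) \<in> B" "open N" "x \<in> N" "N \<subseteq> U"
    "f ` (S \<inter> N) \<subseteq> V" "smooth_on (\<phi> ` (S \<inter> N)) (\<psi> \<circ> f \<circ> inv_into U \<phi>)"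
    unfolding smooth_map_def by (blast dest!: bspec)
  have hA: "homeomorphism U (\<phi> ` U) \<phi> (inv_into U \<phi>)" using A *(1) unfolding smooth_atlas_def by auto
  have hB: "homeomorphism V (\<psi> ` V) \<psi> (inv_into V \<psi>)" using B *(2) unfolding smooth_atlas_def by auto
  have c1: "continuous_on (S \<inter> N) \<phi>" using hA *(5) unfolding homeomorphism_def by (meson Int_lower2 continuous_on_subset order_trans)
  have "continuous_on (S \<inter> N) (\<lambda>y. (\<psi> \<circ> f \<circ> inv_into U \<phi>) (\<phi> y))"
    by (rule continuous_on_compose2[OF smooth_on_imp_continuous_on[OF *(7)] c1]) simp
  moreover have e: "(\<psi> \<circ> f \<circ> inv_into U \<phi>) (\<phi> y) = \<psi> (f y)" if "y \<in> S \<inter> N" for y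
    using that hA *(5) unfolding homeomorphism_def by (simp add: subset_iff)
  ultimately have c2: "continuous_on (S \<inter> N) (\<lambda>y. \<psi> (f y))" by (rule continuous_on_eq)
  have c3: "continuous_on (\<psi> ` V) (inv_into V \<psi>)" using hB unfolding homeomorphism_def by blast
  have "continuous_on (S \<inter> N) (\<lambda>y. inv_into V \<psi> (\<psi> (f y)))"
    by (rule continuous_on_compose2[OF c3 c2]) (use *(6) in blast)
  moreover have "inv_into V \<psi> (\<psi> (f y)) = f y" if "y \<in> S \<inter> N" for y
    by (rule homeomorphism_apply1[OF hB]) (use that *(6) in blast)
  ultimately have "continuous_on (S \<inter> N) f" by (rule continuous_on_eq)
  then obtain N' where "open N'" "x \<in> N'" "\<forall>y\<in>S \<inter> N. y \<in> N' \<longrightarrow> f y \<in> B'"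
    using x *(4) B' unfolding continuous_on_topological by (metis IntI)
  then show "\<exists>A. open A \<and> x \<in> A \<and> (\<forall>y\<in>S. y \<in> A \<longrightarrow> f y \<in> B')"
    using *(3,4) by (intro exI[of _ "N \<inter> N'"]) auto
qed

text \<open>\<open>smooth_map\<close> offers some chart around each image point; a transition
  function of the atlas passes to the prescribed one.\<close>

lemma smooth_on_chart_compose:
  assumes A: "smooth_atlas A" and f: "smooth_map euclid A S f" and S: "open S" and c: "(V, \<psi>) \<in> A"
    and V: "f ` S \<subseteq> V"
  shows "smooth_on S (\<lambda>x. \<psi> (f x))"
proof (rule smooth_on_local)
  fix x assume x: "x \<in> S"
  with f obtain V' \<psi>' N where *: "(V', \<psi>') \<in> A" "open N" "x \<in> N"
    "f ` (S \<inter> N) \<subseteq> V'" "smooth_on (S \<inter> N) (\<psi>' \<circ> f)"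
    unfolding smooth_map_def euclid_def by (force dest!: bspec)
  have inj: "inj_on \<psi>' V'" using A *(1) by (rule smooth_atlas_inj)
  have tr: "smooth_on (\<psi>' ` (V' \<inter> V)) (\<psi> \<circ> inv_into V' \<psi>')"
    using A *(1) c unfolding smooth_atlas_def by blast
  have "smooth_on (S \<inter> N) (\<lambda>y. (\<psi> \<circ> inv_into V' \<psi>') ((\<psi>' \<circ> f) y))"
    by (rule smooth_on_compose[OF *(5) tr]) (use *(4) V in auto)
  moreover have "(\<psi> \<circ> inv_into V' \<psi>') ((\<psi>' \<circ> f) y) = \<psi> (f y)" if "y \<in> S \<inter> N" for y
  proof -
    have "f y \<in> V'" using that *(4) by blast
    then show ?thesis by (simp add: inv_into_f_f[OF inj])
  qed
  ultimately have "smooth_on (S \<inter> N) (\<lambda>x. \<psi> (f x))"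
    using smooth_on_cong[of "S \<inter> N" "\<lambda>y. (\<psi> \<circ> inv_into V' \<psi>') ((\<psi>' \<circ> f) y)" "\<lambda>y. \<psi> (f y)"] by blast
  then show "\<exists>U. open U \<and> x \<in> U \<and> smooth_on (S \<inter> U) (\<lambda>x. \<psi> (f x))" using * by blast
qed

section \<open>Diffeomorphisms\<close>

lemma diffeomorphism_bij: "diffeomorphism A B S T f \<Longrightarrow> bij_betw f S T"
  by (simp add: diffeomorphism_def)

lemma diffeomorphism_smooth: "diffeomorphism A B S T f \<Longrightarrow> smooth_map A B S f"
  by (simp add: diffeomorphism_def)

text \<open>Any two-sided inverse may be exhibited; on the image it agrees with the
  \<open>inv_into\<close> of the definition.\<close>

lemma diffeomorphismI:
  assumes "smooth_atlas B" "smooth_map A B S f" "smooth_map B A T g"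
    and "f ` S \<subseteq> T" "g ` T \<subseteq> S" "\<And>x. x \<in> S \<Longrightarrow> g (f x) = x" "\<And>y. y \<in> T \<Longrightarrow> f (g y) = y"
  shows "diffeomorphism A B S T f"
proof -
  have b: "bij_betw f S T"
    by (rule bij_betw_byWitness[where f'=g]) (use assms in auto)
  have "inv_into S f y = g y" if "y \<in> T" for y
    using that assms(5,7) b by (metis bij_betw_imp_inj_on image_subset_iff inv_into_f_f)
  then have "smooth_map B A T (inv_into S f)"
    using smooth_map_cong[OF assms(1) _ assms(3), of "inv_into S f"] by simp
  with b assms(2) show ?thesis by (simp add: diffeomorphism_def)
qed

lemma diffeomorphism_inv:
  assumes "smooth_atlas A" "diffeomorphism A B S T f"
  shows "diffeomorphism B A T S (inv_into S f)"
  using assms bij_betw_inv_into_left[of f S T] bij_betw_inv_into_right[of f S T]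
    bij_betw_imp_surj_on[OF bij_betw_inv_into, of f S T] bij_betw_imp_surj_on[of f S T]
  by (intro diffeomorphismI[where g=f]) (auto simp: diffeomorphism_def)

lemma diffeomorphism_subset:
  assumes "smooth_atlas B" "diffeomorphism A B S T f" "S' \<subseteq> S"
  shows "diffeomorphism A B S' (f ` S') f"
proof -
  have b: "bij_betw f S T" and s: "smooth_map A B S f" "smooth_map B A T (inv_into S f)"
    using assms(2) by (auto simp: diffeomorphism_def)
  have inj: "inj_on f S" and im: "f ` S = T" using b by (auto simp: bij_betw_def)
  show ?thesis
  proof (rule diffeomorphismI[OF assms(1), where g="inv_into S f"])
    show "smooth_map A B S' f" using smooth_map_subset[OF s(1) assms(3)] .
    show "smooth_map B A (f ` S') (inv_into S f)"
      by (rule smooth_map_subset[OF s(2)]) (use im assms(3) in blast)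
  qed (use assms(3) inj in \<open>auto simp: subset_iff\<close>)
qed

lemma diffeomorphism_compose_left:
  assumes "smooth_atlas A" "diffeomorphism A euclid S T f" "diffeomorphism euclid euclid T R g"
  shows "diffeomorphism A euclid S R (\<lambda>x. g (f x))"
proof -
  have b: "bij_betw f S T" and s: "smooth_map A euclid S f" "smooth_map euclid A T (inv_into S f)"
    using assms(2) by (auto simp: diffeomorphism_def)
  have b': "bij_betw g T R" and s': "smooth_on T g" "smooth_on R (inv_into T g)"
    using assms(3) by (auto simp: diffeomorphism_def smooth_map_euclid)
  have im: "f ` S = T" "g ` T = R" "inv_into T g ` R = T" "inv_into S f ` T = S"
    using b b' by (auto simp: bij_betw_imp_surj_on bij_betw_inv_into)
  show ?thesis
  proof (rule diffeomorphismI[OF smooth_atlas_euclid, where g="\<lambda>y. inv_into S f (inv_into T g y)"])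
    show "smooth_map A euclid S (\<lambda>x. g (f x))"
      by (rule smooth_map_compose_left[OF s(1) s'(1) _ assms(1)]) (use im in auto)
    show "smooth_map euclid A R (\<lambda>y. inv_into S f (inv_into T g y))"
      by (rule smooth_map_compose_right[OF s(2) s'(2)]) (use im in auto)
    show "inv_into S f (inv_into T g (g (f x))) = x" if "x \<in> S" for x
      using that im bij_betw_inv_into_left[OF b] bij_betw_inv_into_left[OF b'] by auto
    show "g (f (inv_into S f (inv_into T g y))) = y" if "y \<in> R" for y
    proof -
      have "inv_into T g y \<in> T" using im that by blast
      then show ?thesis using that bij_betw_inv_into_right[OF b] bij_betw_inv_into_right[OF b'] by simp
    qed
  qed (use im in auto)
qed

lemma diffeomorphism_compose_right:
  assumes "smooth_atlas A" "diffeomorphism euclid euclid S T g" "diffeomorphism euclid A T R f"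
  shows "diffeomorphism euclid A S R (\<lambda>x. f (g x))"
proof -
  have b: "bij_betw f T R" and s: "smooth_map euclid A T f" "smooth_map A euclid R (inv_into T f)"
    using assms(3) by (auto simp: diffeomorphism_def)
  have b': "bij_betw g S T" and s': "smooth_on S g" "smooth_on T (inv_into S g)"
    using assms(2) by (auto simp: diffeomorphism_def smooth_map_euclid)
  have im: "f ` T = R" "g ` S = T" "inv_into S g ` T = S" "inv_into T f ` R = T"
    using b b' by (auto simp: bij_betw_imp_surj_on bij_betw_inv_into)
  show ?thesis
  proof (rule diffeomorphismI[OF assms(1), where g="\<lambda>y. inv_into S g (inv_into T f y)"])
    show "smooth_map euclid A S (\<lambda>x. f (g x))"
      by (rule smooth_map_compose_right[OF s(1) s'(1)]) (use im in auto)
    show "smooth_map A euclid R (\<lambda>y. inv_into S g (inv_into T f y))"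
      by (rule smooth_map_compose_left[OF s(2) s'(2) _ assms(1)]) (use im in auto)
    show "inv_into S g (inv_into T f (f (g x))) = x" if "x \<in> S" for x
      using that im bij_betw_inv_into_left[OF b] bij_betw_inv_into_left[OF b'] by auto
    show "f (g (inv_into S g (inv_into T f y))) = y" if "y \<in> R" for y
    proof -
      have "inv_into T f y \<in> T" using im that by blast
      then show ?thesis using that bij_betw_inv_into_right[OF b] bij_betw_inv_into_right[OF b'] by simp
    qed
    show "(\<lambda>x. f (g x)) ` S \<subseteq> R" using im by blast
    show "(\<lambda>y. inv_into S g (inv_into T f y)) ` R \<subseteq> S" using im by blast
  qed
qed

lemma diffeomorphism_open_image:
  assumes "smooth_atlas A" "smooth_atlas B" "diffeomorphism A B S T f" "open S" "open T" "open U" "U \<subseteq> S"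
  shows "open (f ` U)"
proof -
  have b: "bij_betw f S T" and s: "smooth_map B A T (inv_into S f)"
    using assms(3) by (auto simp: diffeomorphism_def)
  have "f ` U = T \<inter> inv_into S f -` U"
    using b assms(7) bij_betw_inv_into_left[OF b] bij_betw_inv_into_right[OF b]
    by (fastforce simp: bij_betw_def image_iff)
  then show ?thesis
    using smooth_map_imp_continuous_on[OF assms(2,1) s] assms(5,6) by (metis continuous_open_preimage)
qed

section \<open>Embedded submanifolds: locality and images\<close>

text \<open>Slice charts can be shrunk to Q. The sets met later are glued from pieces, and near each
  of their points they coincide with a known submanifold.\<close>

lemma embedded_submanifold_local:
  fixes A :: "('m::topological_space, 'e::euclidean_space) atlas"
  assumes A: "smooth_atlas A"
    and loc: "\<And>x. x \<in> L \<Longrightarrow> \<exists>Q L2. open Q \<and> x \<in> Q \<and> embedded_submanifold A k L2 \<and> L \<inter> Q = L2 \<inter> Q"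
  shows "embedded_submanifold A k L"
  unfolding embedded_submanifold_def
proof
  fix x assume x: "x \<in> L"
  obtain Q L2 where Q: "open Q" "x \<in> Q" "embedded_submanifold A k L2" "L \<inter> Q = L2 \<inter> Q"
    using loc[OF x] by blast
  then have "x \<in> L2" using x by blast
  then obtain U T and \<phi> :: "'m \<Rightarrow> 'e" where U: "open U" "x \<in> U" "open (\<phi> ` U)" "diffeomorphism A euclid U (\<phi> ` U) \<phi>"
    "subspace T" "dim T = k" "\<phi> ` (L2 \<inter> U) = \<phi> ` U \<inter> T"
    using Q(3) unfolding embedded_submanifold_def by meson
  have o: "open (\<phi> ` (U \<inter> Q))"
    using diffeomorphism_open_image[OF A smooth_atlas_euclid U(4,1,3)] U(1) Q(1) by auto
  have inj: "inj_on \<phi> U" using diffeomorphism_bij[OF U(4)] by (simp add: bij_betw_def)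
  have "\<phi> ` (L \<inter> (U \<inter> Q)) = \<phi> ` (L2 \<inter> U \<inter> (U \<inter> Q))" using Q(4) by (intro arg_cong[where f="image \<phi>"]) blast
  also have "\<dots> = \<phi> ` (L2 \<inter> U) \<inter> \<phi> ` (U \<inter> Q)"
    by (rule inj_on_image_Int[OF inj]) auto
  also have "\<dots> = \<phi> ` (U \<inter> Q) \<inter> T" using U(7) by blast
  finally have "\<phi> ` (L \<inter> (U \<inter> Q)) = \<phi> ` (U \<inter> Q) \<inter> T" .
  moreover have "diffeomorphism A euclid (U \<inter> Q) (\<phi> ` (U \<inter> Q)) \<phi>"
    by (rule diffeomorphism_subset[OF smooth_atlas_euclid U(4)]) simp
  ultimately show "\<exists>U (\<phi> :: 'm \<Rightarrow> 'e) T. open U \<and> x \<in> U \<and> open (\<phi> ` U) \<and> diffeomorphism A euclid U (\<phi> ` U) \<phi> \<and>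
        subspace T \<and> dim T = k \<and> \<phi> ` (L \<inter> U) = \<phi> ` U \<inter> T"
    using U Q o x by (intro exI[of _ "U \<inter> Q"] exI[of _ \<phi>] exI[of _ T]) auto
qed

lemma embedded_submanifold_image:
  fixes A :: "('m::topological_space, 'e::euclidean_space) atlas" and P :: "'e set"
  assumes A: "smooth_atlas A" and \<xi>: "diffeomorphism euclid A W0 W \<xi>" and op: "open W0" "open W"
    and P: "embedded_submanifold euclid k P"
  shows "embedded_submanifold A k (\<xi> ` (P \<inter> W0))"
  unfolding embedded_submanifold_def
proof
  fix x assume "x \<in> \<xi> ` (P \<inter> W0)"
  then obtain w where w: "w \<in> P" "w \<in> W0" "x = \<xi> w" by blast
  then obtain U T and \<phi> :: "'e \<Rightarrow> 'e" where U: "open U" "w \<in> U" "open (\<phi> ` U)" "diffeomorphism euclid euclid U (\<phi> ` U) \<phi>"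
    "subspace T" "dim T = k" "\<phi> ` (P \<inter> U) = \<phi> ` U \<inter> T"
    using P unfolding embedded_submanifold_def by meson
  let ?U = "U \<inter> W0"
  have b: "bij_betw \<xi> W0 W" using \<xi> by (rule diffeomorphism_bij)
  have inj: "inj_on \<phi> U" using diffeomorphism_bij[OF U(4)] by (simp add: bij_betw_def)
  have injx: "inj_on \<xi> W0" using b by (simp add: bij_betw_def)
  have o1: "open (\<phi> ` ?U)"
    using diffeomorphism_open_image[OF smooth_atlas_euclid smooth_atlas_euclid U(4,1,3)] U(1) op by auto
  have o2: "open (\<xi> ` ?U)"
    using diffeomorphism_open_image[OF smooth_atlas_euclid A \<xi> op] U(1) op by auto
  let ?g = "inv_into ?U \<xi>"
  have d1: "diffeomorphism A euclid (\<xi> ` ?U) ?U ?g"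
    by (intro diffeomorphism_inv smooth_atlas_euclid diffeomorphism_subset[OF A \<xi>]) auto
  have d2: "diffeomorphism euclid euclid ?U (\<phi> ` ?U) \<phi>"
    by (rule diffeomorphism_subset[OF smooth_atlas_euclid U(4)]) simp
  have d: "diffeomorphism A euclid (\<xi> ` ?U) (\<phi> ` ?U) (\<lambda>z. \<phi> (?g z))"
    by (rule diffeomorphism_compose_left[OF A d1 d2])
  have injU: "inj_on \<xi> ?U" using injx inj_on_subset by blast
  have img: "(\<lambda>z. \<phi> (?g z)) ` \<xi> ` B = \<phi> ` B" if "B \<subseteq> ?U" for B
    using that inv_into_f_f[OF injU] by (force simp: image_iff subset_iff)
  have "\<xi> ` (P \<inter> W0) \<inter> \<xi> ` ?U = \<xi> ` (P \<inter> ?U)"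
    using inj_on_image_Int[OF injx, of "P \<inter> W0" ?U] by (simp add: Int_ac)
  then have "(\<lambda>z. \<phi> (?g z)) ` (\<xi> ` (P \<inter> W0) \<inter> \<xi> ` ?U) = \<phi> ` (P \<inter> ?U)" using img[of "P \<inter> ?U"] by auto
  also have "\<dots> = \<phi> ` (P \<inter> U \<inter> ?U)" by (intro arg_cong[where f="image \<phi>"]) blast
  also have "\<dots> = \<phi> ` (P \<inter> U) \<inter> \<phi> ` ?U" by (rule inj_on_image_Int[OF inj]) auto
  also have "\<dots> = \<phi> ` ?U \<inter> T" using U(7) by blast
  finally have fin: "(\<lambda>z. \<phi> (?g z)) ` (\<xi> ` (P \<inter> W0) \<inter> \<xi> ` ?U) = (\<lambda>z. \<phi> (?g z)) ` \<xi> ` ?U \<inter> T"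
    using img[of ?U] by simp
  show "\<exists>U (\<phi> :: 'm \<Rightarrow> 'e) T. open U \<and> x \<in> U \<and> open (\<phi> ` U) \<and> diffeomorphism A euclid U (\<phi> ` U) \<phi> \<and>
        subspace T \<and> dim T = k \<and> \<phi> ` (\<xi> ` (P \<inter> W0) \<inter> U) = \<phi> ` U \<inter> T"
    using o2 w U(2) img[of ?U] o1 d U(5,6) fin
    by (intro exI[of _ "\<xi> ` ?U"] exI[of _ "\<lambda>z. \<phi> (?g z)"] exI[of _ T]) auto
qed

lemma atlas_of_cotangent: "atlas_of cotangent = euclid"
  by (simp add: atlas_of_def cotangent_def euclid_def)

lemma preserves_form_cotangent:
  "preserves_form cotangent cotangent S f \<longleftrightarrow> (\<forall>x\<in>S. \<forall>u v.
     fst (frechet_derivative f (at x) u) \<bullet> snd (frechet_derivative f (at x) v) -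
     snd (frechet_derivative f (at x) u) \<bullet> fst (frechet_derivative f (at x) v) = fst u \<bullet> snd v - snd u \<bullet> fst v)"
  by (simp add: preserves_form_def cotangent_def Let_def inner_commute)

section \<open>Symplectic maps and rotational Lagrangians\<close>

lemma preserves_form_from_cotangent:
  "preserves_form cotangent X S f \<longleftrightarrow> (\<forall>d\<in>X. \<forall>x\<in>S. f x \<in> ch_dom d \<longrightarrow> (\<forall>u v.
     ch_form d (ch_map d (f x)) (frechet_derivative (\<lambda>z. ch_map d (f z)) (at x) u)
       (frechet_derivative (\<lambda>z. ch_map d (f z)) (at x) v) = fst u \<bullet> snd v - snd u \<bullet> fst v))"
  by (simp add: preserves_form_def cotangent_def Let_def inner_commute o_def)

lemma symplectomorphism_compose:
  assumes X: "smooth_atlas (atlas_of X)"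
    and f: "symplectomorphism cotangent X U V f" and g: "symplectomorphism cotangent cotangent U0 U g"
  shows "symplectomorphism cotangent X U0 V (\<lambda>x. f (g x))"
proof -
  have op: "open U0" "open U" "open V" using f g by (auto simp: symplectomorphism_def)
  have df: "diffeomorphism euclid (atlas_of X) U V f" and dg: "diffeomorphism euclid euclid U0 U g"
    using f g by (auto simp: symplectomorphism_def atlas_of_cotangent)
  have pf: "preserves_form cotangent X U f" and pg: "preserves_form cotangent cotangent U0 g"
    using f g by (auto simp: symplectomorphism_def)
  have sg: "smooth_on U0 g" using dg by (simp add: diffeomorphism_def smooth_map_euclid)
  have gU: "g x \<in> U" if "x \<in> U0" for x using that diffeomorphism_bij[OF dg] by (auto dest: bij_betwE)
  have "preserves_form cotangent X U0 (\<lambda>x. f (g x))"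
    unfolding preserves_form_from_cotangent
  proof (intro ballI impI allI)
    fix d x u v assume d: "d \<in> X" and x: "x \<in> U0" and fx: "f (g x) \<in> ch_dom d"
    have ad: "(ch_dom d, ch_map d) \<in> atlas_of X" using d by (auto simp: atlas_of_def)
    then have od: "open (ch_dom d)" using X by (auto simp: smooth_atlas_def)
    let ?N = "U \<inter> f -` ch_dom d"
    have "continuous_on U f"
      using smooth_map_imp_continuous_on[OF smooth_atlas_euclid X diffeomorphism_smooth[OF df]] .
    then have oN: "open ?N" using op od by (simp add: continuous_open_preimage)
    have sN: "smooth_on ?N (\<lambda>z. ch_map d (f z))"
      by (rule smooth_on_chart_compose[OF X smooth_map_subset[OF diffeomorphism_smooth[OF df]] oN ad]) auto
    have "g x \<in> ?N" using gU x fx by auto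
    then have d1: "(\<lambda>z. ch_map d (f z)) differentiable at (g x)"
      using smooth_on_imp_differentiable[OF sN oN] by blast
    have d2: "g differentiable at x" using smooth_on_imp_differentiable[OF sg op(1) x] .
    let ?S = "frechet_derivative (\<lambda>z. ch_map d (f z)) (at (g x))" and ?T = "frechet_derivative g (at x)"
    have ch: "frechet_derivative (\<lambda>z. ch_map d (f (g z))) (at x) = ?S \<circ> ?T"
      using frechet_derivative_compose[OF d2 d1] by (simp add: o_def)
    have "ch_form d (ch_map d (f (g x))) (?S (?T u)) (?S (?T v)) = fst (?T u) \<bullet> snd (?T v) - snd (?T u) \<bullet> fst (?T v)"
      using pf d gU[OF x] fx unfolding preserves_form_from_cotangent by blast
    also have "\<dots> = fst u \<bullet> snd v - snd u \<bullet> fst v"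
      using pg x unfolding preserves_form_cotangent by blast
    finally show "ch_form d (ch_map d (f (g x))) (frechet_derivative (\<lambda>z. ch_map d (f (g z))) (at x) u)
       (frechet_derivative (\<lambda>z. ch_map d (f (g z))) (at x) v) = fst u \<bullet> snd v - snd u \<bullet> fst v"
      by (simp add: ch)
  qed
  moreover have "diffeomorphism euclid (atlas_of X) U0 V (\<lambda>x. f (g x))"
    by (rule diffeomorphism_compose_right[OF X dg df])
  ultimately show ?thesis using op by (simp add: symplectomorphism_def atlas_of_cotangent)
qed

lemma symplectomorphism_inv:
  fixes f :: "'a::euclidean_space \<times> 'a \<Rightarrow> 'a \<times> 'a"
  assumes "symplectomorphism cotangent cotangent U V f"
  shows "symplectomorphism cotangent cotangent V U (inv_into U f)"
proof -
  have op: "open U" "open V" and d: "diffeomorphism euclid euclid U V f"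
    and p: "preserves_form cotangent cotangent U f"
    using assms by (auto simp: symplectomorphism_def atlas_of_cotangent)
  let ?g = "inv_into U f"
  have d': "diffeomorphism euclid euclid V U ?g" by (rule diffeomorphism_inv[OF smooth_atlas_euclid d])
  have b: "bij_betw f U V" using d by (rule diffeomorphism_bij)
  have s: "smooth_on U f" "smooth_on V ?g" using d d' by (auto simp: diffeomorphism_def smooth_map_euclid)
  have "preserves_form cotangent cotangent V ?g"
    unfolding preserves_form_cotangent
  proof (intro ballI allI)
    fix y u v assume y: "y \<in> V"
    have gy: "?g y \<in> U" using y bij_betwE[OF bij_betw_inv_into[OF b]] by blast
    let ?S = "frechet_derivative f (at (?g y))" and ?T = "frechet_derivative ?g (at y)"
    have "(?g has_derivative ?T) (at y)" "(f has_derivative ?S) (at (?g y))"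
      using smooth_on_imp_differentiable[OF s(2) op(2) y] smooth_on_imp_differentiable[OF s(1) op(1) gy]
        frechet_derivative_works by blast+
    then have "((\<lambda>z. f (?g z)) has_derivative (\<lambda>h. ?S (?T h))) (at y)" by (rule has_derivative_compose)
    moreover have "((\<lambda>z. f (?g z)) has_derivative (\<lambda>h. h)) (at y)"
      by (rule has_derivative_transform_within_open[OF has_derivative_ident op(2) y])
        (simp add: bij_betw_inv_into_right[OF b])
    \<comment> \<open>The derivatives are inverse to each other, so invariance of the form under f,
      read on the vectors \<open>?T u\<close> and \<open>?T v\<close>, is invariance under the
      inverse.\<close>
    ultimately have "(\<lambda>h. ?S (?T h)) = (\<lambda>h. h)" by (rule has_derivative_unique)
    then have e: "?S (?T h) = h" for h by (rule fun_cong)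
    have "fst (?S (?T u)) \<bullet> snd (?S (?T v)) - snd (?S (?T u)) \<bullet> fst (?S (?T v)) =
      fst (?T u) \<bullet> snd (?T v) - snd (?T u) \<bullet> fst (?T v)"
      using p gy unfolding preserves_form_cotangent by blast
    then show "fst (?T u) \<bullet> snd (?T v) - snd (?T u) \<bullet> fst (?T v) = fst u \<bullet> snd v - snd u \<bullet> fst v"
      by (simp add: e)
  qed
  with op d' show ?thesis by (simp add: symplectomorphism_def atlas_of_cotangent)
qed

lemma preserves_form_subset: "preserves_form X Y S f \<Longrightarrow> T \<subseteq> S \<Longrightarrow> preserves_form X Y T f"
  unfolding preserves_form_def by (meson IntD1 IntD2 IntI subsetD)

lemma symplectomorphism_subset:
  assumes "smooth_atlas (atlas_of X)" "symplectomorphism cotangent X U V f" "open U'" "U' \<subseteq> U"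
  shows "symplectomorphism cotangent X U' (f ` U') f"
proof -
  have op: "open U" "open V" and d: "diffeomorphism euclid (atlas_of X) U V f"
    and p: "preserves_form cotangent X U f"
    using assms(2) by (auto simp: symplectomorphism_def atlas_of_cotangent)
  have "open (f ` U')"
    by (rule diffeomorphism_open_image[OF smooth_atlas_euclid assms(1) d op assms(3,4)])
  moreover have "diffeomorphism euclid (atlas_of X) U' (f ` U') f"
    by (rule diffeomorphism_subset[OF assms(1) d assms(4)])
  ultimately show ?thesis
    using assms(3) preserves_form_subset[OF p assms(4)] by (simp add: symplectomorphism_def atlas_of_cotangent)
qed

lemma symplectomorphism_bij: "symplectomorphism X Y U V f \<Longrightarrow> bij_betw f U V"
  by (simp add: symplectomorphism_def diffeomorphism_def)

lemma isotropic_cotangent: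
  "isotropic cotangent L \<longleftrightarrow>
    (\<forall>x\<in>L. \<forall>u\<in>tangent_at L x. \<forall>v\<in>tangent_at L x. fst u \<bullet> snd v - snd u \<bullet> fst v = 0)"
  by (simp add: isotropic_def cotangent_def inner_commute)

text \<open>The value 1 lies in the positive cylindrical end, so V contains the copy of L' over (1,
  0). A curve in L' lifts there with constant first factor; its velocity has no component in that
  factor, and on such vectors the product form is the form of M.\<close>

lemma isotropic_cobordism_end:
  assumes "lagrangian_cobordism X V L' L"
  shows "isotropic X L'"
  unfolding isotropic_def
proof (intro ballI)
  fix c x u v
  assume c: "c \<in> X" and x: "x \<in> L' \<inter> ch_dom c"
    and u: "u \<in> tangent_at (ch_map c ` (L' \<inter> ch_dom c)) (ch_map c x)"
    and v: "v \<in> tangent_at (ch_map c ` (L' \<inter> ch_dom c)) (ch_map c x)"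
  obtain d where d: "0 < d" "V \<inter> ({1 - d..} \<times> UNIV) \<times> UNIV = ({1 - d..} \<times> {0}) \<times> L'"
    and iso: "isotropic (prod_symplectic cotangent X) V"
    using assms by (auto simp: lagrangian_cobordism_def lagrangian_def)
  have inV: "((1, 0), z) \<in> V" if "z \<in> L'" for z
  proof -
    have "((1, 0), z) \<in> ({1 - d..} \<times> {0}) \<times> L'" using that d(1) by auto
    then show ?thesis using d(2) by blast
  qed
  define c' where "c' = \<lparr>ch_dom = UNIV \<times> ch_dom c, ch_map = map_prod id (ch_map c),
    ch_form = (\<lambda>z u v. (fst (fst u) * snd (fst v) - snd (fst u) * fst (fst v))
      + ch_form c (snd z) (snd u) (snd v))\<rparr>"
  have c': "c' \<in> prod_symplectic cotangent X"
    using c by (force simp: c'_def prod_symplectic_def cotangent_def image_iff)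
  have tan: "((0, 0), w) \<in> tangent_at (ch_map c' ` (V \<inter> ch_dom c')) (ch_map c' ((1, 0), x))"
    if w: "w \<in> tangent_at (ch_map c ` (L' \<inter> ch_dom c)) (ch_map c x)" for w
  proof -
    obtain k e where k: "e > 0" "smooth_on {-e<..<e} k" "k 0 = ch_map c x"
      "\<And>t. t \<in> {-e<..<e} \<Longrightarrow> k t \<in> ch_map c ` (L' \<inter> ch_dom c)" "(k has_vector_derivative w) (at 0)"
      using w unfolding tangent_at_def by blast
    have "smooth_on {-e<..<e} (\<lambda>t. ((1::real, 0::real), k t))" by (intro smooth_intros k(2))
    moreover have "((1, 0), k t) \<in> ch_map c' ` (V \<inter> ch_dom c')" if "t \<in> {-e<..<e}" for t
    proof -
      obtain z where "k t = ch_map c z" "z \<in> L'" "z \<in> ch_dom c" using k(4)[OF \<open>t \<in> _\<close>] by blast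
      then show ?thesis using inV[of z] by (intro image_eqI[of _ _ "((1, 0), z)"]) (auto simp: c'_def)
    qed
    moreover have "((\<lambda>t. ((1::real, 0::real), k t)) has_vector_derivative ((0, 0), w)) (at 0)"
      by (intro has_vector_derivative_Pair has_vector_derivative_const k(5))
    moreover have "((1, 0), k 0) = ch_map c' ((1, 0), x)" by (simp add: k(3) c'_def)
    ultimately show ?thesis unfolding tangent_at_def using k(1) by blast
  qed
  have "ch_form c' (ch_map c' ((1, 0), x)) ((0, 0), u) ((0, 0), v) = 0"
  proof -
    have "((1, 0), x) \<in> V \<inter> ch_dom c'" using inV[of x] x by (auto simp: c'_def)
    then show ?thesis using iso c' tan[OF u] tan[OF v] unfolding isotropic_def by blast
  qed
  then show "ch_form c (ch_map c x) u v = 0" by (simp add: c'_def)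
qed

section \<open>Rotated plane curves as embedded Lagrangians\<close>

text \<open>The pairs (t, x) and (s, -x) give the same point exactly when \<gamma> t = - \<gamma> s,
  which must therefore be excluded; with s = t this also keeps \<gamma> away from 0. The last clause
  is properness, which separates embeddings from injective immersions.\<close>

definition profile_curve :: "(real \<Rightarrow> real \<times> real) \<Rightarrow> bool" where
  "profile_curve \<gamma> \<longleftrightarrow> smooth_on UNIV \<gamma> \<and> inj \<gamma> \<and> (\<forall>t. vector_derivative \<gamma> (at t) \<noteq> 0) \<and>
     (\<forall>s t. \<gamma> s \<noteq> - \<gamma> t) \<and> (\<forall>B. \<exists>T. \<forall>t. norm (\<gamma> t) \<le> B \<longrightarrow> \<bar>t\<bar> \<le> T)"

definition spin :: "(real \<Rightarrow> real \<times> real) \<Rightarrow> real \<times> (real, 'n::finite) vec \<Rightarrow> 'n phase" where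
  "spin \<gamma> = (\<lambda>(t, x). (fst (\<gamma> t) *\<^sub>R x, snd (\<gamma> t) *\<^sub>R x))"

definition spin_inv :: "(real \<Rightarrow> real \<times> real) \<Rightarrow> 'n::finite phase \<Rightarrow> real \<times> (real, 'n) vec" where
  "spin_inv \<gamma> = inv_into (UNIV \<times> sphere 0 1) (spin \<gamma>)"

lemma handle_eq_spin: "handle \<gamma> = spin \<gamma> ` (UNIV \<times> sphere 0 1)"
  by (auto simp: handle_def spin_def image_iff) blast+

lemma norm_spin: "norm x = 1 \<Longrightarrow> norm (spin \<gamma> (t, x)) = norm (\<gamma> t)"
  by (cases "\<gamma> t") (simp add: spin_def norm_Pair power_mult_distrib)

lemma profile_curve_nonzero: "profile_curve \<gamma> \<Longrightarrow> \<gamma> t \<noteq> 0"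
  unfolding profile_curve_def by (metis add.inverse_neutral)

lemma profile_curve_pair_nonzero: "profile_curve \<gamma> \<Longrightarrow> (fst (\<gamma> t))\<^sup>2 + (snd (\<gamma> t))\<^sup>2 > 0"
  using profile_curve_nonzero[of \<gamma> t] by (simp add: sum_power2_gt_zero_iff prod_eq_iff)

text \<open>Pairing both coordinates with x and with y gives (x \<bullet> y)^2 = 1, hence x = y or x
  = -y, and the second case would make \<gamma> s the negative of \<gamma> t.\<close>

lemma inj_on_spin:
  assumes "profile_curve \<gamma>"
  shows "inj_on (spin \<gamma>) (UNIV \<times> sphere 0 (1::real) :: (real \<times> (real, 'n::finite) vec) set)"
proof (rule inj_onI, clarsimp simp: dist_norm)
  fix s t and x y :: "(real, 'n) vec"
  assume n: "norm x = 1" "norm y = 1" and eq: "spin \<gamma> (s, x) = spin \<gamma> (t, y)"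
  obtain a b where ab: "\<gamma> s = (a, b)" by (cases "\<gamma> s")
  obtain c d where cd: "\<gamma> t = (c, d)" by (cases "\<gamma> t")
  have e: "a *\<^sub>R x = c *\<^sub>R y" "b *\<^sub>R x = d *\<^sub>R y" using eq by (simp_all add: spin_def ab cd)
  have ip: "a = c * (x \<bullet> y)" "b = d * (x \<bullet> y)" "a * (x \<bullet> y) = c" "b * (x \<bullet> y) = d"
    using arg_cong[OF e(1), of "\<lambda>z. z \<bullet> x"] arg_cong[OF e(2), of "\<lambda>z. z \<bullet> x"]
      arg_cong[OF e(1), of "\<lambda>z. z \<bullet> y"] arg_cong[OF e(2), of "\<lambda>z. z \<bullet> y"] n
    by (simp_all add: inner_commute dot_square_norm)
  have nz: "a \<noteq> 0 \<or> b \<noteq> 0" using profile_curve_nonzero[OF assms, of s] by (auto simp: ab zero_prod_def)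
  have "a * ((x \<bullet> y) * (x \<bullet> y)) = a * 1" "b * ((x \<bullet> y) * (x \<bullet> y)) = b * 1"
    using ip(1,2) unfolding ip(3,4)[symmetric] by (simp_all only: mult.assoc mult_1_right)
  then have "(x \<bullet> y) * (x \<bullet> y) = 1" using nz mult_left_cancel by blast
  then have "x \<bullet> y = 1 \<or> x \<bullet> y = -1" by (simp add: square_eq_1_iff)
  then have "x \<bullet> y = 1"
  proof
    assume "x \<bullet> y = -1"
    then have "\<gamma> s = - \<gamma> t" using ip ab cd by simp
    then show ?thesis using assms unfolding profile_curve_def by blast
  qed
  then have "\<gamma> s = \<gamma> t" using ip ab cd by simp
  then have "s = t" using assms unfolding profile_curve_def inj_def by blast
  moreover have "x = y" using e nz ab cd \<open>\<gamma> s = \<gamma> t\<close> by auto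
  ultimately show "s = t \<and> x = y" by blast
qed

lemma spin_inv_spin:
  "profile_curve \<gamma> \<Longrightarrow> norm x = 1 \<Longrightarrow> spin_inv \<gamma> (spin \<gamma> (t, x)) = (t, x)"
  unfolding spin_inv_def by (rule inv_into_f_f[OF inj_on_spin]) auto

lemma profile_curve_derivative:
  assumes "profile_curve \<gamma>"
  obtains a' b' where "((\<lambda>t. fst (\<gamma> t)) has_real_derivative a') (at t)"
    "((\<lambda>t. snd (\<gamma> t)) has_real_derivative b') (at t)" "a' \<noteq> 0 \<or> b' \<noteq> 0"
proof -
  obtain a' b' where v: "vector_derivative \<gamma> (at t) = (a', b')" by fastforce
  have "\<gamma> differentiable at t"
    using assms smooth_on_imp_differentiable[of UNIV \<gamma> t] by (simp add: profile_curve_def)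
  then have "(\<gamma> has_vector_derivative (a', b')) (at t)"
    using v vector_derivative_works by metis
  then have "((\<lambda>t. fst (\<gamma> t)) has_vector_derivative a') (at t)" "((\<lambda>t. snd (\<gamma> t)) has_vector_derivative b') (at t)"
    using has_derivative_fst[of \<gamma> "\<lambda>h. h *\<^sub>R (a', b')"] has_derivative_snd[of \<gamma> "\<lambda>h. h *\<^sub>R (a', b')"]
    unfolding has_vector_derivative_def by simp_all
  moreover have "a' \<noteq> 0 \<or> b' \<noteq> 0" using assms v unfolding profile_curve_def by (metis zero_prod_def)
  ultimately show ?thesis using that by (simp add: has_real_derivative_iff_has_vector_derivative)
qed

text \<open>\<open>(u, w) \<mapsto> spin \<gamma> (t\<^sub>0 + |u| - 1, u / |u|) + (\<alpha> w, \<beta> w)\<close> is a local diffeomorphism near \<open>(x\<^sub>0, 0)\<close>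
  as soon as \<open>(\<alpha>, \<beta>)\<close> is transverse both to \<open>\<gamma> t\<^sub>0\<close> and to the velocity of \<open>\<gamma>\<close> there.\<close>

lemma handle_slice_chart:
  fixes x\<^sub>0 :: "(real, 'n::finite) vec"
  assumes \<gamma>: "profile_curve \<gamma>" and x\<^sub>0: "norm x\<^sub>0 = 1"
  obtains U V :: "'n phase set" and \<Psi> \<phi> D and a' b' :: real
  where "open U" "open V" "homeomorphism U V \<Psi> \<phi>" "smooth_on U \<Psi>" "smooth_on V \<phi>"
    "(x\<^sub>0, 0) \<in> U" "\<And>u w. (u, w) \<in> U \<Longrightarrow> u \<noteq> 0"
    "\<And>u. (u, 0) \<in> U \<Longrightarrow> \<Psi> (u, 0) = spin \<gamma> (t\<^sub>0 + norm u - 1, u /\<^sub>R norm u)"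
    "handle \<gamma> \<inter> V = \<Psi> ` (U \<inter> UNIV \<times> {0})"
    "(\<Psi> has_derivative D) (at (x\<^sub>0, 0))"
    "\<And>v. D (v, 0) = ((a' * (x\<^sub>0 \<bullet> v)) *\<^sub>R x\<^sub>0 + fst (\<gamma> t\<^sub>0) *\<^sub>R (v - (x\<^sub>0 \<bullet> v) *\<^sub>R x\<^sub>0),
        (b' * (x\<^sub>0 \<bullet> v)) *\<^sub>R x\<^sub>0 + snd (\<gamma> t\<^sub>0) *\<^sub>R (v - (x\<^sub>0 \<bullet> v) *\<^sub>R x\<^sub>0))"
proof -
  obtain a' b' where ab': "((\<lambda>t. fst (\<gamma> t)) has_real_derivative a') (at t\<^sub>0)"
    "((\<lambda>t. snd (\<gamma> t)) has_real_derivative b') (at t\<^sub>0)" "a' \<noteq> 0 \<or> b' \<noteq> 0"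
    using profile_curve_derivative[OF \<gamma>] by metis
  define a b where "a = fst (\<gamma> t\<^sub>0)" and "b = snd (\<gamma> t\<^sub>0)"
  have pos: "a\<^sup>2 + b\<^sup>2 > 0" unfolding a_def b_def by (rule profile_curve_pair_nonzero[OF \<gamma>])
  have pos': "a'\<^sup>2 + b'\<^sup>2 > 0" using ab'(3) by (simp add: sum_power2_gt_zero_iff)
  \<comment> \<open>The quarter turn of (a, b) is transverse to (a, b), and also to (a', b') unless
    the two are orthogonal. In the orthogonal case the quarter turn of their sum works.\<close>
  obtain \<alpha> \<beta> where \<alpha>\<beta>: "\<beta> * a - \<alpha> * b \<noteq> 0" "\<beta> * a' - \<alpha> * b' \<noteq> 0"
  proof (cases "a * a' + b * b' = 0")
    case False
    show ?thesis
      by (rule that[where \<alpha>="-b" and \<beta>=a]) (use pos False in \<open>auto simp: power2_eq_square\<close>)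
  next
    case True
    have e: "(a + a') * a - (- (b + b')) * b = (a\<^sup>2 + b\<^sup>2) + (a * a' + b * b')"
      "(a + a') * a' - (- (b + b')) * b' = (a'\<^sup>2 + b'\<^sup>2) + (a * a' + b * b')"
      by (auto simp: power2_eq_square algebra_simps)
    have nz: "a\<^sup>2 + b\<^sup>2 \<noteq> 0" "a'\<^sup>2 + b'\<^sup>2 \<noteq> 0" using pos pos' by auto
    show ?thesis
      by (rule that[where \<alpha>="- (b + b')" and \<beta>="a + a'"]; unfold e True) (use nz in simp_all)
  qed
  have sm\<gamma>: "smooth_on UNIV \<gamma>" using \<gamma> by (simp add: profile_curve_def)
  define \<Psi> :: "'n phase \<Rightarrow> 'n phase" where
    "\<Psi> z = (fst (\<gamma> (t\<^sub>0 + norm (fst z) - 1)) *\<^sub>R (inverse (norm (fst z)) *\<^sub>R fst z) + \<alpha> *\<^sub>R snd z,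
      snd (\<gamma> (t\<^sub>0 + norm (fst z) - 1)) *\<^sub>R (inverse (norm (fst z)) *\<^sub>R fst z) + \<beta> *\<^sub>R snd z)" for z
  define S :: "'n phase set" where "S = {z. fst z \<noteq> 0}"
  have oS: "open S" unfolding S_def by (intro open_Collect_neq continuous_intros)
  have smt: "smooth_on S (\<lambda>z. \<gamma> (t\<^sub>0 + norm (fst z) - 1))"
    by (rule smooth_on_compose[OF _ sm\<gamma>]) (auto intro!: smooth_intros simp: S_def)
  have sm\<Psi>: "smooth_on S \<Psi>" unfolding \<Psi>_def by (intro smooth_intros smt) (auto simp: S_def)
  define N where "N h = x\<^sub>0 \<bullet> fst h" for h :: "'n phase"
  define D where "D h = ((a' * N h) *\<^sub>R x\<^sub>0 + a *\<^sub>R (fst h - N h *\<^sub>R x\<^sub>0) + \<alpha> *\<^sub>R snd h,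
      (b' * N h) *\<^sub>R x\<^sub>0 + b *\<^sub>R (fst h - N h *\<^sub>R x\<^sub>0) + \<beta> *\<^sub>R snd h)" for h :: "'n phase"
  have x0nz: "x\<^sub>0 \<noteq> 0" using x\<^sub>0 by auto
  have dn: "((\<lambda>z. norm (fst z)) has_derivative N) (at (x\<^sub>0, 0))"
    using has_derivative_compose[OF has_derivative_fst[OF has_derivative_ident], of norm "\<lambda>h. h \<bullet> sgn x\<^sub>0" "(x\<^sub>0, 0)" UNIV]
      has_derivative_norm[OF x0nz] x\<^sub>0 unfolding N_def by (simp add: sgn_div_norm inner_commute)
  have dt: "((\<lambda>z. t\<^sub>0 + norm (fst z) - 1) has_derivative N) (at (x\<^sub>0, 0))"
    by (rule derivative_eq_intros dn refl)+ simp
  have da: "((\<lambda>z. fst (\<gamma> (t\<^sub>0 + norm (fst z) - 1))) has_derivative (\<lambda>h. a' * N h)) (at (x\<^sub>0, 0))"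
    using has_derivative_compose[OF dt, of "\<lambda>t. fst (\<gamma> t)" "(*) a'"] ab'(1) x\<^sub>0 by (simp add: has_field_derivative_def)
  have db: "((\<lambda>z. snd (\<gamma> (t\<^sub>0 + norm (fst z) - 1))) has_derivative (\<lambda>h. b' * N h)) (at (x\<^sub>0, 0))"
    using has_derivative_compose[OF dt, of "\<lambda>t. snd (\<gamma> t)" "(*) b'"] ab'(2) x\<^sub>0 by (simp add: has_field_derivative_def)
  have du: "((\<lambda>z. inverse (norm (fst z)) *\<^sub>R fst z) has_derivative (\<lambda>h. fst h - N h *\<^sub>R x\<^sub>0)) (at (x\<^sub>0, 0))"
    by (rule derivative_eq_intros dn refl | simp add: x\<^sub>0)+
  have dz: "((\<lambda>z. snd z) has_derivative (\<lambda>h. snd h)) (at (x\<^sub>0, 0::(real, 'n) vec))"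
    by (intro has_derivative_snd has_derivative_ident)
  have d\<Psi>: "(\<Psi> has_derivative D) (at (x\<^sub>0, 0))"
    unfolding \<Psi>_def D_def
    by (rule has_derivative_eq_rhs[OF has_derivative_Pair[OF
            has_derivative_add[OF has_derivative_scaleR[OF da du] has_derivative_scaleR_right[OF dz, of \<alpha>]]
            has_derivative_add[OF has_derivative_scaleR[OF db du] has_derivative_scaleR_right[OF dz, of \<beta>]]]])
      (simp add: x\<^sub>0 a_def b_def fun_eq_iff)
  have injD: "h = 0" if "D h = 0" for h
  proof -
    obtain v w where h: "h = (v, w)" by (cases h)
    let ?r = "x\<^sub>0 \<bullet> v"
    have e: "(a' * ?r) *\<^sub>R x\<^sub>0 + a *\<^sub>R (v - ?r *\<^sub>R x\<^sub>0) + \<alpha> *\<^sub>R w = 0"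
      "(b' * ?r) *\<^sub>R x\<^sub>0 + b *\<^sub>R (v - ?r *\<^sub>R x\<^sub>0) + \<beta> *\<^sub>R w = 0"
      using that by (auto simp: D_def h N_def zero_prod_def)
    \<comment> \<open>Subtracting \<alpha> times the second equation from \<beta> times the first
      eliminates w. What remains splits into a part along \<open>x\<^sub>0\<close> and a part
      orthogonal to it, each with a nonzero coefficient.\<close>
    have c: "((\<beta> * a' - \<alpha> * b') * ?r) *\<^sub>R x\<^sub>0 + (\<beta> * a - \<alpha> * b) *\<^sub>R (v - ?r *\<^sub>R x\<^sub>0) = 0"
      using arg_cong2[where f="(-)", OF arg_cong[OF e(1), of "scaleR \<beta>"] arg_cong[OF e(2), of "scaleR \<alpha>"]]
      by (simp add: algebra_simps)
    have "x\<^sub>0 \<bullet> x\<^sub>0 = 1" using x\<^sub>0 by (simp add: dot_square_norm)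
    then have "x\<^sub>0 \<bullet> (v - ?r *\<^sub>R x\<^sub>0) = 0" by (simp add: inner_diff_right)
    then have "(\<beta> * a' - \<alpha> * b') * ?r = 0"
      using arg_cong[OF c, of "\<lambda>z. x\<^sub>0 \<bullet> z"] \<open>x\<^sub>0 \<bullet> x\<^sub>0 = 1\<close> by (simp add: inner_add_right)
    then have r: "?r = 0" using \<alpha>\<beta> by simp
    then have v: "v = 0" using c \<alpha>\<beta> by simp
    have "\<alpha> \<noteq> 0 \<or> \<beta> \<noteq> 0" using \<alpha>\<beta> by auto
    then have "w = 0" using e v by auto
    with v h show ?thesis by (simp add: zero_prod_def)
  qed
  have "(x\<^sub>0, 0) \<in> S" using x0nz by (simp add: S_def)
  then obtain U0 V0 \<phi> where U0: "open U0" "U0 \<subseteq> S" "(x\<^sub>0, 0) \<in> U0" "open V0" "homeomorphism U0 V0 \<Psi> \<phi>"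
    "smooth_on V0 \<phi>"
    using smooth_inverse_function[OF oS sm\<Psi> _ d\<Psi> injD] by metis
  have \<Psi>0: "\<Psi> (u, 0) = spin \<gamma> (t\<^sub>0 + norm u - 1, u /\<^sub>R norm u)" for u
    by (simp add: \<Psi>_def spin_def)
  let ?z0 = "spin \<gamma> (t\<^sub>0, x\<^sub>0)"
  have z0: "\<Psi> (x\<^sub>0, 0) = ?z0" using \<Psi>0[of x\<^sub>0] x\<^sub>0 by simp
  \<comment> \<open>The parameters whose point in the polar coordinates u lies in the domain
    \<open>U0\<close>; the rest of the handle has to be kept out of \<open>V\<close>.\<close>
  define G :: "(real \<times> (real, 'n) vec) set" where
    "G = {(t, x). t > t\<^sub>0 - 1 \<and> ((1 + t - t\<^sub>0) *\<^sub>R x, 0) \<in> U0}"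
  have oG: "open G"
  proof -
    have "G = {w. fst w > t\<^sub>0 - 1} \<inter> (\<lambda>w. ((1 + fst w - t\<^sub>0) *\<^sub>R snd w, 0)) -` U0"
      by (auto simp: G_def)
    moreover have "open ((\<lambda>w::real \<times> (real, 'n) vec. ((1 + fst w - t\<^sub>0) *\<^sub>R snd w, 0)) -` U0)"
      by (rule open_vimage[OF U0(1)]) (intro continuous_intros)
    moreover have "open {w::real \<times> (real, 'n) vec. fst w > t\<^sub>0 - 1}"
      by (intro open_Collect_less continuous_intros)
    ultimately show ?thesis by (simp add: open_Int)
  qed
  \<comment> \<open>Properness: only parameters with |t| \<le> T come within distance 1 of
    \<open>?z0\<close>. Those among them outside \<open>G\<close> form a compact set
    \<open>K\<close>, whose image is closed and misses \<open>?z0\<close> by injectivity, so it can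
    be removed from the target.\<close>
  obtain T where T: "\<And>t. norm (\<gamma> t) \<le> norm ?z0 + 1 \<Longrightarrow> \<bar>t\<bar> \<le> T"
    using \<gamma> unfolding profile_curve_def by metis
  define K where "K = {-T..T} \<times> sphere 0 1 - G"
  have "compact K" unfolding K_def using oG by (intro compact_diff compact_Times compact_Icc compact_sphere)
  have cont: "continuous_on UNIV \<gamma>" using smooth_on_imp_continuous_on[OF sm\<gamma>] .
  have "continuous_on K (spin \<gamma>)"
    unfolding spin_def case_prod_unfold
    by (intro continuous_intros continuous_on_compose2[OF cont]) auto
  then have clK: "closed (spin \<gamma> ` K)" using \<open>compact K\<close> compact_continuous_image compact_imp_closed by blast
  have inG: "(t\<^sub>0, x\<^sub>0) \<in> G" using U0(3) by (simp add: G_def)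
  have z0K: "?z0 \<notin> spin \<gamma> ` K"
  proof
    assume "?z0 \<in> spin \<gamma> ` K"
    then obtain w where w: "w \<in> K" "spin \<gamma> w = ?z0" by auto
    then have "w = (t\<^sub>0, x\<^sub>0)"
      using inj_onD[OF inj_on_spin[OF \<gamma>] w(2)] x\<^sub>0 by (auto simp: K_def)
    then show False using inG w(1) by (simp add: K_def)
  qed
  define V where "V = V0 \<inter> ball ?z0 1 - spin \<gamma> ` K"
  have oV: "open V" unfolding V_def using U0(4) clK by (simp add: open_Diff open_Int)
  have V0: "V \<subseteq> V0" by (auto simp: V_def)
  define U where "U = U0 \<inter> \<Psi> -` V"
  have cont\<Psi>: "continuous_on U0 \<Psi>" using U0(5) by (simp add: homeomorphism_def)
  have oU: "open U" unfolding U_def using continuous_open_preimage[OF cont\<Psi> U0(1) oV] .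
  have hom: "homeomorphism U V \<Psi> \<phi>"
  proof (rule homeomorphism_of_subsets[OF U0(5)])
    show "U \<subseteq> U0" "V \<subseteq> V0" using V0 by (auto simp: U_def)
    show "\<Psi> ` U = V"
    proof
      show "V \<subseteq> \<Psi> ` U"
      proof
        fix z assume z: "z \<in> V"
        then have "z \<in> V0" using V0 by blast
        then have "\<phi> z \<in> U0" "\<Psi> (\<phi> z) = z" using U0(5) by (auto simp: homeomorphism_def)
        then show "z \<in> \<Psi> ` U" using z by (intro image_eqI[of _ _ "\<phi> z"]) (auto simp: U_def)
      qed
    qed (auto simp: U_def)
  qed
  have "?z0 \<in> V0" using z0 U0(3,5) by (force simp: homeomorphism_def)
  then have x0U: "(x\<^sub>0, 0) \<in> U" using U0(3) z0 z0K by (simp add: U_def V_def)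
  have han: "handle \<gamma> \<inter> V = \<Psi> ` (U \<inter> UNIV \<times> {0})"
  proof (intro equalityI subsetI)
    fix z assume z: "z \<in> handle \<gamma> \<inter> V"
    then obtain t x where tx: "z = spin \<gamma> (t, x)" "norm x = 1" unfolding handle_eq_spin by auto
    have "norm z \<le> norm ?z0 + 1" using z norm_triangle_sub[of z ?z0] by (simp add: V_def dist_norm norm_minus_commute)
    then have "\<bar>t\<bar> \<le> T" using T tx norm_spin by metis
    then have "(t, x) \<in> {-T..T} \<times> sphere 0 1" using tx(2) by auto
    then have "(t, x) \<in> G" using z tx(1) unfolding V_def K_def by blast
    then have t: "t > t\<^sub>0 - 1" "((1 + t - t\<^sub>0) *\<^sub>R x, 0) \<in> U0" by (auto simp: G_def)
    have "\<Psi> ((1 + t - t\<^sub>0) *\<^sub>R x, 0) = z" using t(1) tx \<Psi>0[of "(1 + t - t\<^sub>0) *\<^sub>R x"] by simp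
    then show "z \<in> \<Psi> ` (U \<inter> UNIV \<times> {0})"
      using t(2) z by (intro image_eqI[of _ _ "((1 + t - t\<^sub>0) *\<^sub>R x, 0)"]) (auto simp: U_def)
  next
    fix z assume "z \<in> \<Psi> ` (U \<inter> UNIV \<times> {0})"
    then obtain u where u: "z = \<Psi> (u, 0)" "(u, 0) \<in> U" by blast
    then have "u \<noteq> 0" using U0(2) by (auto simp: U_def S_def)
    then have "z \<in> handle \<gamma>" unfolding u(1) \<Psi>0 handle_eq_spin by (intro imageI) auto
    moreover have "z \<in> V" using u by (simp add: U_def)
    ultimately show "z \<in> handle \<gamma> \<inter> V" by blast
  qed
  show ?thesis
  proof (rule that[OF oU oV hom _ _ x0U _ _ han d\<Psi>])
    show "smooth_on U \<Psi>" by (rule smooth_on_subset[OF sm\<Psi>]) (use U0(2) in \<open>auto simp: U_def\<close>)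
    show "smooth_on V \<phi>" using smooth_on_subset[OF U0(6) V0] .
    show "u \<noteq> 0" if "(u, w) \<in> U" for u w using that U0(2) by (auto simp: U_def S_def)
    show "D (v, 0) = ((a' * (x\<^sub>0 \<bullet> v)) *\<^sub>R x\<^sub>0 + fst (\<gamma> t\<^sub>0) *\<^sub>R (v - (x\<^sub>0 \<bullet> v) *\<^sub>R x\<^sub>0),
        (b' * (x\<^sub>0 \<bullet> v)) *\<^sub>R x\<^sub>0 + snd (\<gamma> t\<^sub>0) *\<^sub>R (v - (x\<^sub>0 \<bullet> v) *\<^sub>R x\<^sub>0))" for v
      by (simp add: D_def N_def a_def b_def)
  qed (use \<Psi>0 in auto)
qed

lemma embedded_handle:
  assumes "profile_curve \<gamma>"
  shows "embedded_submanifold euclid CARD('n) (handle \<gamma> :: 'n::finite phase set)"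
  unfolding embedded_submanifold_def
proof
  fix z :: "'n phase" assume "z \<in> handle \<gamma>"
  then obtain t\<^sub>0 x\<^sub>0 where z: "z = spin \<gamma> (t\<^sub>0, x\<^sub>0)" "norm x\<^sub>0 = 1" unfolding handle_eq_spin by auto
  obtain U V :: "'n phase set" and \<Psi> \<phi> where U: "open U" "open V" "homeomorphism U V \<Psi> \<phi>" "smooth_on U \<Psi>"
    "smooth_on V \<phi>" "(x\<^sub>0, 0) \<in> U" "\<Psi> (x\<^sub>0, 0) = spin \<gamma> (t\<^sub>0 + norm x\<^sub>0 - 1, x\<^sub>0 /\<^sub>R norm x\<^sub>0)"
    "handle \<gamma> \<inter> V = \<Psi> ` (U \<inter> UNIV \<times> {0})"
    using handle_slice_chart[OF assms z(2), of t\<^sub>0] by metis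
  let ?T = "(\<lambda>x. (x, 0)) ` UNIV :: 'n phase set"
  have T: "?T = UNIV \<times> {0}" by auto
  have lin: "linear (\<lambda>x::(real, 'n) vec. (x, 0::(real, 'n) vec))"
    by (intro linear_conv_bounded_linear[THEN iffD2] bounded_linear_Pair bounded_linear_ident bounded_linear_zero)
  have "subspace ?T" by (intro linear_subspace_image lin subspace_UNIV)
  have inj: "inj (\<lambda>x::(real, 'n) vec. (x, 0::(real, 'n) vec))" by (auto simp: inj_def)
  have "dim ?T = dim (UNIV :: (real, 'n) vec set)"
    by (rule dim_image_eq[OF lin]) (use inj in \<open>auto simp: inj_on_def\<close>)
  then have "dim ?T = CARD('n)" by simp
  have im: "\<phi> ` V = U" "\<Psi> ` U = V" "\<And>w. w \<in> U \<Longrightarrow> \<phi> (\<Psi> w) = w" "\<And>z. z \<in> V \<Longrightarrow> \<Psi> (\<phi> z) = z"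
    using U(3) by (auto simp: homeomorphism_def)
  have "diffeomorphism euclid euclid V (\<phi> ` V) \<phi>"
    by (rule diffeomorphismI[where g=\<Psi>]) (use im U in \<open>auto simp: smooth_map_euclid smooth_atlas_euclid\<close>)
  moreover have "\<phi> ` (handle \<gamma> \<inter> V) = \<phi> ` V \<inter> ?T"
    unfolding U(8) im(1) T using im(3) by (force simp: image_iff)
  moreover have "z \<in> V" using imageI[OF U(6), of \<Psi>] U(7) z im(2) by simp
  ultimately show "\<exists>U (\<phi> :: 'n phase \<Rightarrow> 'n phase) T. open U \<and> z \<in> U \<and> open (\<phi> ` U) \<and>
        diffeomorphism euclid euclid U (\<phi> ` U) \<phi> \<and>
        subspace T \<and> dim T = CARD('n) \<and> \<phi> ` (handle \<gamma> \<inter> U) = \<phi> ` U \<inter> T"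
    using U(1,2) im(1) \<open>subspace ?T\<close> \<open>dim ?T = CARD('n)\<close> by (intro exI[of _ V] exI[of _ \<phi>] exI[of _ ?T]) simp
qed

text \<open>With r the component of w along \<open>x\<^sub>0\<close> and p the orthogonal one, a
  tangent vector has coordinates a' r \<open>x\<^sub>0\<close> + a p and b' r
  \<open>x\<^sub>0\<close> + b p. The pairing a' b' r r + a b p p is symmetric in two such vectors,
  so its antisymmetrization vanishes.\<close>

lemma isotropic_handle:
  assumes "profile_curve \<gamma>"
  shows "isotropic cotangent (handle \<gamma> :: 'n::finite phase set)"
  unfolding isotropic_cotangent
proof (intro ballI)
  fix z v\<^sub>1 v\<^sub>2 :: "'n phase"
  assume "z \<in> handle \<gamma>" and v: "v\<^sub>1 \<in> tangent_at (handle \<gamma>) z" "v\<^sub>2 \<in> tangent_at (handle \<gamma>) z"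
  then obtain t\<^sub>0 x\<^sub>0 where z: "z = spin \<gamma> (t\<^sub>0, x\<^sub>0)" "norm x\<^sub>0 = 1" unfolding handle_eq_spin by auto
  obtain U V :: "'n phase set" and \<Psi> \<phi> D a' b' where U: "open U" "open V" "homeomorphism U V \<Psi> \<phi>" "smooth_on U \<Psi>"
    "smooth_on V \<phi>" "(x\<^sub>0, 0) \<in> U" "\<And>u. (u, 0) \<in> U \<Longrightarrow> \<Psi> (u, 0) = spin \<gamma> (t\<^sub>0 + norm u - 1, u /\<^sub>R norm u)"
    "handle \<gamma> \<inter> V = \<Psi> ` (U \<inter> UNIV \<times> {0})"
    "(\<Psi> has_derivative D) (at (x\<^sub>0, 0))"
    "\<And>v. D (v, 0) = ((a' * (x\<^sub>0 \<bullet> v)) *\<^sub>R x\<^sub>0 + fst (\<gamma> t\<^sub>0) *\<^sub>R (v - (x\<^sub>0 \<bullet> v) *\<^sub>R x\<^sub>0),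
        (b' * (x\<^sub>0 \<bullet> v)) *\<^sub>R x\<^sub>0 + snd (\<gamma> t\<^sub>0) *\<^sub>R (v - (x\<^sub>0 \<bullet> v) *\<^sub>R x\<^sub>0))"
    by (rule handle_slice_chart[OF assms z(2), of t\<^sub>0]) blast
  have im: "\<phi> ` V = U" "\<Psi> ` U = V" "\<And>w. w \<in> U \<Longrightarrow> \<phi> (\<Psi> w) = w" "\<And>z. z \<in> V \<Longrightarrow> \<Psi> (\<phi> z) = z"
    using U(3) by (auto simp: homeomorphism_def)
  have \<Psi>0: "\<Psi> (x\<^sub>0, 0) = z" using U(7)[OF U(6)] z by simp
  then have zV: "z \<in> V" using imageI[OF U(6), of \<Psi>] im(2) by simp
  have \<phi>z: "\<phi> z = (x\<^sub>0, 0)" using im(3)[OF U(6)] \<Psi>0 by simp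
  \<comment> \<open>In the chart a curve on the handle stays in the slice; differentiating c =
    \<Psi> (fst (\<phi> c), 0) expresses its velocity through \<open>D\<close>.\<close>
  have tan: "\<exists>w. v = D (w, 0)" if vt: "v \<in> tangent_at (handle \<gamma>) z" for v
  proof -
    obtain c e where "e > 0 \<and> smooth_on {-e<..<e} c \<and> c 0 = z \<and> (\<forall>t\<in>{-e<..<e}. c t \<in> handle \<gamma>)
        \<and> (c has_vector_derivative v) (at 0)"
      using vt unfolding tangent_at_def by blast
    then have c: "e > 0" "c 0 = z" "\<forall>t\<in>{-e<..<e}. c t \<in> handle \<gamma>" "(c has_vector_derivative v) (at 0)"
      by blast+
    have "\<phi> differentiable at z" using smooth_on_imp_differentiable[OF U(5,2) zV] .
    then obtain E where E: "(\<phi> has_derivative E) (at z)" unfolding differentiable_def by blast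
    have dc: "(c has_derivative (\<lambda>h. h *\<^sub>R v)) (at 0)" using c(4) by (simp add: has_vector_derivative_def)
    have d1: "((\<lambda>t. \<phi> (c t)) has_derivative (\<lambda>h. E (h *\<^sub>R v))) (at 0)"
      using has_derivative_compose[OF dc, of \<phi> E] E c(2) by simp
    have d2: "((\<lambda>t. (fst (\<phi> (c t)), 0)) has_derivative (\<lambda>h. (fst (E (h *\<^sub>R v)), 0))) (at 0)"
      by (intro has_derivative_Pair has_derivative_fst d1 has_derivative_const)
    have d3: "((\<lambda>t. \<Psi> (fst (\<phi> (c t)), 0)) has_derivative (\<lambda>h. D (fst (E (h *\<^sub>R v)), 0))) (at 0)"
      using has_derivative_compose[OF d2, of \<Psi> D] U(9) c(2) \<phi>z by simp
    have "isCont c 0" using dc has_derivative_continuous by blast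
    then have "\<forall>\<^sub>F t in nhds 0. c t \<in> V"
      using c(2) zV U(2) by (simp add: continuous_at_imp_continuous_at_within isCont_def eventually_nhds_conv_at topological_tendstoD)
    then obtain R where R: "open R" "0 \<in> R" "\<And>t. t \<in> R \<Longrightarrow> c t \<in> V" unfolding eventually_nhds by blast
    have "(c has_derivative (\<lambda>h. D (fst (E (h *\<^sub>R v)), 0))) (at 0)"
    proof (rule has_derivative_transform_within_open[OF d3, of "R \<inter> {-e<..<e}"])
      fix t assume t: "t \<in> R \<inter> {-e<..<e}"
      then have "c t \<in> \<Psi> ` (U \<inter> UNIV \<times> {0})" using R(3) c(3) U(8) by blast
      then obtain u where u: "c t = \<Psi> (u, 0)" "(u, 0) \<in> U" by blast
      then show "\<Psi> (fst (\<phi> (c t)), 0) = c t" using im(3) by simp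
    qed (use R c(1) in auto)
    then have "(\<lambda>h. D (fst (E (h *\<^sub>R v)), 0)) = (\<lambda>h. h *\<^sub>R v)" by (rule has_derivative_unique[OF _ dc])
    then have "D (fst (E v), 0) = v" using fun_cong[of _ _ 1] by fastforce
    then show ?thesis by (intro exI[of _ "fst (E v)"]) simp
  qed
  obtain w\<^sub>1 w\<^sub>2 where w: "v\<^sub>1 = D (w\<^sub>1, 0)" "v\<^sub>2 = D (w\<^sub>2, 0)" using tan v by meson
  have "x\<^sub>0 \<bullet> x\<^sub>0 = 1" using z by (simp add: dot_square_norm)
  then show "fst v\<^sub>1 \<bullet> snd v\<^sub>2 - snd v\<^sub>1 \<bullet> fst v\<^sub>2 = 0"
    unfolding w U(10) by (simp add: inner_simps inner_commute algebra_simps)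
qed

lemma lagrangian_handle:
  "profile_curve \<gamma> \<Longrightarrow> lagrangian cotangent (handle \<gamma> :: 'n::finite phase set)"
  using embedded_handle[of \<gamma>, where 'n='n] isotropic_handle[of \<gamma>, where 'n='n]
  by (simp add: lagrangian_def atlas_of_cotangent)

text \<open>In the slice chart the parameters of a point are \<open>t\<^sub>0 + norm u - 1\<close>
  and u / |u|, smooth because u is never 0 there.\<close>

lemma smooth_on_spin_inv:
  assumes "profile_curve \<gamma>"
  shows "smooth_on (handle \<gamma> :: 'n::finite phase set) (spin_inv \<gamma>)"
proof (rule smooth_on_local)
  fix z :: "'n phase" assume "z \<in> handle \<gamma>"
  then obtain t\<^sub>0 x\<^sub>0 where z: "z = spin \<gamma> (t\<^sub>0, x\<^sub>0)" "norm x\<^sub>0 = 1" unfolding handle_eq_spin by auto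
  obtain U V :: "'n phase set" and \<Psi> \<phi> where U: "open U" "open V" "homeomorphism U V \<Psi> \<phi>" "smooth_on U \<Psi>"
    "smooth_on V \<phi>" "(x\<^sub>0, 0) \<in> U" "\<And>u w. (u, w) \<in> U \<Longrightarrow> u \<noteq> 0"
    "\<And>u. (u, 0) \<in> U \<Longrightarrow> \<Psi> (u, 0) = spin \<gamma> (t\<^sub>0 + norm u - 1, u /\<^sub>R norm u)"
    "handle \<gamma> \<inter> V = \<Psi> ` (U \<inter> UNIV \<times> {0})"
    using handle_slice_chart[OF assms z(2), of t\<^sub>0] by metis
  have im: "\<phi> ` V = U" "\<Psi> ` U = V" "\<And>w. w \<in> U \<Longrightarrow> \<phi> (\<Psi> w) = w" "\<And>z. z \<in> V \<Longrightarrow> \<Psi> (\<phi> z) = z"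
    using U(3) by (auto simp: homeomorphism_def)
  have nz: "fst (\<phi> y) \<noteq> 0" if "y \<in> V" for y using that im(1) U(7) by (metis imageI prod.collapse)
  let ?q = "\<lambda>y. (t\<^sub>0 + norm (fst (\<phi> y)) - 1, inverse (norm (fst (\<phi> y))) *\<^sub>R fst (\<phi> y))"
  have "smooth_on V ?q" by (intro smooth_intros U(5)) (use nz in auto)
  then have "smooth_on (handle \<gamma> \<inter> V) ?q" by (rule smooth_on_subset) auto
  moreover have "?q y = spin_inv \<gamma> y" if y: "y \<in> handle \<gamma> \<inter> V" for y
  proof -
    obtain u where u: "y = \<Psi> (u, 0)" "(u, 0) \<in> U" using y unfolding U(9) by blast
    then have "\<phi> y = (u, 0)" using im(3) by simp
    moreover have "u \<noteq> 0" using U(7) u(2) by blast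
    ultimately show ?thesis unfolding u(1) U(8)[OF u(2)] using spin_inv_spin[OF assms, of "u /\<^sub>R norm u"] u(1)
      by (simp add: U(8)[OF u(2)])
  qed
  ultimately have "smooth_on (handle \<gamma> \<inter> V) (spin_inv \<gamma>)" using smooth_on_cong[of "handle \<gamma> \<inter> V" ?q "spin_inv \<gamma>"] by simp
  moreover have "z \<in> V" using U(8)[OF U(6)] imageI[OF U(6), of \<Psi>] z im(2) by simp
  ultimately show "\<exists>U. open U \<and> z \<in> U \<and> smooth_on (handle \<gamma> \<inter> U) (spin_inv \<gamma>)" using U(2) by blast
qed

text \<open>Handles of different profile curves are identified through their common parameters;
  along a family of curves these are the maps of an isotopy.\<close>

lemma diffeomorphism_handles:
  assumes "profile_curve \<gamma>" "profile_curve \<gamma>'"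
  shows "diffeomorphism euclid euclid (handle \<gamma> :: 'n::finite phase set) (handle \<gamma>') (\<lambda>z. spin \<gamma>' (spin_inv \<gamma> z))"
proof -
  have sp: "smooth_on (handle \<gamma> :: 'n phase set) (\<lambda>z. spin \<gamma>' (spin_inv \<gamma> z))"
    if "profile_curve \<gamma>" "profile_curve \<gamma>'" for \<gamma> \<gamma>'
  proof -
    have s\<gamma>: "smooth_on UNIV \<gamma>'" using that by (simp add: profile_curve_def)
    have i: "smooth_on (handle \<gamma> :: 'n phase set) (spin_inv \<gamma>)" by (rule smooth_on_spin_inv[OF that(1)])
    have "smooth_on (handle \<gamma> :: 'n phase set) (\<lambda>z. \<gamma>' (fst (spin_inv \<gamma> z)))"
      by (rule smooth_on_compose[OF smooth_on_fst[OF i] s\<gamma>]) simp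
    then show ?thesis unfolding spin_def case_prod_unfold by (intro smooth_intros i)
  qed
  show ?thesis
  proof (rule diffeomorphismI[where g="\<lambda>z. spin \<gamma> (spin_inv \<gamma>' z)"], unfold smooth_map_euclid)
    show "smooth_on (handle \<gamma> :: 'n phase set) (\<lambda>z. spin \<gamma>' (spin_inv \<gamma> z))" by (rule sp[OF assms])
    show "smooth_on (handle \<gamma>' :: 'n phase set) (\<lambda>z. spin \<gamma> (spin_inv \<gamma>' z))" by (rule sp[OF assms(2,1)])
  qed (use assms smooth_atlas_euclid in \<open>auto simp: handle_eq_spin spin_inv_spin\<close>)
qed

section \<open>The local model\<close>

text \<open>A handle curve stays in the quadrant a \<le> 0 \<le> b and avoids the origin, so it
  never meets its own negative; for |t| \<ge> \<kappa> its norm is |t|, which gives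
  properness.\<close>

lemma profile_curve_handle_curve:
  assumes "handle_curve \<kappa> \<gamma>"
  shows "profile_curve \<gamma>"
proof -
  have h: "0 < \<kappa>" "smooth_on UNIV \<gamma>" "inj \<gamma>" "\<And>t. vector_derivative \<gamma> (at t) \<noteq> 0"
    "\<And>t. t \<le> -\<kappa> \<Longrightarrow> \<gamma> t = (t, 0)" "\<And>t. t \<ge> \<kappa> \<Longrightarrow> \<gamma> t = (0, t)"
    "\<And>t. \<bar>t\<bar> < \<kappa> \<Longrightarrow> fst (\<gamma> t) < 0 \<and> 0 < snd (\<gamma> t)"
    using assms unfolding handle_curve_def by auto
  have sgn: "fst (\<gamma> t) \<le> 0 \<and> 0 \<le> snd (\<gamma> t) \<and> (fst (\<gamma> t) < 0 \<or> 0 < snd (\<gamma> t))" for t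
    using h(1) h(5)[of t] h(6)[of t] h(7)[of t]
    by (cases "t \<le> -\<kappa>"; cases "t \<ge> \<kappa>") (auto simp: abs_less_iff)
  have "\<gamma> s \<noteq> - \<gamma> t" for s t
    using sgn[of s] sgn[of t] by (auto simp: prod_eq_iff)
  moreover have "\<exists>T. \<forall>t. norm (\<gamma> t) \<le> B \<longrightarrow> \<bar>t\<bar> \<le> T" for B
  proof (intro exI allI impI)
    fix t assume "norm (\<gamma> t) \<le> B"
    then show "\<bar>t\<bar> \<le> max \<kappa> B"
      using h(1) h(5)[of t] h(6)[of t] by (cases "t \<le> -\<kappa>"; cases "t \<ge> \<kappa>") (auto simp: norm_Pair)
  qed
  ultimately show ?thesis using h unfolding profile_curve_def by blast
qed

section \<open>The cut-off functions and smooth steps made from them\<close>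

locale antisurgery_model =
  fixes \<epsilon> \<delta> :: real and \<sigma> \<rho> :: "real \<Rightarrow> real"
  assumes params: "model_parameters \<epsilon> \<delta> \<sigma> \<rho>"
begin

lemma eps: "0 < \<epsilon>" "\<epsilon> < 1/2" and delta: "0 < \<delta>" "\<delta> < 1/2"
  and sigma: "smooth_on UNIV \<sigma>" "\<And>t. t \<le> \<delta> \<Longrightarrow> \<sigma> t = 0" "\<And>t. t \<ge> 1 - \<delta> \<Longrightarrow> \<sigma> t = 1 + \<epsilon>"
    "\<And>t. \<delta> < t \<Longrightarrow> t < 1 - \<delta> \<Longrightarrow> 0 < deriv \<sigma> t"
  and rho: "smooth_on {0..} \<rho>" "\<And>u. u \<ge> 0 \<Longrightarrow> 0 \<le> \<rho> u" "\<And>u. u \<ge> 1 + 2 * \<epsilon> \<Longrightarrow> \<rho> u = 0"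
    "\<And>u. u > 0 \<Longrightarrow> -1 / (1 + \<epsilon>) < deriv \<rho> u" "\<And>u. u > 0 \<Longrightarrow> deriv \<rho> u \<le> 0"
  and rho1: "\<exists>u\<^sub>0>0. \<forall>u\<in>{0..u\<^sub>0}. \<rho> u = 1"
  using params unfolding model_parameters_def by auto

lemma sigma_strict:
  assumes "\<delta> \<le> x" "x < y" "y \<le> 1 - \<delta>"
  shows "\<sigma> x < \<sigma> y"
proof (rule DERIV_pos_imp_increasing_open[OF assms(2)])
  fix t assume "x < t" "t < y"
  moreover have "\<sigma> differentiable at t" using smooth_on_imp_differentiable[OF sigma(1)] by simp
  ultimately show "\<exists>y. DERIV \<sigma> t :> y \<and> 0 < y"
    using assms sigma(4)[of t] by (intro exI[of _ "deriv \<sigma> t"]) (simp add: DERIV_deriv_iff_real_differentiable)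
next
  show "continuous_on {x..y} \<sigma>"
    using smooth_on_imp_continuous_on[OF sigma(1)] continuous_on_subset by blast
qed

lemma sigma_mono: "x \<le> y \<Longrightarrow> \<sigma> x \<le> \<sigma> y"
proof -
  \<comment> \<open>Clamping to the interval of strict increase changes no value of \<sigma>, which
    is constant on either side.\<close>
  define c where "c t = max \<delta> (min t (1 - \<delta>))" for t
  have *: "\<sigma> t = \<sigma> (c t)" for t
    using delta sigma(2)[of t] sigma(2)[of \<delta>] sigma(3)[of t] sigma(3)[of "1 - \<delta>"]
    by (cases "t \<le> \<delta>"; cases "t \<ge> 1 - \<delta>") (auto simp: c_def max_def min_def)
  assume "x \<le> y"
  then have "c x \<le> c y" "\<delta> \<le> c x" "c y \<le> 1 - \<delta>" using delta by (auto simp: c_def)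
  then show ?thesis
    using sigma_strict[of "c x" "c y"] unfolding *[of x] *[of y] by (cases "c x = c y") auto
qed

text \<open>The cut-off \<open>\<sigma>\<close> of the model serves as the smooth step from which handle curves are built.\<close>

lemma handle_profile_exists:
  assumes "\<kappa> > 0"
  obtains \<phi> \<psi> :: "real \<Rightarrow> real" where
    "smooth_on UNIV \<phi>" "\<And>t. (\<phi> has_real_derivative \<psi> t) (at t)" "\<And>t. 0 \<le> \<psi> t" "\<And>t. \<psi> t + \<psi> (-t) = 1"
    "\<And>t. t > -\<kappa> \<Longrightarrow> 0 < \<psi> t" "\<And>t. t \<le> -\<kappa> \<Longrightarrow> \<phi> t = 0" "\<And>t. t > -\<kappa> \<Longrightarrow> 0 < \<phi> t"
    "\<And>t. \<phi> t - \<phi> (-t) = t" "\<And>t. \<bar>t\<bar> \<le> \<kappa> \<Longrightarrow> \<phi> t + \<phi> (-t) \<le> \<kappa>"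
proof -
  \<comment> \<open>The scale for which 1/2 + l t maps [-\<kappa>, \<kappa>] onto
    [\<delta>, 1 - \<delta>].\<close>
  define l where "l = (1/2 - \<delta>) / \<kappa>"
  have l: "l > 0" "l * \<kappa> = 1/2 - \<delta>" using assms delta by (auto simp: l_def)
  define s where "s t = \<sigma> (1/2 + l * t) / (1 + \<epsilon>)" for t
  have s0: "s t = 0" if "t \<le> -\<kappa>" for t
  proof -
    have "l * t \<le> l * (-\<kappa>)" using that l(1) by (intro mult_left_mono) auto
    then show ?thesis using l by (simp add: s_def sigma(2))
  qed
  have s1: "s t = 1" if "t \<ge> \<kappa>" for t
  proof -
    have "l * t \<ge> l * \<kappa>" using that l(1) by (intro mult_left_mono) auto
    then show ?thesis using l eps by (simp add: s_def sigma(3))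
  qed
  have smono: "s x \<le> s y" if "x \<le> y" for x y
    unfolding s_def using that l(1) eps by (intro divide_right_mono sigma_mono) (auto simp: mult_left_mono)
  have spos: "s t > 0" if "t > -\<kappa>" for t
  proof -
    define u where "u = min t \<kappa>"
    have u: "u > -\<kappa>" "u \<le> \<kappa>" "u \<le> t" using that assms by (auto simp: u_def)
    have "l * (-\<kappa>) < l * u" "l * u \<le> l * \<kappa>" using u l(1) mult_strict_left_mono[OF u(1) l(1)] by (auto intro: mult_left_mono)
    then have "\<sigma> \<delta> < \<sigma> (1/2 + l * u)" using l by (intro sigma_strict) auto
    then have "s u > 0" using sigma(2)[of \<delta>] eps by (simp add: s_def)
    then show ?thesis using smono[OF u(3)] by linarith
  qed
  have sle: "s t \<le> 1" for t using smono[of t "max t \<kappa>"] s1[of "max t \<kappa>"] by simp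
  have sm_s: "smooth_on UNIV s"
    unfolding s_def using eps
    by (intro smooth_intros smooth_on_compose[OF _ sigma(1)]) auto
  \<comment> \<open>Symmetrizing the step gives \<psi> t + \<psi> (-t) = 1, which integrates to
    \<phi> t - \<phi> (-t) = t.\<close>
  define \<psi> where "\<psi> t = (s t + 1 - s (-t)) / 2" for t
  have sm\<psi>: "smooth_on UNIV \<psi>"
    unfolding \<psi>_def by (intro smooth_intros sm_s smooth_on_compose[OF _ sm_s]) auto
  have \<psi>0: "\<psi> t = 0" if "t \<le> -\<kappa>" for t using s0[OF that] s1[of "-t"] that by (simp add: \<psi>_def)
  have \<psi>pos: "\<psi> t > 0" if "t > -\<kappa>" for t using spos[OF that] sle[of "-t"] by (simp add: \<psi>_def)
  \<comment> \<open>Starting strictly to the left of -\<kappa> makes the lower limit harmless: the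
    integrand vanishes up to -\<kappa>, and for smaller t the interval is empty.\<close>
  define \<phi> where "\<phi> t = integral {-\<kappa>-1..t} \<psi>" for t
  have cont: "continuous_on UNIV \<psi>" using smooth_on_imp_continuous_on[OF sm\<psi>] .
  have \<phi>0: "\<phi> t = 0" if "t \<le> -\<kappa>" for t
  proof -
    have "\<phi> t = integral {-\<kappa>-1..t} (\<lambda>x. 0)"
      unfolding \<phi>_def by (rule integral_cong) (use that \<psi>0 in auto)
    then show ?thesis by simp
  qed
  have d\<phi>: "(\<phi> has_real_derivative \<psi> t) (at t)" for t
  proof (cases "t < -\<kappa>")
    case True
    have "((\<lambda>_. 0) has_real_derivative \<psi> t) (at t)" using True \<psi>0[of t] by simp
    then show ?thesis
      by (rule has_field_derivative_transform_within_open[of _ _ _ "{..<-\<kappa>}"]) (use True \<phi>0 in auto)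
  next
    case False
    have "((\<lambda>x. integral {-\<kappa>-1..x} \<psi>) has_real_derivative \<psi> t) (at t within {-\<kappa>-1..t+1})"
      by (rule integral_has_real_derivative) (use False continuous_on_subset[OF cont] in auto)
    then show ?thesis using False at_within_Icc_at[of "-\<kappa>-1" t "t+1"] unfolding \<phi>_def by simp
  qed
  have sm\<phi>: "smooth_on UNIV \<phi>"
    unfolding smooth_on_open[OF open_UNIV]
  proof
    fix k
    have s: "Ck_on k (\<lambda>x. \<psi> x * v) UNIV" for k v
      using smooth_on_mult[OF sm\<psi> smooth_on_const[of UNIV v]] smooth_on_open[OF open_UNIV] by blast
    have "Ck_on (Suc k) \<phi> UNIV"
      by (rule Ck_on_SucI[where D="\<lambda>x v. \<psi> x * v"]) (use s d\<phi> in \<open>auto simp: has_field_derivative_def\<close>)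
    then show "Ck_on k \<phi> UNIV" by (rule Ck_on_Suc_imp)
  qed
  have sum1: "\<psi> t + \<psi> (-t) = 1" for t by (simp add: \<psi>_def field_simps)
  have d\<phi>m: "((\<lambda>t. \<phi> (-t)) has_real_derivative - \<psi> (-t)) (at t)" for t
    using DERIV_chain2[where f=\<phi> and g=uminus and x=t and s=UNIV, OF d\<phi>[of "-t"] DERIV_minus[OF DERIV_ident]] by simp
  have diff: "\<phi> t - \<phi> (-t) = t" for t
  proof -
    have "((\<lambda>t. \<phi> t - \<phi> (-t) - t) has_real_derivative 0) (at t)" for t
      using DERIV_diff[OF DERIV_diff[OF d\<phi>[of t] d\<phi>m[of t]] DERIV_ident] sum1[of t] by simp
    then have "\<phi> t - \<phi> (-t) - t = \<phi> 0 - \<phi> (-0) - 0" by (rule DERIV_isconst_all[rule_format, of "\<lambda>t. \<phi> t - \<phi> (-t) - t"])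
    then show ?thesis by simp
  qed
  have pos: "\<phi> t > 0" if "t > -\<kappa>" for t
  proof -
    have "\<phi> (-\<kappa>) < \<phi> t"
    proof (rule DERIV_pos_imp_increasing_open[OF that])
      show "\<exists>y. DERIV \<phi> x :> y \<and> 0 < y" if "-\<kappa> < x" for x using d\<phi> \<psi>pos[OF that] by blast
      show "continuous_on {-\<kappa>..t} \<phi>"
        using d\<phi> by (meson DERIV_continuous_on DERIV_subset subset_UNIV)
    qed
    then show ?thesis using \<phi>0 by simp
  qed
  \<comment> \<open>For t \<ge> 0 the sum grows with t, since \<psi> (-t) \<le> \<psi> t, and it
    equals \<kappa> at t = \<kappa>. It bounds the norm of the handle curve (-\<phi> (-t), \<phi>
    t).\<close>
  have E: "\<phi> t + \<phi> (-t) \<le> \<kappa>" if "0 \<le> t" "t \<le> \<kappa>" for t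
  proof -
    have "\<phi> t + \<phi> (-t) \<le> \<phi> \<kappa> + \<phi> (-\<kappa>)"
    proof (rule DERIV_nonneg_imp_nondecreasing[OF that(2), of "\<lambda>t. \<phi> t + \<phi> (-t)"])
      fix x assume "t \<le> x" "x \<le> \<kappa>"
      then have "0 \<le> \<psi> x + - \<psi> (-x)" using smono[of "-x" x] that by (simp add: \<psi>_def)
      then show "\<exists>y. ((\<lambda>t. \<phi> t + \<phi> (-t)) has_real_derivative y) (at x) \<and> 0 \<le> y"
        using DERIV_add[OF d\<phi>[of x] d\<phi>m[of x]] by blast
    qed
    then show ?thesis using diff[of \<kappa>] \<phi>0[of "-\<kappa>"] by simp
  qed
  show ?thesis
  proof (rule that[OF sm\<phi> d\<phi> _ sum1 \<psi>pos \<phi>0 pos diff])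
    show "0 \<le> \<psi> t" for t using \<psi>pos[of t] \<psi>0[of t] by (cases "t \<le> -\<kappa>") auto
    show "\<phi> t + \<phi> (-t) \<le> \<kappa>" if "\<bar>t\<bar> \<le> \<kappa>" for t
      using that E[of t] E[of "-t"] by (cases "0 \<le> t") auto
  qed auto
qed

section \<open>The radial function at the upper end of the model\<close>

text \<open>The double point corresponds to q = 0, the boundary of the domain of \<rho>. As \<rho>
  is 1 near 0, continuing it by 1 keeps it smooth and makes two-sided derivatives available
  there.\<close>

definition rho_ext :: "real \<Rightarrow> real" where
  "rho_ext u = (if u < 0 then 1 else \<rho> u)"

text \<open>Where \<sigma> has reached 1 + \<epsilon>, the model function is \<open>f1\<close> of
  the squared norm.\<close>

definition f1 :: "real \<Rightarrow> real" where
  "f1 q = q + (1 + \<epsilon>) * rho_ext q - 1"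

definition f1' :: "real \<Rightarrow> real" where
  "f1' q = 1 + (1 + \<epsilon>) * deriv rho_ext q"

lemma smooth_rho_ext: "smooth_on UNIV rho_ext"
proof (rule smooth_on_local)
  obtain u\<^sub>0 where u: "u\<^sub>0 > 0" "\<And>u. 0 \<le> u \<Longrightarrow> u \<le> u\<^sub>0 \<Longrightarrow> \<rho> u = 1" using rho1 by auto
  fix x :: real
  show "\<exists>U. open U \<and> x \<in> U \<and> smooth_on (UNIV \<inter> U) rho_ext"
  proof (cases "x < u\<^sub>0")
    case True
    have "smooth_on {..<u\<^sub>0} rho_ext \<longleftrightarrow> smooth_on {..<u\<^sub>0} (\<lambda>_. 1 :: real)"
      by (rule smooth_on_cong) (use u in \<open>auto simp: rho_ext_def\<close>)
    then show ?thesis using True smooth_on_const by (intro exI[of _ "{..<u\<^sub>0}"]) auto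
  next
    case False
    have "smooth_on {0<..} rho_ext \<longleftrightarrow> smooth_on {0<..} \<rho>"
      by (rule smooth_on_cong) (auto simp: rho_ext_def)
    then show ?thesis using False u(1) smooth_on_subset[OF rho(1), of "{0<..}"] subsetI[of "{0::real<..}" "{0..}"]
      by (intro exI[of _ "{0<..}"]) auto
  qed
qed

lemma rho_ext_derivative: "(rho_ext has_real_derivative deriv rho_ext q) (at q)"
  using smooth_on_imp_differentiable[OF smooth_rho_ext] by (simp add: DERIV_deriv_iff_real_differentiable)

lemma f1_derivative: "(f1 has_real_derivative f1' q) (at q)"
  unfolding f1_def[abs_def] f1'_def
  by (rule derivative_eq_intros rho_ext_derivative refl | simp)+

lemma smooth_f1[smooth_intros]: "smooth_on S f \<Longrightarrow> smooth_on S (\<lambda>x. f1 (f x))"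
  using smooth_on_compose[OF _ smooth_rho_ext, of S f] unfolding f1_def by (intro smooth_intros) auto

lemma smooth_f1'[smooth_intros]: "smooth_on S f \<Longrightarrow> smooth_on S (\<lambda>x. f1' (f x))"
  using smooth_on_compose[OF _ smooth_on_deriv[OF smooth_rho_ext open_UNIV], of S f]
  unfolding f1'_def by (intro smooth_intros) auto

lemma deriv_rho_ext_pos: "q > 0 \<Longrightarrow> deriv rho_ext q = deriv \<rho> q"
  by (rule deriv_cong_ev) (auto simp: rho_ext_def intro!: eventually_nhds_in_open[of "{0<..}", THEN eventually_mono])

lemma near_zero:
  obtains u\<^sub>0 where "u\<^sub>0 > 0" "\<And>q. q < u\<^sub>0 \<Longrightarrow> f1 q = q + \<epsilon>" "\<And>q. q < u\<^sub>0 \<Longrightarrow> f1' q = 1"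
proof -
  obtain u\<^sub>0 where u: "u\<^sub>0 > 0" "\<And>u. 0 \<le> u \<Longrightarrow> u \<le> u\<^sub>0 \<Longrightarrow> \<rho> u = 1" using rho1 by auto
  have r: "rho_ext q = 1" if "q < u\<^sub>0" for q using u that by (auto simp: rho_ext_def)
  have "f1' q = 1" if "q < u\<^sub>0" for q
  proof -
    have "((\<lambda>_. 1) has_real_derivative 0) (at q)" by simp
    then have "(rho_ext has_real_derivative 0) (at q)"
      by (rule has_field_derivative_transform_within_open[of _ _ _ "{..<u\<^sub>0}"]) (use that r in auto)
    then show ?thesis by (simp add: f1'_def DERIV_imp_deriv)
  qed
  then show ?thesis using that[of u\<^sub>0] u(1) r by (simp add: f1_def)
qed

text \<open>The lower bound -1/(1 + \<epsilon>) on the derivative of \<rho> is precisely positivity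
  of \<open>f1'\<close>; the upper bound 0 gives \<open>f1'\<close> \<le> 1.\<close>

lemma f1'_pos: "f1' q > 0" and f1'_le: "f1' q \<le> 1"
proof -
  obtain u\<^sub>0 where u: "u\<^sub>0 > 0" "\<And>q. q < u\<^sub>0 \<Longrightarrow> f1' q = 1" using near_zero by metis
  have "f1' q > 0 \<and> f1' q \<le> 1"
  proof (cases "q < u\<^sub>0")
    case False
    then have q: "q > 0" using u(1) by simp
    have "-1 < (1 + \<epsilon>) * deriv \<rho> q" using rho(4)[OF q] eps by (simp add: field_simps)
    moreover have "(1 + \<epsilon>) * deriv \<rho> q \<le> 0" using rho(5)[OF q] eps by (simp add: mult_nonneg_nonpos)
    ultimately show ?thesis by (simp add: f1'_def deriv_rho_ext_pos[OF q])
  qed (use u in simp)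
  then show "f1' q > 0" "f1' q \<le> 1" by auto
qed

lemma f1_far: "q \<ge> 1 + 2 * \<epsilon> \<Longrightarrow> f1 q = q - 1"
  using eps rho(3) by (simp add: f1_def rho_ext_def)

lemma f1'_far: assumes "q \<ge> 1 + 2 * \<epsilon>" shows "f1' q = 1"
proof -
  have "deriv rho_ext q = 0"
  \<comment> \<open>Every such q is a minimum of the nonnegative function \<open>rho_ext\<close>.
    This also settles the endpoint 1 + 2\<epsilon>, where \<rho> is known to vanish on one side
    only.\<close>
  proof (rule DERIV_local_min[OF rho_ext_derivative, of 1])
    show "\<forall>y. \<bar>q - y\<bar> < 1 \<longrightarrow> rho_ext q \<le> rho_ext y"
      using assms eps rho(2,3) by (auto simp: rho_ext_def)
  qed simp
  then show ?thesis by (simp add: f1'_def)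
qed

lemma f1_strict: "p < q \<Longrightarrow> f1 p < f1 q"
  using DERIV_pos_imp_increasing f1_derivative f1'_pos by metis

lemma f1_less_iff: "f1 p < f1 q \<longleftrightarrow> p < q"
  using f1_strict by (metis linorder_neqE_linordered_idom order_less_asym)

lemma f1_0: "f1 0 = \<epsilon>"
  using near_zero by (metis add_0)

lemma f1_pos: "q \<ge> 0 \<Longrightarrow> f1 q > 0"
  using f1_strict[of 0 q] f1_0 eps by (cases "q = 0") auto

end

text \<open>The factor 3 is 3/2 from the exponent times 2 from the gradient 2x of the squared norm.
  Uniqueness of derivatives turns membership in the graph into an equation for y.\<close>

lemma graph_d32_radial:
  fixes x y :: "(real, 'n::finite) vec"
  assumes g: "\<And>z. g z = f ((norm z)\<^sup>2)" and f: "(f has_real_derivative f') (at ((norm x)\<^sup>2))"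
    and pos: "f ((norm x)\<^sup>2) > 0"
  shows "(x, y) \<in> graph_d32 g s \<longleftrightarrow> y = (s * 3 * sqrt (f ((norm x)\<^sup>2)) * f') *\<^sub>R x"
proof -
  let ?q = "(norm x)\<^sup>2" and ?c = "s * 3 * sqrt (f ((norm x)\<^sup>2)) * f'"
  have dq: "((\<lambda>z::(real, 'n) vec. (norm z)\<^sup>2) has_derivative (\<lambda>h. 2 * (x \<bullet> h))) (at x)"
    unfolding power2_norm_eq_inner by (rule derivative_eq_intros refl)+ (simp add: inner_commute)
  have df: "(f has_derivative (*) f') (at ?q)" using f by (simp add: has_field_derivative_def)
  have d1: "((\<lambda>w. s * w powr (3/2)) has_real_derivative s * (3/2 * (f ?q) powr (1/2))) (at (f ?q))"
    using pos by (auto intro!: derivative_eq_intros)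
  have d2: "((\<lambda>w. s * w powr (3/2)) has_derivative (\<lambda>h. s * (3/2 * sqrt (f ?q)) * h)) (at (f ?q))"
    by (rule has_derivative_eq_rhs[OF d1[unfolded has_field_derivative_def]])
      (use pos in \<open>simp add: powr_half_sqrt fun_eq_iff\<close>)
  have "((\<lambda>z. s * (f ((norm z)\<^sup>2)) powr (3/2)) has_derivative (\<lambda>h. s * (3/2 * sqrt (f ?q)) * (f' * (2 * (x \<bullet> h))))) (at x)"
    using has_derivative_compose[OF has_derivative_compose[OF dq df] d2] .
  moreover have "(\<lambda>h. s * (3/2 * sqrt (f ?q)) * (f' * (2 * (x \<bullet> h)))) = (\<lambda>h. (?c *\<^sub>R x) \<bullet> h)"
    by (simp add: fun_eq_iff)
  ultimately have D: "((\<lambda>z. s * g z powr (3/2)) has_derivative (\<lambda>h. (?c *\<^sub>R x) \<bullet> h)) (at x)"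
    by (simp add: g)
  have "((\<lambda>z. s * g z powr (3/2)) has_derivative (\<lambda>h. y \<bullet> h)) (at x) \<longleftrightarrow> y = ?c *\<^sub>R x"
  proof
    assume "((\<lambda>z. s * g z powr (3/2)) has_derivative (\<lambda>h. y \<bullet> h)) (at x)"
    then have "(\<lambda>h. y \<bullet> h) = (\<lambda>h. (?c *\<^sub>R x) \<bullet> h)" by (rule has_derivative_unique[OF _ D])
    then have "y \<bullet> h = (?c *\<^sub>R x) \<bullet> h" for h by (rule fun_cong)
    then show "y = ?c *\<^sub>R x" by (metis vector_eq_rdot)
  qed (use D in simp)
  then show ?thesis using pos by (simp add: graph_d32_def g)
qed

context antisurgery_model
begin

lemma model_f_0: "model_f \<sigma> \<rho> 0 x = (norm x)\<^sup>2 - 1"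
  using sigma(2)[of 0] delta by (simp add: model_f_def)

lemma model_f_1: "t \<ge> 1 - \<delta> \<Longrightarrow> model_f \<sigma> \<rho> t x = f1 ((norm x)\<^sup>2)"
  using sigma(3)[of t] by (simp add: model_f_def f1_def rho_ext_def)

lemma Lambda'_sheet_iff:
  "(x, y) \<in> Lambda'_sheet \<sigma> \<rho> s \<longleftrightarrow> y = (s * 3 * sqrt (f1 ((norm x)\<^sup>2)) * f1' ((norm x)\<^sup>2)) *\<^sub>R x"
  unfolding Lambda'_sheet_def
  by (rule graph_d32_radial) (use delta in \<open>auto simp: model_f_1 f1_derivative f1_pos\<close>)

text \<open>At |x| = 1 the root vanishes, so the formula reproduces the extension of dF by 0 to the
  boundary of its domain.\<close>

lemma Lambda_iff:
  "(x, y) \<in> Lambda \<sigma> \<rho> \<longleftrightarrow> norm x \<ge> 1 \<and>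
    (y = (3 * sqrt ((norm x)\<^sup>2 - 1)) *\<^sub>R x \<or> y = (- 3 * sqrt ((norm x)\<^sup>2 - 1)) *\<^sub>R x)"
proof -
  consider "norm x > 1" | "norm x = 1" | "norm x < 1" by linarith
  then show ?thesis
  proof cases
    case 1
    then have p: "(norm x)\<^sup>2 - 1 > 0" by (simp add: one_less_power)
    have d: "((\<lambda>q. q - 1) has_real_derivative 1) (at ((norm x)\<^sup>2))"
      by (auto intro!: derivative_eq_intros)
    have "(x, y) \<in> graph_d32 (model_f \<sigma> \<rho> 0) s \<longleftrightarrow> y = (s * 3 * sqrt ((norm x)\<^sup>2 - 1) * 1) *\<^sub>R x" for s
      by (rule graph_d32_radial[OF _ d p]) (simp add: model_f_0)
    then show ?thesis using 1 by (simp add: Lambda_def)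
  next
    case 2
    then show ?thesis by (simp add: Lambda_def graph_d32_def model_f_0)
  next
    case 3
    then have "(norm x)\<^sup>2 < 1" by (simp add: power_less_one_iff abs_square_less_1)
    with 3 show ?thesis by (simp add: Lambda_def graph_d32_def model_f_0)
  qed
qed

end

section \<open>The profile of a resolution\<close>

text \<open>The inverse \<beta> of x \<mapsto> 6 x sqrt(\<epsilon> + x^2): squaring b = 6 \<beta>
  sqrt(\<epsilon> + \<beta>^2) gives a quadratic equation for \<epsilon> + \<beta>^2, whose positive
  root stands under the outer square root. Written this way it is smooth at b = 0.\<close>

definition chart_beta :: "real \<Rightarrow> real \<Rightarrow> real" where
  "chart_beta \<epsilon> b = b / (6 * sqrt ((\<epsilon> + sqrt (\<epsilon>\<^sup>2 + b\<^sup>2 / 9)) / 2))"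

lemma chart_beta_root:
  fixes \<epsilon> b :: real
  assumes "\<epsilon> > 0"
  shows "\<epsilon> + (chart_beta \<epsilon> b)\<^sup>2 = (\<epsilon> + sqrt (\<epsilon>\<^sup>2 + b\<^sup>2 / 9)) / 2"
proof -
  define D where "D = sqrt (\<epsilon>\<^sup>2 + b\<^sup>2 / 9)"
  have D: "D\<^sup>2 = \<epsilon>\<^sup>2 + b\<^sup>2 / 9" "D > 0" using assms by (auto simp: D_def add_pos_nonneg)
  have "(chart_beta \<epsilon> b)\<^sup>2 = b\<^sup>2 / (36 * ((\<epsilon> + D) / 2))"
    unfolding chart_beta_def D_def[symmetric] using assms D(2) by (simp add: power_divide power_mult_distrib)
  also have "b\<^sup>2 = 9 * (D - \<epsilon>) * (D + \<epsilon>)" using D(1) by (simp add: algebra_simps power2_eq_square)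
  also have "9 * (D - \<epsilon>) * (D + \<epsilon>) / (36 * ((\<epsilon> + D) / 2)) = (D - \<epsilon>) / 2"
    using assms D(2) by (simp add: field_simps)
  finally show ?thesis by (simp add: D_def field_simps)
qed

lemma chart_beta_inverse:
  assumes "\<epsilon> > 0"
  shows "6 * sqrt (\<epsilon> + (chart_beta \<epsilon> b)\<^sup>2) * chart_beta \<epsilon> b = b"
proof -
  have "(\<epsilon> + sqrt (\<epsilon>\<^sup>2 + b\<^sup>2 / 9)) / 2 > 0" using assms by (simp add: add_pos_nonneg)
  then show ?thesis unfolding chart_beta_root[OF assms] by (simp add: chart_beta_def)
qed

lemma chart_beta_of:
  assumes "\<epsilon> > 0"
  shows "chart_beta \<epsilon> (6 * sqrt (\<epsilon> + x\<^sup>2) * x) = x"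
proof -
  let ?b = "6 * sqrt (\<epsilon> + x\<^sup>2) * x"
  have p: "\<epsilon> + x\<^sup>2 > 0" using assms by (simp add: add_pos_nonneg)
  have "\<epsilon>\<^sup>2 + ?b\<^sup>2 / 9 = (\<epsilon> + 2 * x\<^sup>2)\<^sup>2"
    using p by (simp add: power_mult_distrib) (simp add: power2_eq_square algebra_simps)
  then have "sqrt (\<epsilon>\<^sup>2 + ?b\<^sup>2 / 9) = \<epsilon> + 2 * x\<^sup>2" using assms by simp
  then have e: "(\<epsilon> + sqrt (\<epsilon>\<^sup>2 + ?b\<^sup>2 / 9)) / 2 = \<epsilon> + x\<^sup>2" by simp
  show ?thesis unfolding chart_beta_def e using p by simp
qed

lemma smooth_chart_beta[smooth_intros]:
  assumes "\<epsilon> > 0" "smooth_on S f"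
  shows "smooth_on S (\<lambda>x. chart_beta \<epsilon> (f x))"
proof -
  have p: "\<epsilon>\<^sup>2 + b\<^sup>2 / 9 > 0" for b :: real using assms(1) by (simp add: add_pos_nonneg)
  have "(\<epsilon> + sqrt (\<epsilon>\<^sup>2 + b\<^sup>2 / 9)) / 2 > 0" for b :: real using assms(1) p[of b] by (simp add: add_pos_pos)
  then show ?thesis unfolding chart_beta_def
    by (intro smooth_intros assms(2) p) (auto simp: less_imp_neq[symmetric])
qed

text \<open>Differentiating the relation 6 sqrt(\<epsilon> + \<beta>^2) \<beta> = b shows that the
  derivative times a positive number is 1.\<close>

lemma chart_beta_derivative:
  assumes "\<epsilon> > 0"
  obtains d where "(chart_beta \<epsilon> has_real_derivative d) (at b)" "d > 0"
proof -
  have "smooth_on UNIV (chart_beta \<epsilon>)" by (rule smooth_chart_beta[OF assms smooth_on_ident])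
  then have "chart_beta \<epsilon> differentiable (at b)" using smooth_on_imp_differentiable by blast
  then obtain d where d: "(chart_beta \<epsilon> has_real_derivative d) (at b)"
    using real_differentiable_def by blast
  let ?\<beta> = "chart_beta \<epsilon> b"
  have p: "\<epsilon> + ?\<beta>\<^sup>2 > 0" using assms by (simp add: add_pos_nonneg)
  have "((\<lambda>b. 6 * sqrt (\<epsilon> + (chart_beta \<epsilon> b)\<^sup>2) * chart_beta \<epsilon> b) has_real_derivative
    (6 * (2 * ?\<beta> * d / (2 * sqrt (\<epsilon> + ?\<beta>\<^sup>2))) * ?\<beta> + 6 * sqrt (\<epsilon> + ?\<beta>\<^sup>2) * d)) (at b)"
    using p by (auto intro!: derivative_eq_intros d simp: field_simps)
  moreover have "((\<lambda>b. 6 * sqrt (\<epsilon> + (chart_beta \<epsilon> b)\<^sup>2) * chart_beta \<epsilon> b) has_real_derivative 1) (at b)"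
    unfolding chart_beta_inverse[OF assms] by (rule DERIV_ident)
  ultimately have "6 * (2 * ?\<beta> * d / (2 * sqrt (\<epsilon> + ?\<beta>\<^sup>2))) * ?\<beta> + 6 * sqrt (\<epsilon> + ?\<beta>\<^sup>2) * d = 1"
    by (rule DERIV_unique)
  then have e: "d * (6 * ?\<beta>\<^sup>2 / sqrt (\<epsilon> + ?\<beta>\<^sup>2) + 6 * sqrt (\<epsilon> + ?\<beta>\<^sup>2)) = 1"
    using p by (simp add: power2_eq_square algebra_simps)
  have "6 * ?\<beta>\<^sup>2 / sqrt (\<epsilon> + ?\<beta>\<^sup>2) + 6 * sqrt (\<epsilon> + ?\<beta>\<^sup>2) > 0"
    using p by (intro add_nonneg_pos) auto
  then have "d > 0" using e by (metis zero_less_mult_pos2 zero_less_one)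
  with d that show ?thesis by blast
qed

lemma chart_beta_nonneg: "\<epsilon> > 0 \<Longrightarrow> b \<ge> 0 \<Longrightarrow> chart_beta \<epsilon> b \<ge> 0"
  and chart_beta_pos: "\<epsilon> > 0 \<Longrightarrow> b > 0 \<Longrightarrow> chart_beta \<epsilon> b > 0"
  and chart_beta_0: "chart_beta \<epsilon> 0 = 0"
  by (auto simp: chart_beta_def add_nonneg_nonneg add_pos_nonneg)

lemma chart_beta_le:
  assumes "\<epsilon> > 0" "b \<ge> 0"
  shows "chart_beta \<epsilon> b \<le> b / sqrt \<epsilon>"
proof -
  let ?\<beta> = "chart_beta \<epsilon> b"
  have "sqrt \<epsilon> * ?\<beta> \<le> 6 * sqrt (\<epsilon> + ?\<beta>\<^sup>2) * ?\<beta>"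
  proof (rule mult_right_mono[OF _ chart_beta_nonneg[OF assms]])
    have "sqrt \<epsilon> \<le> sqrt (\<epsilon> + ?\<beta>\<^sup>2)" by simp
    moreover have "0 \<le> sqrt (\<epsilon> + ?\<beta>\<^sup>2)" using assms by simp
    ultimately show "sqrt \<epsilon> \<le> 6 * sqrt (\<epsilon> + ?\<beta>\<^sup>2)" by linarith
  qed
  then show ?thesis unfolding chart_beta_inverse[OF assms(1)] using assms(1) by (simp add: field_simps)
qed

text \<open>With \<open>h x = 3 x sqrt (\<epsilon> + x\<^sup>2)\<close>, this is the numerator of the derivative of
  \<open>(h (\<alpha> + \<beta>) - 2 h \<beta>) / (3 (\<alpha> + \<beta>))\<close> along a curve with velocity \<open>(\<alpha>', \<beta>')\<close>.\<close>

lemma slope_numerator_neg: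
  fixes \<alpha> \<beta> \<alpha>' \<beta>' \<epsilon> :: real
  assumes "\<epsilon> > 0" "\<alpha> \<ge> 0" "\<beta> \<ge> 0" "\<alpha> + \<beta> > 0" "\<alpha>' \<le> 0" "\<beta>' \<ge> 0" "\<alpha>' < 0 \<or> \<beta>' > 0"
    and small: "\<alpha>\<^sup>2 + 3 * \<alpha> * \<beta> < 2 * \<epsilon>"
  defines "h \<equiv> \<lambda>x. 3 * x * sqrt (\<epsilon> + x\<^sup>2)" and "h' \<equiv> \<lambda>x. 3 * (\<epsilon> + 2 * x\<^sup>2) / sqrt (\<epsilon> + x\<^sup>2)"
  shows "(h' (\<alpha> + \<beta>) * (\<alpha>' + \<beta>') - 2 * h' \<beta> * \<beta>') * (\<alpha> + \<beta>) - (h (\<alpha> + \<beta>) - 2 * h \<beta>) * (\<alpha>' + \<beta>') < 0"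
proof -
  define X where "X = \<alpha> + \<beta>"
  define R S where "R = sqrt (\<epsilon> + X\<^sup>2)" and "S = sqrt (\<epsilon> + \<beta>\<^sup>2)"
  have R: "R > 0" "R\<^sup>2 = \<epsilon> + X\<^sup>2" and S: "S > 0" "S\<^sup>2 = \<epsilon> + \<beta>\<^sup>2"
    using assms(1) by (auto simp: R_def S_def add_pos_nonneg)
  have SR: "S \<le> R" using assms(2,3) by (simp add: R_def S_def X_def)
  have X: "X > 0" using assms(4) by (simp add: X_def)
  have hX: "h X = 3 * X * (\<epsilon> + X\<^sup>2) / R" "h \<beta> = 3 * \<beta> * (\<epsilon> + \<beta>\<^sup>2) / S"
    using R S unfolding h_def R_def[symmetric] S_def[symmetric]
    by (simp_all add: field_simps flip: R(2) S(2)) (simp_all add: power2_eq_square)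
  have hX': "h' X = 3 * (\<epsilon> + 2 * X\<^sup>2) / R" "h' \<beta> = 3 * (\<epsilon> + 2 * \<beta>\<^sup>2) / S"
    by (simp_all add: h'_def R_def S_def)
  \<comment> \<open>The numerator is linear in the velocity and equals \<alpha>' A + \<beta>' B, so
    A > 0 and B < 0 suffice.\<close>
  define A where "A = 3 * X^3 / R + 2 * h \<beta>"
  define B where "B = 3 * X^3 / R - 6 * \<beta>^3 / S - 6 * \<alpha> * (\<epsilon> + 2 * \<beta>\<^sup>2) / S"
  have e1: "h' X * X - h X = 3 * X^3 / R"
    unfolding hX hX' by (simp add: diff_divide_distrib[symmetric]) (simp add: algebra_simps power2_eq_square power3_eq_cube)
  have e2: "- 2 * h' \<beta> * X + 2 * h \<beta> = - 6 * \<beta>^3 / S - 6 * \<alpha> * (\<epsilon> + 2 * \<beta>\<^sup>2) / S"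
    unfolding hX hX' X_def using S(1) by (simp add: field_simps) (simp add: algebra_simps power2_eq_square power3_eq_cube)
  have B_eq: "B = (h' X * X - h X) + (- 2 * h' \<beta> * X + 2 * h \<beta>)" unfolding B_def e1 e2 by simp
  have A_eq: "A = (h' X * X - h X) + 2 * h \<beta>" unfolding A_def e1 by simp
  have eq: "(h' X * (\<alpha>' + \<beta>') - 2 * h' \<beta> * \<beta>') * X - (h X - 2 * h \<beta>) * (\<alpha>' + \<beta>') = \<alpha>' * A + \<beta>' * B"
    unfolding A_eq B_eq by (simp add: algebra_simps)
  have A: "A > 0" unfolding A_def h_def using X R assms(1,3) by (intro add_pos_nonneg) auto
  \<comment> \<open>This is B < 0 with R replaced by the smaller S. The identity \<open>i\<close>
    isolates \<alpha> (2\<epsilon> - \<alpha>^2 - 3\<alpha>\<beta>), the one place where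
    \<open>small\<close> enters.\<close>
  have "X^3 < 2 * \<beta>^3 + 2 * \<alpha> * (\<epsilon> + 2 * \<beta>\<^sup>2)"
  proof -
    have i: "2 * \<beta>^3 + 2 * \<alpha> * (\<epsilon> + 2 * \<beta>\<^sup>2) - X^3 = \<alpha> * (2 * \<epsilon> - (\<alpha>\<^sup>2 + 3 * \<alpha> * \<beta>)) + \<alpha> * \<beta>\<^sup>2 + \<beta>^3"
      by (simp add: X_def algebra_simps power2_eq_square power3_eq_cube)
    have "\<alpha> * (2 * \<epsilon> - (\<alpha>\<^sup>2 + 3 * \<alpha> * \<beta>)) + \<alpha> * \<beta>\<^sup>2 + \<beta>^3 > 0"
    proof (cases "\<alpha> = 0")
      case True
      then show ?thesis using assms(4) by simp
    next
      case False
      then have "\<alpha> * (2 * \<epsilon> - (\<alpha>\<^sup>2 + 3 * \<alpha> * \<beta>)) > 0" using assms(2) small by simp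
      moreover have "\<alpha> * \<beta>\<^sup>2 \<ge> 0" "\<beta>^3 \<ge> 0" using assms(2,3) by auto
      ultimately show ?thesis by linarith
    qed
    with i show ?thesis by linarith
  qed
  then have "X^3 / S < (2 * \<beta>^3 + 2 * \<alpha> * (\<epsilon> + 2 * \<beta>\<^sup>2)) / S" using S(1) by (rule divide_strict_right_mono)
  moreover have "X^3 / R \<le> X^3 / S" using SR S(1) X by (intro divide_left_mono) auto
  ultimately have "X^3 / R < (2 * \<beta>^3 + 2 * \<alpha> * (\<epsilon> + 2 * \<beta>\<^sup>2)) / S" by linarith
  then have B: "B < 0" by (simp add: B_def add_divide_distrib)
  have "\<alpha>' * A \<le> 0" "\<beta>' * B \<le> 0" using A B assms(5,6) by (auto simp: mult_nonpos_nonneg mult_nonneg_nonpos)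
  moreover have "\<alpha>' * A < 0 \<or> \<beta>' * B < 0" using A B assms(7) by (auto simp: mult_neg_pos mult_pos_neg)
  ultimately have "\<alpha>' * A + \<beta>' * B < 0" by linarith
  then show ?thesis using eq by (simp add: X_def)
qed

context antisurgery_model
begin

section \<open>A small handle with monotone reduced slope\<close>

text \<open>\<open>X\<close> is to be the radius of the resolution and \<open>m\<close> its slope
  divided by 3 \<open>f1'\<close>. Smallness of \<kappa> makes \<open>m\<close> strictly decreasing
  and keeps the bend where \<open>f1\<close> q = q + \<epsilon>, so that the effect of the cross
  chart on the handle is explicit.\<close>

lemma profile_data:
  assumes u\<^sub>0: "u\<^sub>0 > 0" "\<And>q. q < u\<^sub>0 \<Longrightarrow> f1 q = q + \<epsilon>" and \<kappa>\<^sub>0: "\<kappa>\<^sub>0 > 0"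
  obtains \<kappa> \<gamma> X m where "0 < \<kappa>" "\<kappa> < \<kappa>\<^sub>0" "handle_curve \<kappa> \<gamma>"
    "smooth_on UNIV X" "smooth_on UNIV m" "\<And>t. X t > 0"
    "\<And>t. \<exists>m'<0. (m has_real_derivative m') (at t)"
    "\<And>t. X t = - fst (\<gamma> t) + chart_beta \<epsilon> (snd (\<gamma> t))"
    "\<And>t. (X t)\<^sup>2 < u\<^sub>0 \<Longrightarrow> 3 * m t * X t = 3 * sqrt (\<epsilon> + (X t)\<^sup>2) * X t - snd (\<gamma> t)"
    "\<And>t. t \<ge> \<kappa> \<Longrightarrow> m t = - sqrt (f1 ((X t)\<^sup>2)) \<and> t = 6 * sqrt (\<epsilon> + (X t)\<^sup>2) * X t"
    "\<And>t. t \<le> -\<kappa> \<Longrightarrow> m t = sqrt (f1 ((X t)\<^sup>2)) \<and> X t = - t"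
    "\<And>t. \<bar>t\<bar> \<le> \<kappa> \<Longrightarrow> (X t)\<^sup>2 < u\<^sub>0 \<and> X t < 1"
    "\<And>t. (m t)\<^sup>2 \<le> f1 ((X t)\<^sup>2)"
proof -
  \<comment> \<open>In the bend \<alpha> \<le> \<kappa> and \<beta> \<le> \<kappa> / sqrt
    \<epsilon>, so the radius \<alpha> + \<beta> is at most \<kappa> C.\<close>
  define C where "C = 1 + 1 / sqrt \<epsilon>"
  have C: "C \<ge> 1" using eps by (simp add: C_def)
  \<comment> \<open>The four bounds serve, in order, for \<alpha> \<le> 1; for 3 \<alpha> X \<le>
    3\<epsilon>/4 < 2\<epsilon>, as the slope estimate requires, and X < 1; for X^2 <
    \<open>u\<^sub>0\<close>; and for staying below \<open>\<kappa>\<^sub>0\<close>.\<close>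
  define \<kappa> where "\<kappa> = min (min (min 1 (\<epsilon> / (4 * C))) (sqrt u\<^sub>0 / (2 * C))) (\<kappa>\<^sub>0 / 2)"
  have pos: "\<epsilon> / (4 * C) > 0" "sqrt u\<^sub>0 / (2 * C) > 0" using C eps u\<^sub>0(1) by simp_all
  have \<kappa>: "\<kappa> > 0" "\<kappa> \<le> 1" "\<kappa> \<le> \<epsilon> / (4 * C)" "\<kappa> \<le> sqrt u\<^sub>0 / (2 * C)" "\<kappa> < \<kappa>\<^sub>0"
    using pos \<kappa>\<^sub>0 unfolding \<kappa>_def by linarith+
  have \<kappa>C: "\<kappa> * C \<le> \<epsilon> / 4" "\<kappa> * C < sqrt u\<^sub>0"
  proof -
    have "\<kappa> * C \<le> \<epsilon> / (4 * C) * C" "\<kappa> * C \<le> sqrt u\<^sub>0 / (2 * C) * C"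
      by (rule mult_right_mono[OF \<kappa>(3)] mult_right_mono[OF \<kappa>(4)]; use C in simp)+
    then have "\<kappa> * C \<le> \<epsilon> / 4" "\<kappa> * C \<le> sqrt u\<^sub>0 / 2" using C by auto
    then show "\<kappa> * C \<le> \<epsilon> / 4" "\<kappa> * C < sqrt u\<^sub>0" using u\<^sub>0(1) real_sqrt_gt_zero[of u\<^sub>0] by linarith+
  qed
  obtain \<phi> \<psi> where \<phi>: "smooth_on UNIV \<phi>" "\<And>t. (\<phi> has_real_derivative \<psi> t) (at t)" "\<And>t. 0 \<le> \<psi> t"
    "\<And>t. \<psi> t + \<psi> (-t) = 1" "\<And>t. t > -\<kappa> \<Longrightarrow> 0 < \<psi> t" "\<And>t. t \<le> -\<kappa> \<Longrightarrow> \<phi> t = 0" "\<And>t. t > -\<kappa> \<Longrightarrow> 0 < \<phi> t"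
    "\<And>t. \<phi> t - \<phi> (-t) = t" "\<And>t. \<bar>t\<bar> \<le> \<kappa> \<Longrightarrow> \<phi> t + \<phi> (-t) \<le> \<kappa>"
    using handle_profile_exists[OF \<kappa>(1)] by metis
  have \<phi>nn: "\<phi> t \<ge> 0" for t using \<phi>(6)[of t] \<phi>(7)[of t] by (cases "t \<le> -\<kappa>") auto
  have \<phi>id: "\<phi> t = t" if "t \<ge> \<kappa>" for t using \<phi>(8)[of t] \<phi>(6)[of "-t"] that by simp
  have d\<phi>m: "((\<lambda>t. \<phi> (-t)) has_real_derivative - \<psi> (-t)) (at t)" for t
    using DERIV_chain2[where f=\<phi> and g=uminus and x=t and s=UNIV, OF \<phi>(2)[of "-t"] DERIV_minus[OF DERIV_ident]] by simp
  have sm\<phi>m: "smooth_on UNIV (\<lambda>t. \<phi> (-t))"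
    by (rule smooth_on_compose[OF _ \<phi>(1)]) (auto intro: smooth_intros)
  \<comment> \<open>The sum of the two coordinates is \<phi> t - \<phi> (-t) = t, whence
    injectivity.\<close>
  define \<gamma> where "\<gamma> t = (- \<phi> (-t), \<phi> t)" for t
  have hc: "handle_curve \<kappa> \<gamma>"
    unfolding handle_curve_def
  proof (intro conjI allI impI)
    show "smooth_on UNIV \<gamma>" unfolding \<gamma>_def by (intro smooth_intros \<phi>(1) sm\<phi>m)
    show "inj \<gamma>" using \<phi>(8) by (auto simp: inj_def \<gamma>_def) metis
    show "vector_derivative \<gamma> (at t) \<noteq> 0" for t
    proof -
      have "(\<gamma> has_vector_derivative (\<psi> (-t), \<psi> t)) (at t)"
        unfolding \<gamma>_def using DERIV_minus[OF d\<phi>m[of t]] \<phi>(2)[of t]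
        by (intro has_vector_derivative_Pair) (simp_all add: has_real_derivative_iff_has_vector_derivative)
      then have "vector_derivative \<gamma> (at t) = (\<psi> (-t), \<psi> t)" by (rule vector_derivative_at)
      then show ?thesis using \<phi>(4)[of t] by (auto simp: zero_prod_def)
    qed
    show "\<gamma> t = (t, 0)" if "t \<le> -\<kappa>" for t using that \<phi>(6)[of t] \<phi>id[of "-t"] by (simp add: \<gamma>_def)
    show "\<gamma> t = (0, t)" if "\<kappa> \<le> t" for t using that \<phi>id[of t] \<phi>(6)[of "-t"] by (simp add: \<gamma>_def)
    show "fst (\<gamma> t) < 0" "0 < snd (\<gamma> t)" if "\<bar>t\<bar> < \<kappa>" for t
      using that \<phi>(7)[of t] \<phi>(7)[of "-t"] by (auto simp: \<gamma>_def)
    show "norm (\<gamma> t) \<le> \<kappa>" if "\<bar>t\<bar> \<le> \<kappa>" for t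
    proof -
      have "norm (\<gamma> t) \<le> \<bar>\<phi> (-t)\<bar> + \<bar>\<phi> t\<bar>"
        unfolding \<gamma>_def norm_Pair using sqrt_sum_squares_le_sum_abs[of "- \<phi> (-t)" "\<phi> t"] by simp
      then show ?thesis using \<phi>(9)[OF that] \<phi>nn[of t] \<phi>nn[of "-t"] by simp
    qed
  qed (rule \<kappa>(1))
  define \<alpha> \<beta> where "\<alpha> t = \<phi> (-t)" and "\<beta> t = chart_beta \<epsilon> (\<phi> t)" for t
  define X where "X t = \<alpha> t + \<beta> t" for t
  define h where "h x = 3 * x * sqrt (f1 (x\<^sup>2))" for x
  \<comment> \<open>\<open>h\<close> is the height of the positive arm divided by
    \<open>f1'\<close>, and 2 h \<beta> is the second handle coordinate as long as \<beta>^2 <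
    \<open>u\<^sub>0\<close>. Through the global \<open>h\<close>, \<open>m\<close> becomes plus or
    minus sqrt(\<open>f1\<close>) on the arms even beyond the reach of the explicit chart.\<close>
  define m where "m t = (h (X t) - 2 * h (\<beta> t)) / (3 * X t)" for t
  have nn: "\<alpha> t \<ge> 0" "\<beta> t \<ge> 0" for t
    using \<phi>nn eps by (auto simp: \<alpha>_def \<beta>_def chart_beta_nonneg)
  have Xpos: "X t > 0" for t
  proof (cases "t > -\<kappa>")
    case True
    then show ?thesis using nn[of t] chart_beta_pos[OF eps(1) \<phi>(7)[OF True]] by (simp add: X_def \<beta>_def)
  next
    case False
    then have "\<alpha> t > 0" using \<phi>(7)[of "-t"] \<kappa>(1) by (simp add: \<alpha>_def)
    then show ?thesis using nn[of t] by (simp add: X_def)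
  qed
  have smX: "smooth_on UNIV X" unfolding X_def \<alpha>_def \<beta>_def by (intro smooth_intros sm\<phi>m \<phi>(1) eps(1))
  have f1p: "f1 (x\<^sup>2) > 0" for x using f1_pos by simp
  have smh: "smooth_on UNIV (\<lambda>t. h (g t))" if "smooth_on UNIV g" for g :: "real \<Rightarrow> real"
    unfolding h_def by (intro smooth_intros that f1p)
  have sm\<beta>: "smooth_on UNIV \<beta>" unfolding \<beta>_def by (intro smooth_intros \<phi>(1) eps(1))
  have smm: "smooth_on UNIV m"
    unfolding m_def using Xpos by (intro smooth_intros smh smX sm\<beta>) (auto simp: less_imp_neq[symmetric])
  have \<beta>0: "\<beta> t = 0" if "t \<le> -\<kappa>" for t using that \<phi>(6) by (simp add: \<beta>_def chart_beta_0)
  have \<alpha>0: "\<alpha> t = 0" if "t \<ge> \<kappa>" for t using that \<phi>(6)[of "-t"] by (simp add: \<alpha>_def)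
  have m1: "m t = - sqrt (f1 ((X t)\<^sup>2))" if "t \<ge> \<kappa>" for t
    using that \<alpha>0[of t] Xpos[of t] by (simp add: m_def X_def h_def)
  have m2: "m t = sqrt (f1 ((X t)\<^sup>2))" if "t \<le> -\<kappa>" for t
    using that \<beta>0[of t] Xpos[of t] by (simp add: m_def X_def h_def)
  have X1: "t = 6 * sqrt (\<epsilon> + (X t)\<^sup>2) * X t" if "t \<ge> \<kappa>" for t
    using chart_beta_inverse[OF eps(1), of "\<phi> t"] \<phi>id[OF that] \<alpha>0[OF that] by (simp add: X_def \<beta>_def)
  have X2: "X t = - t" if "t \<le> -\<kappa>" for t
    using \<beta>0[OF that] \<phi>id[of "-t"] that by (simp add: X_def \<alpha>_def)
  have small: "\<alpha> t \<le> \<kappa>" "\<beta> t \<le> \<kappa> / sqrt \<epsilon>" if "\<bar>t\<bar> \<le> \<kappa>" for t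
  proof -
    have le: "\<phi> t \<le> \<kappa>" "\<phi> (-t) \<le> \<kappa>" using \<phi>(9)[OF that] \<phi>nn[of t] \<phi>nn[of "-t"] by auto
    then show "\<alpha> t \<le> \<kappa>" by (simp add: \<alpha>_def)
    have "\<beta> t \<le> \<phi> t / sqrt \<epsilon>" unfolding \<beta>_def by (rule chart_beta_le[OF eps(1) \<phi>nn])
    also have "\<dots> \<le> \<kappa> / sqrt \<epsilon>" using le(1) eps by (intro divide_right_mono) auto
    finally show "\<beta> t \<le> \<kappa> / sqrt \<epsilon>" .
  qed
  have Xsmall: "X t \<le> \<kappa> * C" if "\<bar>t\<bar> \<le> \<kappa>" for t
    using small[OF that] by (simp add: X_def C_def distrib_left)
  have Xu: "(X t)\<^sup>2 < u\<^sub>0" "X t < 1" if "\<bar>t\<bar> \<le> \<kappa>" for t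
  proof -
    have "X t < sqrt u\<^sub>0" using Xsmall[OF that] \<kappa>C by linarith
    then show "(X t)\<^sup>2 < u\<^sub>0" using Xpos[of t] u\<^sub>0(1) by (metis less_eq_real_def power_strict_mono real_sqrt_pow2 zero_less_numeral)
    show "X t < 1" using Xsmall[OF that] \<kappa>C eps by linarith
  qed
  have hmono: "h x \<le> h y" if "0 \<le> x" "x \<le> y" for x y
  proof -
    have "f1 (x\<^sup>2) \<le> f1 (y\<^sup>2)" using that f1_less_iff[of "y\<^sup>2" "x\<^sup>2"] by (meson not_less power_mono)
    then show ?thesis unfolding h_def using that f1p by (intro mult_mono) (auto simp: less_imp_le)
  qed
  \<comment> \<open>From 0 \<le> h \<beta> \<le> h X the numerator of \<open>m\<close> lies between
    -h X and h X: the resolution runs between the two arms.\<close>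
  have mle: "(m t)\<^sup>2 \<le> f1 ((X t)\<^sup>2)" for t
  proof -
    have "0 \<le> h (\<beta> t)" "h (\<beta> t) \<le> h (X t)"
      using hmono[of 0 "\<beta> t"] hmono[of "\<beta> t" "X t"] nn[of t] by (auto simp: X_def h_def)
    then have "\<bar>h (X t) - 2 * h (\<beta> t)\<bar> \<le> h (X t)" by linarith
    then have "\<bar>m t\<bar> \<le> h (X t) / (3 * X t)"
      unfolding m_def using Xpos[of t] by (simp add: abs_divide divide_right_mono)
    also have "\<dots> = sqrt (f1 ((X t)\<^sup>2))" using Xpos[of t] by (simp add: h_def)
    finally have "\<bar>m t\<bar>\<^sup>2 \<le> (sqrt (f1 ((X t)\<^sup>2)))\<^sup>2" by (rule power_mono) simp
    then show ?thesis using f1p[of "X t"] by simp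
  qed
  have hloc: "h x = 3 * x * sqrt (\<epsilon> + x\<^sup>2)" if "x\<^sup>2 < u\<^sub>0" for x
    using u\<^sub>0(2)[OF that] by (simp add: h_def add.commute)
  have chart: "3 * m t * X t = 3 * sqrt (\<epsilon> + (X t)\<^sup>2) * X t - snd (\<gamma> t)" if "(X t)\<^sup>2 < u\<^sub>0" for t
  proof -
    have "(\<beta> t)\<^sup>2 \<le> (X t)\<^sup>2" using nn[of t] by (intro power_mono) (auto simp: X_def)
    then have "(\<beta> t)\<^sup>2 < u\<^sub>0" using that by linarith
    then have "2 * h (\<beta> t) = \<phi> t"
      using chart_beta_inverse[OF eps(1), of "\<phi> t"] by (simp add: hloc \<beta>_def mult.commute mult.left_commute)
    moreover have "3 * m t * X t = h (X t) - 2 * h (\<beta> t)" using Xpos[of t] by (simp add: m_def)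
    ultimately show ?thesis using hloc[OF that] by (simp add: \<gamma>_def)
  qed
  have dm: "\<exists>m'<0. (m has_real_derivative m') (at t)" for t
  proof -
    obtain g where g: "(chart_beta \<epsilon> has_real_derivative g) (at (\<phi> t))" "g > 0"
      using chart_beta_derivative[OF eps(1)] by blast
    have d\<beta>: "(\<beta> has_real_derivative (g * \<psi> t)) (at t)"
      unfolding \<beta>_def[abs_def] by (rule DERIV_chain2[OF g(1) \<phi>(2)])
    have d\<alpha>: "(\<alpha> has_real_derivative (- \<psi> (-t))) (at t)" unfolding \<alpha>_def[abs_def] by (rule d\<phi>m)
    have dX: "(X has_real_derivative (- \<psi> (-t) + g * \<psi> t)) (at t)"
      unfolding X_def[abs_def] by (rule DERIV_add[OF d\<alpha> d\<beta>])
    have dr: "((\<lambda>x. sqrt (f1 (x\<^sup>2))) has_real_derivative (f1' (x\<^sup>2) * (2 * x) / (2 * sqrt (f1 (x\<^sup>2))))) (at x)" for x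
      using f1p[of x]
      by (auto intro!: derivative_eq_intros DERIV_chain2[OF f1_derivative] simp: field_simps)
    \<comment> \<open>Only the bend uses the slope estimate. On the arms \<open>m\<close> is plus or
      minus sqrt(\<open>f1\<close>) of X^2, with X increasing to the right and decreasing to the
      left.\<close>
    consider "\<bar>t\<bar> \<le> \<kappa>" | "t > \<kappa>" | "t < -\<kappa>" by linarith
    then show ?thesis
    proof cases
      case 1
      define h' where "h' = (\<lambda>x. 3 * (\<epsilon> + 2 * x\<^sup>2) / sqrt (\<epsilon> + x\<^sup>2))"
      have dh: "(h has_real_derivative h' x) (at x)" if x: "x\<^sup>2 < u\<^sub>0" for x
      proof -
        have p: "\<epsilon> + x\<^sup>2 > 0" using eps by (simp add: add_pos_nonneg)
        have sq: "sqrt (\<epsilon> + x\<^sup>2) * sqrt (\<epsilon> + x\<^sup>2) = \<epsilon> + x\<^sup>2" using p by simp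
        have "((\<lambda>x. 3 * x * sqrt (\<epsilon> + x\<^sup>2)) has_real_derivative (3 * sqrt (\<epsilon> + x\<^sup>2) + 3 * x * (2 * x / (2 * sqrt (\<epsilon> + x\<^sup>2))))) (at x)"
          using p by (auto intro!: derivative_eq_intros simp: field_simps)
        also have "3 * sqrt (\<epsilon> + x\<^sup>2) + 3 * x * (2 * x / (2 * sqrt (\<epsilon> + x\<^sup>2))) = h' x"
          using p sq by (simp add: h'_def field_simps power2_eq_square)
        finally show ?thesis
        proof (rule has_field_derivative_transform_within_open[of _ _ _ "{y. y\<^sup>2 < u\<^sub>0}"])
          show "open {y::real. y\<^sup>2 < u\<^sub>0}" by (intro open_Collect_less continuous_intros)
        qed (use x hloc in auto)
      qed
      have XU: "(X t)\<^sup>2 < u\<^sub>0" using Xu[OF 1] by blast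
      have "(\<beta> t)\<^sup>2 \<le> (X t)\<^sup>2" using nn[of t] by (intro power_mono) (auto simp: X_def)
      then have \<beta>U: "(\<beta> t)\<^sup>2 < u\<^sub>0" using XU by linarith
      define X' where "X' = - \<psi> (-t) + g * \<psi> t"
      define N where "N = (h' (X t) * X' - 2 * h' (\<beta> t) * (g * \<psi> t)) * X t - (h (X t) - 2 * h (\<beta> t)) * X'"
      have "((\<lambda>t. (h (X t) - 2 * h (\<beta> t)) / (3 * X t)) has_real_derivative
        ((h' (X t) * X' - 2 * (h' (\<beta> t) * (g * \<psi> t))) * (3 * X t) - (h (X t) - 2 * h (\<beta> t)) * (3 * X')) / (3 * X t * (3 * X t))) (at t)"
        unfolding X'_def using Xpos[of t]
        by (intro DERIV_divide DERIV_diff DERIV_cmult DERIV_chain2[OF dh[OF XU] dX] DERIV_chain2[OF dh[OF \<beta>U] d\<beta>] dX) auto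
      moreover have "((h' (X t) * X' - 2 * (h' (\<beta> t) * (g * \<psi> t))) * (3 * X t) - (h (X t) - 2 * h (\<beta> t)) * (3 * X')) / (3 * X t * (3 * X t))
        = N / (3 * (X t)\<^sup>2)"
        using Xpos[of t] by (simp add: N_def divide_simps power2_eq_square)
      ultimately have dm: "(m has_real_derivative (N / (3 * (X t)\<^sup>2))) (at t)" unfolding m_def[abs_def] by simp
      have "N < 0"
      proof -
        have k1: "(\<alpha> t)\<^sup>2 + 3 * \<alpha> t * \<beta> t < 2 * \<epsilon>"
        proof -
          have "(\<alpha> t)\<^sup>2 + 3 * \<alpha> t * \<beta> t \<le> 3 * (\<alpha> t * X t)"
            using nn[of t] by (simp add: X_def power2_eq_square algebra_simps)
          also have "\<dots> \<le> 3 * (1 * (\<kappa> * C))"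
            using nn[of t] small(1)[OF 1] Xsmall[OF 1] Xpos[of t] \<kappa>(2) by (intro mult_left_mono mult_mono) auto
          finally show ?thesis using \<kappa>C(1) eps by linarith
        qed
        have "- \<psi> (-t) < 0 \<or> g * \<psi> t > 0"
          using \<phi>(3)[of t] \<phi>(3)[of "-t"] \<phi>(4)[of t] g(2) by (cases "\<psi> (-t) = 0") auto
        then show ?thesis
          using slope_numerator_neg[OF eps(1) nn[of t] _ _ _ _ k1, of "- \<psi> (-t)" "g * \<psi> t"]
            Xpos[of t] \<phi>(3)[of t] \<phi>(3)[of "-t"] g(2) hloc[OF XU] hloc[OF \<beta>U]
          unfolding N_def X'_def h'_def X_def by simp
      qed
      then have "N / (3 * (X t)\<^sup>2) < 0" using Xpos[of t] by (simp add: divide_neg_pos)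
      with dm show ?thesis by blast
    next
      case 2
      have p: "- \<psi> (-t) = 0" "\<psi> t > 0" using 2 \<kappa>(1) \<phi>(5)[of t] \<phi>(4)[of t] \<phi>(8)[of t]
      proof -
        have "((\<lambda>_. 0) has_real_derivative 0) (at (-t))" by simp
        then have "(\<phi> has_real_derivative 0) (at (-t))"
          by (rule has_field_derivative_transform_within_open[of _ _ _ "{..<-\<kappa>}"]) (use 2 \<phi>(6) in auto)
        then show "- \<psi> (-t) = 0" using DERIV_unique \<phi>(2) by fastforce
        show "\<psi> t > 0" using 2 \<kappa>(1) \<phi>(5)[of t] by simp
      qed
      have "((\<lambda>t. - sqrt (f1 ((X t)\<^sup>2))) has_real_derivative
          - (f1' ((X t)\<^sup>2) * (2 * X t) / (2 * sqrt (f1 ((X t)\<^sup>2))) * (- \<psi> (-t) + g * \<psi> t))) (at t)"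
        by (rule DERIV_minus[OF DERIV_chain2[OF dr dX]])
      then have "(m has_real_derivative - (f1' ((X t)\<^sup>2) * (2 * X t) / (2 * sqrt (f1 ((X t)\<^sup>2))) * (- \<psi> (-t) + g * \<psi> t))) (at t)"
        by (rule has_field_derivative_transform_within_open[of _ _ _ "{\<kappa><..}"]) (use 2 m1 in auto)
      moreover have "f1' ((X t)\<^sup>2) * (2 * X t) / (2 * sqrt (f1 ((X t)\<^sup>2))) * (- \<psi> (-t) + g * \<psi> t) > 0"
        using p g(2) Xpos[of t] f1'_pos f1p[of "X t"] by simp
      ultimately show ?thesis using neg_less_0_iff_less by blast
    next
      case 3
      have "((\<lambda>t. sqrt (f1 ((- t)\<^sup>2))) has_real_derivative
          (f1' ((- t)\<^sup>2) * (2 * (- t)) / (2 * sqrt (f1 ((- t)\<^sup>2))) * (- 1))) (at t)"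
        by (rule DERIV_chain2[OF dr DERIV_minus[OF DERIV_ident]])
      then have "(m has_real_derivative (f1' ((- t)\<^sup>2) * (2 * (- t)) / (2 * sqrt (f1 ((- t)\<^sup>2))) * (- 1))) (at t)"
        by (rule has_field_derivative_transform_within_open[of _ _ _ "{..<-\<kappa>}"]) (use 3 m2 X2 in auto)
      moreover have "f1' ((- t)\<^sup>2) * (2 * (- t)) / (2 * sqrt (f1 ((- t)\<^sup>2))) > 0"
        using 3 \<kappa>(1) f1'_pos f1p[of "-t"] by (intro divide_pos_pos mult_pos_pos) auto
      ultimately show ?thesis by (metis mult_minus1_right neg_less_0_iff_less)
    qed
  qed
  show ?thesis
    by (rule that[OF \<kappa>(1,5) hc smX smm Xpos dm _ chart])
      (use m1 m2 X1 X2 Xu mle in \<open>auto simp: X_def \<alpha>_def \<beta>_def \<gamma>_def\<close>)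
qed

end

section \<open>The cross chart and the isotopy\<close>

lemma radial_field_derivative:
  fixes x :: "'a::real_inner"
  assumes "(c has_real_derivative c') (at ((norm x)\<^sup>2))"
  shows "((\<lambda>x. c ((norm x)\<^sup>2) *\<^sub>R x) has_derivative
    (\<lambda>v. c ((norm x)\<^sup>2) *\<^sub>R v + (c' * (2 * (x \<bullet> v))) *\<^sub>R x)) (at x)"
proof -
  have dq: "((\<lambda>z. (norm z)\<^sup>2) has_derivative (\<lambda>h. 2 * (x \<bullet> h))) (at x)"
    unfolding power2_norm_eq_inner by (rule derivative_eq_intros refl)+ (simp add: inner_commute)
  have "((\<lambda>z. c ((norm z)\<^sup>2)) has_derivative (\<lambda>h. c' * (2 * (x \<bullet> h)))) (at x)"
    using has_derivative_compose[OF dq] assms by (simp add: has_field_derivative_def)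
  from has_derivative_scaleR[OF this has_derivative_ident] show ?thesis .
qed

text \<open>The terms by which the shear changes the form cancel because the derivative of K is
  symmetric, that is, K is a gradient field.\<close>

lemma symmetric_shear_symplectomorphism:
  fixes K :: "'a::euclidean_space \<Rightarrow> 'a"
  assumes sm: "smooth_on UNIV K" and d: "\<And>x. (K has_derivative K' x) (at x)"
    and sym: "\<And>x u v. K' x u \<bullet> v = u \<bullet> K' x v"
  shows "symplectomorphism cotangent cotangent UNIV UNIV (\<lambda>z. (fst z, snd z + K (fst z)))"
    and "symplectomorphism cotangent cotangent UNIV UNIV (\<lambda>z. (fst z + K (snd z), snd z))"
proof -
  have smK: "smooth_on UNIV (\<lambda>z. K (g z))" if "smooth_on UNIV g" for g :: "'a \<times> 'a \<Rightarrow> 'a"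
    by (rule smooth_on_compose[OF that sm]) simp
  have "diffeomorphism euclid euclid UNIV UNIV (\<lambda>z. (fst z, snd z + K (fst z)))"
    by (rule diffeomorphismI[where g="\<lambda>z. (fst z, snd z - K (fst z))"])
      (auto simp: smooth_atlas_euclid smooth_map_euclid intro!: smooth_intros smK)
  moreover have "preserves_form cotangent cotangent UNIV (\<lambda>z. (fst z, snd z + K (fst z)))"
    unfolding preserves_form_cotangent
  proof (intro ballI allI)
    fix z u v :: "'a \<times> 'a"
    have "((\<lambda>z. (fst z, snd z + K (fst z))) has_derivative (\<lambda>h. (fst h, snd h + K' (fst z) (fst h)))) (at z)"
      by (intro has_derivative_Pair has_derivative_add has_derivative_fst has_derivative_snd has_derivative_ident
          has_derivative_compose[OF _ d])
    then have e: "frechet_derivative (\<lambda>z. (fst z, snd z + K (fst z))) (at z) = (\<lambda>h. (fst h, snd h + K' (fst z) (fst h)))"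
      by (rule frechet_derivative_at[symmetric])
    show "fst (frechet_derivative (\<lambda>z. (fst z, snd z + K (fst z))) (at z) u) \<bullet>
        snd (frechet_derivative (\<lambda>z. (fst z, snd z + K (fst z))) (at z) v) -
      snd (frechet_derivative (\<lambda>z. (fst z, snd z + K (fst z))) (at z) u) \<bullet>
        fst (frechet_derivative (\<lambda>z. (fst z, snd z + K (fst z))) (at z) v) = fst u \<bullet> snd v - snd u \<bullet> fst v"
      unfolding e using sym[of "fst z" "fst u" "fst v"] by (simp add: inner_add_left inner_add_right)
  qed
  ultimately show "symplectomorphism cotangent cotangent UNIV UNIV (\<lambda>z. (fst z, snd z + K (fst z)))"
    by (simp add: symplectomorphism_def atlas_of_cotangent)
  have "diffeomorphism euclid euclid UNIV UNIV (\<lambda>z. (fst z + K (snd z), snd z))"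
    by (rule diffeomorphismI[where g="\<lambda>z. (fst z - K (snd z), snd z)"])
      (auto simp: smooth_atlas_euclid smooth_map_euclid intro!: smooth_intros smK)
  moreover have "preserves_form cotangent cotangent UNIV (\<lambda>z. (fst z + K (snd z), snd z))"
    unfolding preserves_form_cotangent
  proof (intro ballI allI)
    fix z u v :: "'a \<times> 'a"
    have "((\<lambda>z. (fst z + K (snd z), snd z)) has_derivative (\<lambda>h. (fst h + K' (snd z) (snd h), snd h))) (at z)"
      by (intro has_derivative_Pair has_derivative_add has_derivative_fst has_derivative_snd has_derivative_ident
          has_derivative_compose[OF _ d])
    then have e: "frechet_derivative (\<lambda>z. (fst z + K (snd z), snd z)) (at z) = (\<lambda>h. (fst h + K' (snd z) (snd h), snd h))"
      by (rule frechet_derivative_at[symmetric])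
    show "fst (frechet_derivative (\<lambda>z. (fst z + K (snd z), snd z)) (at z) u) \<bullet>
        snd (frechet_derivative (\<lambda>z. (fst z + K (snd z), snd z)) (at z) v) -
      snd (frechet_derivative (\<lambda>z. (fst z + K (snd z), snd z)) (at z) u) \<bullet>
        fst (frechet_derivative (\<lambda>z. (fst z + K (snd z), snd z)) (at z) v) = fst u \<bullet> snd v - snd u \<bullet> fst v"
      unfolding e using sym[of "snd z" "snd u" "snd v"] by (simp add: inner_add_left inner_add_right)
  qed
  ultimately show "symplectomorphism cotangent cotangent UNIV UNIV (\<lambda>z. (fst z + K (snd z), snd z))"
    by (simp add: symplectomorphism_def atlas_of_cotangent)
qed

text \<open>The field c(|x|^2) x is the gradient of a radial function. The domain of c extends below
  0 so that c is smooth at the value |x|^2 = 0.\<close>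

lemma radial_shear_symplectomorphism:
  fixes c :: "real \<Rightarrow> real"
  assumes c: "smooth_on {-a<..} c" and a: "a > 0"
  shows "symplectomorphism cotangent cotangent UNIV UNIV
      (\<lambda>z::'n::finite phase. (fst z, snd z + c ((norm (fst z))\<^sup>2) *\<^sub>R fst z))"
    and "symplectomorphism cotangent cotangent UNIV UNIV
      (\<lambda>z::'n::finite phase. (fst z + c ((norm (snd z))\<^sup>2) *\<^sub>R snd z, snd z))"
proof -
  let ?K = "\<lambda>x::(real, 'n) vec. c ((norm x)\<^sup>2) *\<^sub>R x"
  let ?K' = "\<lambda>(x::(real, 'n) vec) v. c ((norm x)\<^sup>2) *\<^sub>R v + (deriv c ((norm x)\<^sup>2) * (2 * (x \<bullet> v))) *\<^sub>R x"
  have gt: "-a < (norm x)\<^sup>2" for x :: "(real, 'n) vec" using a by (smt (verit) zero_le_power2)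
  have d: "(c has_real_derivative deriv c ((norm x)\<^sup>2)) (at ((norm x)\<^sup>2))" for x :: "(real, 'n) vec"
    using smooth_on_imp_differentiable[OF c, of "(norm x)\<^sup>2"] gt[of x] by (simp add: DERIV_deriv_iff_real_differentiable)
  have sm: "smooth_on UNIV ?K"
    unfolding power2_norm_eq_inner
    by (intro smooth_intros smooth_on_compose[OF _ c]) (use gt in \<open>auto simp: power2_norm_eq_inner\<close>)
  have dK: "(?K has_derivative ?K' x) (at x)" for x by (rule radial_field_derivative[OF d])
  have sym: "?K' x u \<bullet> v = u \<bullet> ?K' x v" for x u v
    by (simp add: inner_add_left inner_add_right inner_commute)
  show "symplectomorphism cotangent cotangent UNIV UNIV
      (\<lambda>z::'n phase. (fst z, snd z + c ((norm (fst z))\<^sup>2) *\<^sub>R fst z))"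
    by (rule symmetric_shear_symplectomorphism(1)[OF sm dK sym])
  show "symplectomorphism cotangent cotangent UNIV UNIV
      (\<lambda>z::'n phase. (fst z + c ((norm (snd z))\<^sup>2) *\<^sub>R snd z, snd z))"
    by (rule symmetric_shear_symplectomorphism(2)[OF sm dK sym])
qed

text \<open>Near the origin \<open>\<Lambda>'\<close> is the union of the graphs of \<open>\<plusminus>h\<close>, \<open>h x = 3 sqrt (\<epsilon> + |x|\<^sup>2) x\<close>. The second
  shear takes the first axis to the graph of \<open>h\<close> and the graph of \<open>-2h\<close> to that of \<open>-h\<close>; the
  first shear takes the second axis to the graph of \<open>-2h\<close>.\<close>

definition cross_chart :: "real \<Rightarrow> 'n::finite phase \<Rightarrow> 'n phase" where
  "cross_chart \<epsilon> z =
     (let x = fst z - (1 / (6 * sqrt ((\<epsilon> + sqrt (\<epsilon>\<^sup>2 + (norm (snd z))\<^sup>2 / 9)) / 2))) *\<^sub>R snd z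
      in (x, snd z + (3 * sqrt (\<epsilon> + (norm x)\<^sup>2)) *\<^sub>R x))"

lemma cross_chart_symplectomorphism:
  assumes "\<epsilon> > 0"
  shows "symplectomorphism cotangent cotangent UNIV UNIV (cross_chart \<epsilon> :: 'n::finite phase \<Rightarrow> _)"
proof -
  \<comment> \<open>The coefficients as functions of a squared norm w: for b > 0 and w = b^2,
    \<open>?c\<close> is -\<beta>(b)/b with \<beta> = \<open>chart_beta \<epsilon>\<close>, and
    \<open>?e\<close> is the factor in the equation of the positive sheet near the origin.\<close>
  let ?c = "\<lambda>w::real. - (1 / (6 * sqrt ((\<epsilon> + sqrt (\<epsilon>\<^sup>2 + w / 9)) / 2)))" and ?e = "\<lambda>w::real. 3 * sqrt (\<epsilon> + w)"
  have p1: "\<epsilon>\<^sup>2 + w / 9 > 0" if "w \<in> {- (9 * \<epsilon>\<^sup>2)<..}" for w using that by simp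
  have p2: "(\<epsilon> + sqrt (\<epsilon>\<^sup>2 + w / 9)) / 2 > 0" if "w \<in> {- (9 * \<epsilon>\<^sup>2)<..}" for w
    using p1[OF that] assms by (simp add: add_pos_pos)
  have s1: "smooth_on {- (9 * \<epsilon>\<^sup>2)<..} ?c"
    using p2 by (intro smooth_intros p1) (auto simp: less_imp_neq[symmetric])
  have s2: "smooth_on {-\<epsilon><..} ?e" by (intro smooth_intros) auto
  have "symplectomorphism cotangent cotangent UNIV UNIV
    (\<lambda>z::'n phase. (fst (fst z + ?c ((norm (snd z))\<^sup>2) *\<^sub>R snd z, snd z),
       snd (fst z + ?c ((norm (snd z))\<^sup>2) *\<^sub>R snd z, snd z) +
       ?e ((norm (fst (fst z + ?c ((norm (snd z))\<^sup>2) *\<^sub>R snd z, snd z)))\<^sup>2) *\<^sub>R fst (fst z + ?c ((norm (snd z))\<^sup>2) *\<^sub>R snd z, snd z)))"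
    by (rule symplectomorphism_compose[OF _ radial_shear_symplectomorphism(1)[OF s2 assms] radial_shear_symplectomorphism(2)[OF s1]])
      (use assms in \<open>auto simp: atlas_of_cotangent smooth_atlas_euclid\<close>)
  moreover have "(\<lambda>z::'n phase. (fst (fst z + ?c ((norm (snd z))\<^sup>2) *\<^sub>R snd z, snd z),
       snd (fst z + ?c ((norm (snd z))\<^sup>2) *\<^sub>R snd z, snd z) +
       ?e ((norm (fst (fst z + ?c ((norm (snd z))\<^sup>2) *\<^sub>R snd z, snd z)))\<^sup>2) *\<^sub>R fst (fst z + ?c ((norm (snd z))\<^sup>2) *\<^sub>R snd z, snd z)))
     = cross_chart \<epsilon>"
    by (simp add: fun_eq_iff cross_chart_def Let_def)
  ultimately show ?thesis by simp
qed

text \<open>The chart commutes with rotations and preserves each plane of pairs (a w, b w), so on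
  handles it acts through a map of profile curves.\<close>

lemma cross_chart_ray:
  assumes "norm w = 1"
  shows "cross_chart \<epsilon> (a *\<^sub>R w, b *\<^sub>R w) = ((a - chart_beta \<epsilon> b) *\<^sub>R w,
    (b + 3 * sqrt (\<epsilon> + (a - chart_beta \<epsilon> b)\<^sup>2) * (a - chart_beta \<epsilon> b)) *\<^sub>R w)"
proof -
  have "a *\<^sub>R w - (1 / (6 * sqrt ((\<epsilon> + sqrt (\<epsilon>\<^sup>2 + (norm (b *\<^sub>R w))\<^sup>2 / 9)) / 2))) *\<^sub>R (b *\<^sub>R w) = (a - chart_beta \<epsilon> b) *\<^sub>R w"
    using assms by (simp add: chart_beta_def scaleR_left_diff_distrib)
  then show ?thesis
    unfolding cross_chart_def Let_def fst_conv snd_conv using assms by (simp add: scaleR_left_distrib)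
qed

lemma cross_chart_first_axis: "cross_chart \<epsilon> (x, 0) = (x, (3 * sqrt (\<epsilon> + (norm x)\<^sup>2)) *\<^sub>R x)"
  by (simp add: cross_chart_def Let_def)

lemma cross_chart_second_axis:
  assumes "\<epsilon> > 0"
  shows "cross_chart \<epsilon> (0, - (6 * sqrt (\<epsilon> + (norm x)\<^sup>2)) *\<^sub>R x) = (x, - (3 * sqrt (\<epsilon> + (norm x)\<^sup>2)) *\<^sub>R x)"
proof (cases "x = 0")
  case False
  \<comment> \<open>The chart sends (0, b w) to a point over -\<beta>(b) w; for this to lie over x
    with b > 0, w must be opposite to x.\<close>
  define w where "w = - (x /\<^sub>R norm x)"
  have w: "norm w = 1" "x = - norm x *\<^sub>R w" using False by (auto simp: w_def)
  define r where "r = norm x"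
  let ?b = "6 * sqrt (\<epsilon> + r\<^sup>2) * r"
  have "cross_chart \<epsilon> (0 *\<^sub>R w, ?b *\<^sub>R w) = ((-r) *\<^sub>R w, (3 * sqrt (\<epsilon> + r\<^sup>2) * r) *\<^sub>R w)"
    unfolding cross_chart_ray[OF w(1)] chart_beta_of[OF assms] by simp
  moreover have "0 *\<^sub>R w = 0" "?b *\<^sub>R w = - (6 * sqrt (\<epsilon> + (norm x)\<^sup>2)) *\<^sub>R x" "(-r) *\<^sub>R w = x"
    "(3 * sqrt (\<epsilon> + r\<^sup>2) * r) *\<^sub>R w = - (3 * sqrt (\<epsilon> + (norm x)\<^sup>2)) *\<^sub>R x"
    using False by (simp_all add: r_def w_def)
  ultimately show ?thesis by simp
qed (simp add: cross_chart_def)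

lemma second_axis_cover:
  fixes y :: "(real, 'n::finite) vec"
  assumes "\<epsilon> > 0"
  obtains x where "y = - (6 * sqrt (\<epsilon> + (norm x)\<^sup>2)) *\<^sub>R x"
proof (cases "y = 0")
  case False
  let ?\<beta> = "chart_beta \<epsilon> (norm y)"
  define x where "x = - ?\<beta> *\<^sub>R (y /\<^sub>R norm y)"
  have u: "norm (y /\<^sub>R norm y) = 1" using False by simp
  have n: "(norm x)\<^sup>2 = ?\<beta>\<^sup>2" unfolding x_def norm_scaleR[of "- ?\<beta>"] u by simp
  have "- (6 * sqrt (\<epsilon> + (norm x)\<^sup>2)) *\<^sub>R x = (6 * sqrt (\<epsilon> + ?\<beta>\<^sup>2) * ?\<beta>) *\<^sub>R (y /\<^sub>R norm y)"
    unfolding n by (simp add: x_def)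
  also have "\<dots> = y" unfolding chart_beta_inverse[OF assms] using False by simp
  finally show ?thesis using that by metis
qed (use that[of 0] in simp)

section \<open>The compact region supporting the isotopy\<close>

text \<open>Over q = |x|^2 \<le> 1 + 2\<epsilon>, the curves in question have |y|^2 = 9 m^2 k^2 q
  with m^2 \<le> 2\<epsilon> and 0 < k \<le> 1, which gives the bound 18 \<epsilon> (1 +
  2\<epsilon>).\<close>

definition model_core :: "real \<Rightarrow> 'n::finite phase set" where
  "model_core \<epsilon> = cball 0 (sqrt (1 + 2 * \<epsilon>)) \<times> cball 0 (sqrt (18 * \<epsilon> * (1 + 2 * \<epsilon>)))"

lemma compact_model_core: "compact (model_core \<epsilon>)"
  by (auto simp: model_core_def intro: compact_Times)

lemma model_core_iff:
  fixes x y :: "(real, 'n::finite) vec"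
  assumes "0 < \<epsilon>"
  shows "(x, y) \<in> model_core \<epsilon> \<longleftrightarrow> (norm x)\<^sup>2 \<le> 1 + 2 * \<epsilon> \<and> (norm y)\<^sup>2 \<le> 18 * \<epsilon> * (1 + 2 * \<epsilon>)"
proof -
  have "norm v \<le> sqrt a \<longleftrightarrow> (norm v)\<^sup>2 \<le> a" for v :: "(real, 'n) vec" and a
    by (metis norm_ge_zero real_le_rsqrt real_sqrt_le_iff real_sqrt_unique)
  then show ?thesis by (simp add: model_core_def)
qed

text \<open>In terms of s = sqrt(2\<epsilon>) the difference of the two sides is 3 s (1 - s) (2 - s
  + 3 s^2), positive because \<epsilon> < 1/2 means s < 1.\<close>

lemma model_box_bound:
  assumes "0 < \<epsilon>" "\<epsilon> < 1/2"
  shows "18 * \<epsilon> * (1 + 2 * \<epsilon>) < 6 * sqrt (2 * \<epsilon>) * (1 + 4 * \<epsilon>)"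
proof -
  define s where "s = sqrt (2 * \<epsilon>)"
  have s: "0 < s" "s < 1" "s\<^sup>2 = 2 * \<epsilon>" using assms by (auto simp: s_def)
  then have e: "\<epsilon> = s\<^sup>2 / 2" by simp
  have "2 - s + 3 * s\<^sup>2 > 0" using s(2) zero_le_power2[of s] by linarith
  then have "(1 - s) * (2 - s + 3 * s\<^sup>2) > 0" using s by (intro mult_pos_pos) auto
  then have "6 * s * ((1 - s) * (2 - s + 3 * s\<^sup>2)) > 0" using s by simp
  moreover have "6 * s * (1 + 4 * \<epsilon>) - 18 * \<epsilon> * (1 + 2 * \<epsilon>) = 3 * s * ((1 - s) * (2 - s + 3 * s\<^sup>2))"
    unfolding e by (simp add: algebra_simps power2_eq_square)
  ultimately show ?thesis by (simp add: s_def)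
qed

lemma model_core_subset:
  assumes "0 < \<epsilon>" "\<epsilon> < 1/2"
  shows "model_core \<epsilon> \<subseteq> (closure (model_box \<epsilon>) :: 'n::finite phase set)"
proof -
  let ?a = "1 + 2 * \<epsilon>" and ?b = "6 * sqrt (2 * \<epsilon>) * (1 + 4 * \<epsilon>)"
  have pos: "?a > 0" "?b > 0" using assms by (auto simp: add_pos_pos)
  have lt: "norm v < sqrt a \<longleftrightarrow> (norm v)\<^sup>2 < a" if "a > 0" for v :: "(real, 'n) vec" and a
    using that by (metis norm_ge_zero real_less_rsqrt real_sqrt_less_iff real_sqrt_unique)
  have "model_box \<epsilon> = (ball 0 (sqrt ?a) \<times> ball 0 (sqrt ?b) :: 'n phase set)"
    unfolding model_box_def using lt pos by auto
  then have "closure (model_box \<epsilon>) = (cball 0 (sqrt ?a) \<times> cball 0 (sqrt ?b) :: 'n phase set)"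
    using pos by (simp add: closure_Times)
  moreover have "sqrt (18 * \<epsilon> * (1 + 2 * \<epsilon>)) \<le> sqrt ?b"
    using model_box_bound[OF assms] by simp
  ultimately show ?thesis
    unfolding model_core_def by (simp only:) (intro Sigma_mono subset_cball order_refl; simp)
qed

context antisurgery_model
begin

section \<open>Interpolation between the profiles\<close>

text \<open>At \<tau> = 0 this is r^2 = 1 + m^2, y = 3 m r, the profile of \<Lambda>; at \<tau> = 1
  it is r = X, y = 3 m f1' r, the resolution. The value of r^2 and the factor 1 or f1' are
  interpolated, while \<open>m\<close> is the same at all times.\<close>

definition profile_family :: "(real \<Rightarrow> real) \<Rightarrow> (real \<Rightarrow> real) \<Rightarrow> real \<Rightarrow> real \<Rightarrow> real \<times> real" where
  "profile_family X m \<tau> t =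
     (let q = (1 - \<tau>) * (1 + (m t)\<^sup>2) + \<tau> * (X t)\<^sup>2
      in (sqrt q, 3 * m t * ((1 - \<tau>) + \<tau> * f1' q) * sqrt q))"

end

text \<open>The isotopy sees the resolution through its radius and reduced slope;
  \<open>right\<close> and \<open>left\<close> describe the arms, \<open>core\<close> the
  bend.\<close>

locale profile_setup = antisurgery_model +
  fixes \<kappa> :: real and X m :: "real \<Rightarrow> real"
  assumes kappa: "0 < \<kappa>"
    and smX: "smooth_on UNIV X" and smm: "smooth_on UNIV m"
    and Xpos: "X t > 0"
    and dm: "\<exists>m'<0. (m has_real_derivative m') (at t)"
    and right: "t \<ge> \<kappa> \<Longrightarrow> m t = - sqrt (f1 ((X t)\<^sup>2)) \<and> t = 6 * sqrt (\<epsilon> + (X t)\<^sup>2) * X t"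
    and left: "t \<le> -\<kappa> \<Longrightarrow> m t = sqrt (f1 ((X t)\<^sup>2)) \<and> X t = - t"
    and core: "\<bar>t\<bar> \<le> \<kappa> \<Longrightarrow> X t < 1"
    and mle: "(m t)\<^sup>2 \<le> f1 ((X t)\<^sup>2)"
begin

text \<open>In the bend X < 1, so such a radius occurs on the arms only, where m^2 = f1 (X^2) = X^2
  - 1.\<close>

lemma m_far:
  assumes "(X t)\<^sup>2 > 1 + 2 * \<epsilon>"
  shows "(X t)\<^sup>2 = 1 + (m t)\<^sup>2"
proof -
  have "X t \<ge> 1"
  proof (rule ccontr)
    assume "\<not> X t \<ge> 1"
    then have "(X t)\<^sup>2 < 1" using Xpos[of t] by (simp add: power_less_one_iff)
    then show False using assms eps by simp
  qed
  then have "\<not> \<bar>t\<bar> \<le> \<kappa>" using core[of t] by auto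
  then have "(m t)\<^sup>2 = f1 ((X t)\<^sup>2)"
    using right[of t] left[of t] f1_pos[of "(X t)\<^sup>2"] by (cases "t \<ge> \<kappa>") auto
  then show ?thesis using f1_far[of "(X t)\<^sup>2"] assms by simp
qed

text \<open>The point of \<Lambda> with parameter t has r^2 = 1 + m^2. So the points of \<Lambda>
  and of the resolution with equal parameter pass the radius 1 + 2\<epsilon> of r^2
  together.\<close>

lemma m_far_iff: "(m t)\<^sup>2 > 2 * \<epsilon> \<longleftrightarrow> (X t)\<^sup>2 > 1 + 2 * \<epsilon>"
proof
  assume "(m t)\<^sup>2 > 2 * \<epsilon>"
  then have "f1 (1 + 2 * \<epsilon>) < f1 ((X t)\<^sup>2)" using mle[of t] f1_far[of "1 + 2 * \<epsilon>"] by simp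
  then show "(X t)\<^sup>2 > 1 + 2 * \<epsilon>" by (simp add: f1_less_iff)
qed (use m_far in fastforce)

lemma inj_m: "inj m"
proof -
  have "m x > m y" if "x < y" for x y
    using that by (rule DERIV_neg_imp_decreasing) (use dm in blast)
  then show ?thesis by (metis injI less_irrefl linorder_neqE_linordered_idom)
qed

lemma X_of: 
  assumes "x > 0" "6 * sqrt (\<epsilon> + x\<^sup>2) * x \<ge> \<kappa>"
  shows "X (6 * sqrt (\<epsilon> + x\<^sup>2) * x) = x"
proof -
  let ?t = "6 * sqrt (\<epsilon> + x\<^sup>2) * x"
  have "?t = 6 * sqrt (\<epsilon> + (X ?t)\<^sup>2) * X ?t" using right[OF assms(2)] by simp
  then have "chart_beta \<epsilon> ?t = chart_beta \<epsilon> (6 * sqrt (\<epsilon> + (X ?t)\<^sup>2) * X ?t)" by (rule arg_cong)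
  then show ?thesis unfolding chart_beta_of[OF eps(1)] by simp
qed

lemma X_proper: "X t \<le> B \<Longrightarrow> \<bar>t\<bar> \<le> \<kappa> + (B + 6 * sqrt (\<epsilon> + B\<^sup>2) * B)"
proof -
  assume B: "X t \<le> B"
  then have B0: "B > 0" using Xpos[of t] by linarith
  then have p: "6 * sqrt (\<epsilon> + B\<^sup>2) * B \<ge> 0" using eps by simp
  consider "\<bar>t\<bar> \<le> \<kappa>" | "t > \<kappa>" | "t < -\<kappa>" by linarith
  then show ?thesis
  proof cases
    case 2
    have "6 * sqrt (\<epsilon> + (X t)\<^sup>2) * X t \<le> 6 * sqrt (\<epsilon> + B\<^sup>2) * B"
      using B Xpos[of t] eps by (intro mult_mono) (auto intro: power_mono)
    then show ?thesis using right[of t] 2 B0 kappa by linarith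
  next
    case 3
    then show ?thesis using left[of t] B p kappa by linarith
  qed (use p B0 in linarith)
qed

text \<open>Needed for the curve at \<tau> = 0 to sweep out both branches of \<Lambda> entirely; the
  arms provide arbitrarily large slopes of either sign.\<close>

lemma m_surj: "\<exists>t. m t = v"
proof -
  \<comment> \<open>Chosen so that x^2 - 1 \<ge> v^2, so that x^2 is beyond 1 + 2\<epsilon>, and so
    that -x lies on the left arm.\<close>
  define x where "x = 2 + \<bar>v\<bar> + \<kappa>"
  have x: "x \<ge> 2" "x \<ge> \<kappa>" using kappa by (auto simp: x_def)
  have "(2 + \<bar>v\<bar>)\<^sup>2 \<le> x\<^sup>2" using kappa by (intro power_mono) (auto simp: x_def)
  then have xv: "x\<^sup>2 \<ge> 4 + v\<^sup>2" by (simp add: power2_eq_square algebra_simps)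
  have f: "f1 (x\<^sup>2) = x\<^sup>2 - 1" using xv eps zero_le_power2[of v] by (intro f1_far) linarith
  have "sqrt (x\<^sup>2 - 1) \<ge> \<bar>v\<bar>" using xv by (intro real_le_rsqrt) simp
  then have sq: "sqrt (f1 (x\<^sup>2)) \<ge> \<bar>v\<bar>" using f by simp
  let ?t = "6 * sqrt (\<epsilon> + x\<^sup>2) * x"
  have "sqrt (\<epsilon> + x\<^sup>2) \<ge> 1" using x eps by (simp add: add_increasing)
  then have "1 \<le> 6 * sqrt (\<epsilon> + x\<^sup>2)" by linarith
  then have "1 * x \<le> ?t" using x(1) by (intro mult_right_mono) simp_all
  then have t: "?t \<ge> \<kappa>" "?t \<ge> -x" using x by linarith+
  have "m ?t = - sqrt (f1 (x\<^sup>2))" using right[OF t(1)] X_of[OF _ t(1)] x by simp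
  moreover have "m (-x) = sqrt (f1 (x\<^sup>2))" using left[of "-x"] x by simp
  moreover have "continuous_on {-x..?t} m"
    using smooth_on_imp_continuous_on[OF smm] continuous_on_subset by blast
  ultimately have "\<exists>s\<ge>-x. s \<le> ?t \<and> m s = v"
    using sq t(2) by (intro IVT2') auto
  then show ?thesis by blast
qed

abbreviation Q :: "real \<Rightarrow> real \<Rightarrow> real" where
  "Q \<tau> t \<equiv> (1 - \<tau>) * (1 + (m t)\<^sup>2) + \<tau> * (X t)\<^sup>2"

lemma Q_pos: "0 \<le> \<tau> \<Longrightarrow> \<tau> \<le> 1 \<Longrightarrow> Q \<tau> t > 0"
proof (cases "\<tau> = 0")
  case False
  assume "0 \<le> \<tau>" "\<tau> \<le> 1"
  moreover from this have "(1 - \<tau>) * (1 + (m t)\<^sup>2) \<ge> 0" by simp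
  ultimately show ?thesis using Xpos[of t] False by (simp add: add_nonneg_pos)
qed (simp add: add_pos_nonneg)

lemma scale_pos: "0 \<le> \<tau> \<Longrightarrow> \<tau> \<le> 1 \<Longrightarrow> (1 - \<tau>) + \<tau> * f1' q > 0"
  using f1'_pos[of q] by (cases "\<tau> = 0") (auto intro!: add_nonneg_pos)

lemma smooth_profile_family:
  "smooth_on ({0..1} \<times> UNIV) (\<lambda>(\<tau>, t). profile_family X m \<tau> t)"
proof -
  have c: "smooth_on ({0..1} \<times> UNIV) (\<lambda>w. X (snd w))" "smooth_on ({0..1} \<times> UNIV) (\<lambda>w. m (snd w))"
    by (rule smooth_on_compose[OF _ smX] smooth_on_compose[OF _ smm], auto intro: smooth_intros)+
  show ?thesis
    unfolding profile_family_def Let_def case_prod_unfold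
    by (intro smooth_intros c) (auto intro: Q_pos)
qed

text \<open>The radius determines r^2 and with it the positive factor k; the height then determines
  \<open>m\<close>, hence t. Infinitesimally, if r^2 is stationary then so is k, and the height has
  velocity 3 m' k, which is not 0. Positivity of r keeps the curve off its negative.\<close>

lemma profile_curve_family:
  assumes \<tau>: "0 \<le> \<tau>" "\<tau> \<le> 1"
  shows "profile_curve (profile_family X m \<tau>)"
  unfolding profile_curve_def
proof (intro conjI allI)
  let ?\<gamma> = "profile_family X m \<tau>"
  define k where "k q = ((1 - \<tau>) + \<tau> * f1' q) * sqrt q" for q
  have \<gamma>: "?\<gamma> t = (sqrt (Q \<tau> t), 3 * m t * k (Q \<tau> t))" for t
    by (simp add: profile_family_def Let_def k_def)
  have kpos: "k (Q \<tau> t) > 0" for t using scale_pos[OF \<tau>] Q_pos[OF \<tau>, of t] by (simp add: k_def)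
  have "smooth_on UNIV (\<lambda>t. (\<lambda>(\<tau>, t). profile_family X m \<tau> t) (\<tau>, t))"
    by (rule smooth_on_compose[OF smooth_on_Pair[OF smooth_on_const smooth_on_ident] smooth_profile_family])
      (use \<tau> in auto)
  then show sm: "smooth_on UNIV ?\<gamma>" by simp
  show "inj ?\<gamma>"
  proof (rule injI)
    fix s t assume "?\<gamma> s = ?\<gamma> t"
    then have "Q \<tau> s = Q \<tau> t" "3 * m s * k (Q \<tau> s) = 3 * m t * k (Q \<tau> t)" unfolding \<gamma> by auto
    then have "m s = m t" using kpos[of t] by simp
    then show "s = t" using inj_m by (simp add: inj_eq)
  qed
  show "vector_derivative ?\<gamma> (at t) \<noteq> 0" for t
  proof
    assume v0: "vector_derivative ?\<gamma> (at t) = 0"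
    have "?\<gamma> differentiable at t" using smooth_on_imp_differentiable[OF sm] by simp
    then have "(?\<gamma> has_vector_derivative 0) (at t)" using v0 vector_derivative_works by metis
    then have d0: "((\<lambda>t. fst (?\<gamma> t)) has_real_derivative 0) (at t)" "((\<lambda>t. snd (?\<gamma> t)) has_real_derivative 0) (at t)"
      using has_derivative_fst[of ?\<gamma> "\<lambda>h. h *\<^sub>R 0"] has_derivative_snd[of ?\<gamma> "\<lambda>h. h *\<^sub>R 0"]
      unfolding has_vector_derivative_def has_field_derivative_def by (simp_all add: lambda_zero)
    have sq: "((\<lambda>t. Q \<tau> t) has_real_derivative 0) (at t)"
    proof -
      have "((\<lambda>t. (fst (?\<gamma> t))\<^sup>2) has_real_derivative 0) (at t)"
        using DERIV_power[OF d0(1), of 2] by simp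
      then show ?thesis using Q_pos[OF \<tau>] by (simp add: \<gamma> less_imp_le)
    qed
    obtain m' where m': "m' < 0" "(m has_real_derivative m') (at t)" using dm by blast
    have "smooth_on {0<..} k" unfolding k_def by (intro smooth_intros) auto
    then have "k differentiable at (Q \<tau> t)"
      by (rule smooth_on_imp_differentiable) (use Q_pos[OF \<tau>, of t] in auto)
    then obtain k' where k': "(k has_real_derivative k') (at (Q \<tau> t))" using real_differentiable_def by blast
    have dk: "((\<lambda>t. k (Q \<tau> t)) has_real_derivative k' * 0) (at t)" by (rule DERIV_chain2[OF k' sq])
    have "((\<lambda>t. 3 * m t * k (Q \<tau> t)) has_real_derivative (3 * m' * k (Q \<tau> t) + k' * 0 * (3 * m t))) (at t)"
      by (rule DERIV_mult[OF DERIV_cmult[OF m'(2)] dk])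
    then have "3 * m' * k (Q \<tau> t) = 0" using d0(2) DERIV_unique by (fastforce simp: \<gamma>)
    then show False using m' kpos[of t] by simp
  qed
  show "?\<gamma> s \<noteq> - ?\<gamma> t" for s t
  proof
    assume "?\<gamma> s = - ?\<gamma> t"
    then have "sqrt (Q \<tau> s) = - sqrt (Q \<tau> t)" by (simp add: \<gamma>)
    moreover have "sqrt (Q \<tau> s) > 0" "sqrt (Q \<tau> t) > 0" using Q_pos[OF \<tau>] by auto
    ultimately show False by linarith
  qed
  show "\<exists>T. \<forall>t. norm (?\<gamma> t) \<le> B \<longrightarrow> \<bar>t\<bar> \<le> T" for B
  proof (intro exI allI impI)
    fix t assume B: "norm (?\<gamma> t) \<le> B"
    \<comment> \<open>Beyond r^2 = 1 + 2\<epsilon> the first coordinate is \<open>X\<close> at all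
      times, and elsewhere X^2 is below 4.\<close>
    have "X t \<le> max B 2"
    proof (cases "(X t)\<^sup>2 > 1 + 2 * \<epsilon>")
      case True
      then have "Q \<tau> t = (X t)\<^sup>2" using m_far[OF True] by (simp add: algebra_simps)
      then have "X t = fst (?\<gamma> t)" using Xpos[of t] by (simp add: \<gamma>)
      also have "\<dots> \<le> norm (?\<gamma> t)" using norm_fst_le[of "fst (?\<gamma> t)" "snd (?\<gamma> t)"] by simp
      finally show ?thesis using B by simp
    next
      case False
      then have "(X t)\<^sup>2 \<le> 2\<^sup>2" using eps by simp
      then have "X t \<le> 2" by (rule power2_le_imp_le) simp
      then show ?thesis by simp
    qed
    then show "\<bar>t\<bar> \<le> \<kappa> + (max B 2 + 6 * sqrt (\<epsilon> + (max B 2)\<^sup>2) * max B 2)" by (rule X_proper)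
  qed
qed

lemma Lambda_eq_handle: "(Lambda \<sigma> \<rho> :: 'n::finite phase set) = handle (profile_family X m 0)"
proof -
  have fam: "profile_family X m 0 t = (sqrt (1 + (m t)\<^sup>2), 3 * m t * sqrt (1 + (m t)\<^sup>2))" for t
    by (simp add: profile_family_def Let_def)
  show ?thesis
  proof (intro equalityI subsetI)
    fix z :: "'n phase" assume "z \<in> Lambda \<sigma> \<rho>"
    then obtain x y where z: "z = (x, y)" "(x, y) \<in> Lambda \<sigma> \<rho>" by (cases z) auto
    define s where "s = sqrt ((norm x)\<^sup>2 - 1)"
    have n: "norm x \<ge> 1" and y: "y = (3 * s) *\<^sub>R x \<or> y = (- 3 * s) *\<^sub>R x"
      using z(2) unfolding Lambda_iff s_def by auto
    have "\<exists>v. (v = s \<or> v = -s) \<and> y = (3 * v) *\<^sub>R x"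
      using y by (auto intro: exI[of _ s] exI[of _ "-s"])
    then obtain v where v: "v = s \<or> v = -s" "y = (3 * v) *\<^sub>R x" by blast
    have "(norm x)\<^sup>2 \<ge> 1" using n by (simp add: one_le_power)
    then have "s\<^sup>2 = (norm x)\<^sup>2 - 1" by (simp add: s_def)
    then have "1 + v\<^sup>2 = (norm x)\<^sup>2" using v(1) by auto
    then have vn: "sqrt (1 + v\<^sup>2) = norm x" by simp
    obtain t where t: "m t = v" using m_surj by blast
    have "z = (fst (profile_family X m 0 t) *\<^sub>R (x /\<^sub>R norm x), snd (profile_family X m 0 t) *\<^sub>R (x /\<^sub>R norm x))"
    proof -
      have "norm x \<noteq> 0" using n by linarith
      then show ?thesis by (simp add: z(1) fam t vn v(2))
    qed
    moreover have "norm x \<noteq> 0" using n by linarith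
    then have "x /\<^sub>R norm x \<in> sphere 0 1" by simp
    ultimately show "z \<in> handle (profile_family X m 0)" unfolding handle_def by blast
  next
    fix z :: "'n phase" assume "z \<in> handle (profile_family X m 0)"
    then obtain t x where tx: "norm x = 1"
      "z = (sqrt (1 + (m t)\<^sup>2) *\<^sub>R x, (3 * m t * sqrt (1 + (m t)\<^sup>2)) *\<^sub>R x)"
      by (auto simp: handle_def fam)
    have n: "(norm (sqrt (1 + (m t)\<^sup>2) *\<^sub>R x))\<^sup>2 - 1 = (m t)\<^sup>2" "norm (sqrt (1 + (m t)\<^sup>2) *\<^sub>R x) \<ge> 1"
      using tx(1) by auto
    show "z \<in> Lambda \<sigma> \<rho>"
      unfolding tx(2) Lambda_iff n(1) using n(2) by (cases "m t \<ge> 0") (auto simp: abs_if)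
  qed
qed

text \<open>Each point keeps its parameters while the profile curve moves underneath.\<close>

lemma isotopy:
  assumes W: "closure (model_box \<epsilon>) \<subseteq> W\<^sub>0"
  shows "local_lagrangian_isotopy W\<^sub>0 (Lambda \<sigma> \<rho>) (handle (profile_family X m 1) :: 'n::finite phase set)"
  unfolding local_lagrangian_isotopy_def
proof (intro exI conjI)
  let ?\<gamma> = "profile_family X m" and ?K = "model_core \<epsilon> :: 'n phase set"
  define j where "j t z = spin (?\<gamma> t) (spin_inv (?\<gamma> 0) z)" for t and z :: "'n phase"
  have good: "profile_curve (?\<gamma> t)" if "t \<in> {0..1}" for t using that profile_curve_family by simp
  have g0: "profile_curve (?\<gamma> 0)" by (rule good) simp
  have j_spin: "j t (spin (?\<gamma> 0) (s, x)) = spin (?\<gamma> t) (s, x)" if "norm x = 1" for t s x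
    unfolding j_def using spin_inv_spin[OF g0 that] by simp
  have img: "j t ` Lambda \<sigma> \<rho> = handle (?\<gamma> t)" for t
    unfolding Lambda_eq_handle handle_eq_spin image_image by (rule image_cong) (auto simp: j_spin)
  have dif: "diffeomorphism euclid euclid (Lambda \<sigma> \<rho>) (handle (?\<gamma> t)) (j t)" if "t \<in> {0..1}" for t
    using diffeomorphism_handles[OF g0 good[OF that], where 'n='n] unfolding Lambda_eq_handle j_def[abs_def] .
  show "compact ?K" by (rule compact_model_core)
  show "?K \<subseteq> W\<^sub>0" using model_core_subset[OF eps] W by blast
  show "smooth_on ({0..1} \<times> Lambda \<sigma> \<rho>) (\<lambda>(t, z). j t z)"
  proof -
    let ?S = "{0..1::real} \<times> (Lambda \<sigma> \<rho> :: 'n phase set)"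
    have i: "smooth_on ?S (\<lambda>w. spin_inv (?\<gamma> 0) (snd w))"
      by (rule smooth_on_compose[OF _ smooth_on_spin_inv[OF g0]]) (auto simp: Lambda_eq_handle intro: smooth_intros)
    have "smooth_on ?S (\<lambda>w. (\<lambda>(\<tau>, t). ?\<gamma> \<tau> t) (fst w, fst (spin_inv (?\<gamma> 0) (snd w))))"
      by (rule smooth_on_compose[OF _ smooth_profile_family]) (auto intro!: smooth_intros i)
    then have "smooth_on ?S (\<lambda>w. ?\<gamma> (fst w) (fst (spin_inv (?\<gamma> 0) (snd w))))" by simp
    then show ?thesis
      unfolding j_def spin_def case_prod_unfold by (intro smooth_intros i)
  qed
  \<comment> \<open>Points with m^2 > 2\<epsilon> lie outside the core and never move, those with
    m^2 \<le> 2\<epsilon> stay inside it at all times.\<close>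
  have key: "if s \<in> ?K then j t s \<in> ?K else j t s = s" if t: "t \<in> {0..1}" and "s \<in> Lambda \<sigma> \<rho>" for t s
  proof -
    obtain u x where s: "s = spin (?\<gamma> 0) (u, x)" "norm x = 1"
      using \<open>s \<in> Lambda \<sigma> \<rho>\<close> unfolding Lambda_eq_handle handle_eq_spin by auto
    have js: "j t s = (sqrt (Q t u) *\<^sub>R x, (3 * m u * ((1 - t) + t * f1' (Q t u)) * sqrt (Q t u)) *\<^sub>R x)"
      unfolding s(1) j_spin[OF s(2)] by (simp add: spin_def profile_family_def Let_def)
    have s': "s = (sqrt (1 + (m u)\<^sup>2) *\<^sub>R x, (3 * m u * sqrt (1 + (m u)\<^sup>2)) *\<^sub>R x)"
      unfolding s(1) by (simp add: spin_def profile_family_def Let_def)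
    show ?thesis
    proof (cases "(m u)\<^sup>2 > 2 * \<epsilon>")
      case True
      then have "s \<notin> ?K" unfolding s' model_core_iff[OF eps(1)] using s(2) by simp
      moreover have "(X u)\<^sup>2 = 1 + (m u)\<^sup>2" using True m_far_iff m_far by blast
      then have Q: "Q t u = 1 + (m u)\<^sup>2" by (simp add: algebra_simps)
      have "f1' (Q t u) = 1" unfolding Q using True by (intro f1'_far) simp
      then have "j t s = s" by (subst js, subst s') (simp add: Q)
      ultimately show ?thesis by simp
    next
      case False
      then have m2: "(m u)\<^sup>2 \<le> 2 * \<epsilon>" and X2: "(X u)\<^sup>2 \<le> 1 + 2 * \<epsilon>" using m_far_iff[of u] by auto
      have Qp: "Q t u > 0" using Q_pos t by simp
      have "Q t u \<le> (1 - t) * (1 + 2 * \<epsilon>) + t * (1 + 2 * \<epsilon>)"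
        using t m2 X2 by (intro add_mono mult_left_mono) auto
      then have Qle: "Q t u \<le> 1 + 2 * \<epsilon>" by (simp add: algebra_simps)
      let ?k = "(1 - t) + t * f1' (Q t u)"
      have k0: "?k > 0" using scale_pos t by simp
      have "?k \<le> (1 - t) + t * 1" using t f1'_le by (intro add_left_mono mult_left_mono) auto
      then have "?k\<^sup>2 \<le> 1" using k0 by (simp add: power_le_one)
      then have "(m u)\<^sup>2 * (?k\<^sup>2 * Q t u) \<le> (2 * \<epsilon>) * (1 * (1 + 2 * \<epsilon>))"
        using m2 Qle Qp eps by (intro mult_mono) auto
      then have "9 * ((m u)\<^sup>2 * (?k\<^sup>2 * Q t u)) \<le> 9 * ((2 * \<epsilon>) * (1 * (1 + 2 * \<epsilon>)))" by (rule mult_left_mono) simp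
      moreover have "(norm ((3 * m u * k * sqrt q) *\<^sub>R x))\<^sup>2 = 9 * ((m u)\<^sup>2 * (k\<^sup>2 * q))" if "q > 0" for k q
        using s(2) that by (simp add: power_mult_distrib)
      ultimately have "(norm ((3 * m u * ?k * sqrt (Q t u)) *\<^sub>R x))\<^sup>2 \<le> 18 * \<epsilon> * (1 + 2 * \<epsilon>)"
        using Qp by simp
      moreover have "(norm (sqrt (Q t u) *\<^sub>R x))\<^sup>2 \<le> 1 + 2 * \<epsilon>" using s(2) Qp Qle by simp
      ultimately have "j t s \<in> ?K" unfolding js model_core_iff[OF eps(1)] by blast
      moreover have "s \<in> ?K"
      proof -
        have "(m u)\<^sup>2 * (1 + (m u)\<^sup>2) \<le> (2 * \<epsilon>) * (1 + 2 * \<epsilon>)" using m2 eps by (intro mult_mono) auto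
        then show ?thesis unfolding s' model_core_iff[OF eps(1)] using s(2) m2 by (simp add: power_mult_distrib)
      qed
      ultimately show ?thesis by simp
    qed
  qed
  show "\<forall>t\<in>{0..1}. diffeomorphism euclid euclid (Lambda \<sigma> \<rho>) (j t ` Lambda \<sigma> \<rho>) (j t) \<and>
      lagrangian cotangent (j t ` Lambda \<sigma> \<rho>) \<and>
      (\<forall>z\<in>Lambda \<sigma> \<rho> - ?K. j t z = z) \<and> j t ` (Lambda \<sigma> \<rho> \<inter> ?K) \<subseteq> ?K"
  proof (intro ballI conjI)
    fix t :: real assume t: "t \<in> {0..1}"
    show "diffeomorphism euclid euclid (Lambda \<sigma> \<rho>) (j t ` Lambda \<sigma> \<rho>) (j t)" unfolding img by (rule dif[OF t])
    show "lagrangian cotangent (j t ` Lambda \<sigma> \<rho>)" unfolding img by (rule lagrangian_handle[OF good[OF t]])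
    show "j t z = z" if "z \<in> Lambda \<sigma> \<rho> - ?K" for z using key[OF t, of z] that by auto
    show "j t ` (Lambda \<sigma> \<rho> \<inter> ?K) \<subseteq> ?K" using key[OF t] by (auto split: if_splits)
  qed
  show "\<forall>z\<in>Lambda \<sigma> \<rho>. j 0 z = z"
    unfolding Lambda_eq_handle handle_eq_spin by (auto simp: j_spin)
  show "j 1 ` Lambda \<sigma> \<rho> = handle (profile_family X m 1)" by (rule img)
qed

end

section \<open>Resolutions of the model double point\<close>

context antisurgery_model
begin

lemma Lambda'_iff:
  "(x, y) \<in> Lambda' \<sigma> \<rho> \<longleftrightarrow> (\<exists>s\<in>{1, -1}. y = (s * 3 * sqrt (f1 ((norm x)\<^sup>2)) * f1' ((norm x)\<^sup>2)) *\<^sub>R x)"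
  by (auto simp: Lambda'_def Lambda'_sheet_iff)

text \<open>The implanted handle and the untouched part of \<Lambda>' together form one rotated
  curve, the member \<tau> = 1 of the family; this makes the resolution Lagrangian and isotopic to
  \<Lambda> at once. The radius d is free: it serves to stay inside the domain of implantation and
  to come arbitrarily close to the double point.\<close>

lemma local_resolution:
  assumes "d > 0"
  obtains U R :: "'n::finite phase set" and \<kappa> \<gamma> and \<theta> :: "'n phase \<Rightarrow> 'n phase"
  where "open U" "0 \<in> U" "handle_curve \<kappa> \<gamma>" "cball 0 \<kappa> \<subseteq> U"
    "symplectomorphism cotangent cotangent U (\<theta> ` U) \<theta>" "\<theta> 0 = 0" "\<theta> ` U \<subseteq> ball 0 d"
    "\<theta> ` (U \<inter> UNIV \<times> {0}) = Lambda'_sheet \<sigma> \<rho> 1 \<inter> \<theta> ` U"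
    "\<theta> ` (U \<inter> {0} \<times> UNIV) = Lambda'_sheet \<sigma> \<rho> (-1) \<inter> \<theta> ` U"
    "R = (Lambda' \<sigma> \<rho> - \<theta> ` U) \<union> \<theta> ` (U \<inter> handle \<gamma>)" "lagrangian cotangent R"
    "\<And>W\<^sub>0. closure (model_box \<epsilon>) \<subseteq> W\<^sub>0 \<Longrightarrow> local_lagrangian_isotopy W\<^sub>0 (Lambda \<sigma> \<rho>) R"
proof -
  obtain u\<^sub>0 where u: "u\<^sub>0 > 0" "\<And>q. q < u\<^sub>0 \<Longrightarrow> f1 q = q + \<epsilon>" "\<And>q. q < u\<^sub>0 \<Longrightarrow> f1' q = 1"
    using near_zero by metis
  \<comment> \<open>The bound sqrt \<open>u\<^sub>0\<close> keeps the chart over |x|^2 <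
    \<open>u\<^sub>0\<close>, where the images of the axes are the sheets.\<close>
  define e where "e = min d (sqrt u\<^sub>0)"
  have e: "e > 0" "e \<le> d" "e \<le> sqrt u\<^sub>0" using assms u(1) by (auto simp: e_def)
  let ?\<theta> = "cross_chart \<epsilon> :: 'n phase \<Rightarrow> 'n phase"
  have sy: "symplectomorphism cotangent cotangent UNIV UNIV ?\<theta>" by (rule cross_chart_symplectomorphism[OF eps(1)])
  have inj: "inj ?\<theta>" using symplectomorphism_bij[OF sy] by (simp add: bij_betw_def)
  have \<theta>0: "?\<theta> 0 = 0" by (simp add: cross_chart_def zero_prod_def Let_def)
  have "smooth_on UNIV ?\<theta>" using sy by (simp add: symplectomorphism_def diffeomorphism_def atlas_of_cotangent smooth_map_euclid)
  then have "open (?\<theta> -` ball 0 e)" using smooth_on_imp_continuous_on by (metis open_vimage open_ball)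
  then obtain \<omega> where \<omega>: "\<omega> > 0" "ball 0 \<omega> \<subseteq> ?\<theta> -` ball 0 e"
    using \<theta>0 e(1) open_contains_ball[of "?\<theta> -` ball 0 e"] by (metis centre_in_ball vimageI)
  define U :: "'n phase set" where "U = ball 0 \<omega>"
  have U: "open U" "0 \<in> U" using \<omega> by (auto simp: U_def)
  have Ue: "?\<theta> ` U \<subseteq> ball 0 e" using \<omega>(2) by (auto simp: U_def)
  have small: "(norm (fst z))\<^sup>2 < u\<^sub>0" if "z \<in> ?\<theta> ` U" for z
  proof -
    have "norm (fst z) \<le> norm z" using norm_fst_le[of "fst z" "snd z"] by simp
    moreover have "norm z < e" using that Ue by auto
    ultimately have "norm (fst z) < sqrt u\<^sub>0" using e(3) by linarith
    then have "(norm (fst z))\<^sup>2 < (sqrt u\<^sub>0)\<^sup>2" by (intro power_strict_mono) auto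
    then show ?thesis using u(1) by simp
  qed
  obtain \<kappa> \<gamma> X m where P: "0 < \<kappa>" "\<kappa> < \<omega>" "handle_curve \<kappa> \<gamma>"
    "smooth_on UNIV X" "smooth_on UNIV m" "\<And>t. X t > 0"
    "\<And>t. \<exists>m'<0. (m has_real_derivative m') (at t)"
    "\<And>t. X t = - fst (\<gamma> t) + chart_beta \<epsilon> (snd (\<gamma> t))"
    "\<And>t. (X t)\<^sup>2 < u\<^sub>0 \<Longrightarrow> 3 * m t * X t = 3 * sqrt (\<epsilon> + (X t)\<^sup>2) * X t - snd (\<gamma> t)"
    "\<And>t. t \<ge> \<kappa> \<Longrightarrow> m t = - sqrt (f1 ((X t)\<^sup>2)) \<and> t = 6 * sqrt (\<epsilon> + (X t)\<^sup>2) * X t"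
    "\<And>t. t \<le> -\<kappa> \<Longrightarrow> m t = sqrt (f1 ((X t)\<^sup>2)) \<and> X t = - t"
    "\<And>t. \<bar>t\<bar> \<le> \<kappa> \<Longrightarrow> (X t)\<^sup>2 < u\<^sub>0 \<and> X t < 1"
    "\<And>t. (m t)\<^sup>2 \<le> f1 ((X t)\<^sup>2)"
    using profile_data[OF u(1,2) \<omega>(1)] by blast
  interpret profile_setup \<epsilon> \<delta> \<sigma> \<rho> \<kappa> X m
    by unfold_locales (use P in auto)
  define R :: "'n phase set" where "R = handle (profile_family X m 1)"
  have fam: "spin (profile_family X m 1) (t, w) = (X t *\<^sub>R w, (3 * m t * f1' ((X t)\<^sup>2) * X t) *\<^sub>R w)"
    for t and w :: "(real, 'n) vec"
    using P(6)[of t] by (simp add: spin_def profile_family_def Let_def)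
  have fst_chart: "norm (fst (?\<theta> (spin \<gamma> (t, w)))) = X t" if "norm w = 1" for t w
    using that P(6)[of t] P(8)[of t] unfolding spin_def case_prod_conv cross_chart_ray[OF that] by simp
  \<comment> \<open>On the handle the chart has first coordinate -X along its unit vector, so the
    radius X belongs to the opposite vector: the two parametrizations differ by the antipodal
    map.\<close>
  have link: "spin (profile_family X m 1) (t, w) = ?\<theta> (spin \<gamma> (t, - w))" if n: "norm w = 1" and s: "(X t)\<^sup>2 < u\<^sub>0" for t w
  proof -
    have n': "norm (- w) = 1" using n by simp
    have a: "fst (\<gamma> t) - chart_beta \<epsilon> (snd (\<gamma> t)) = - X t" using P(8)[of t] by simp
    have "?\<theta> (spin \<gamma> (t, - w)) = ((- X t) *\<^sub>R (- w), (snd (\<gamma> t) + 3 * sqrt (\<epsilon> + (- X t)\<^sup>2) * (- X t)) *\<^sub>R (- w))"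
      unfolding spin_def case_prod_conv cross_chart_ray[OF n'] a ..
    also have "\<dots> = (X t *\<^sub>R w, (3 * m t * X t) *\<^sub>R w)"
      unfolding P(9)[OF s] by (simp add: scaleR_left_diff_distrib algebra_simps)
    finally show ?thesis unfolding fam u(3)[OF s] by simp
  qed
  have core\<gamma>: "norm (\<gamma> t) \<le> \<kappa>" if "\<bar>t\<bar> \<le> \<kappa>" for t using P(3) that by (simp add: handle_curve_def)
  have in_plus: "(x, y) \<in> Lambda'_sheet \<sigma> \<rho> 1 \<longleftrightarrow> (x, y) = ?\<theta> (x, 0)"
    and in_minus: "(x, y) \<in> Lambda'_sheet \<sigma> \<rho> (-1) \<longleftrightarrow> (x, y) = ?\<theta> (0, - (6 * sqrt (\<epsilon> + (norm x)\<^sup>2)) *\<^sub>R x)"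
    if s: "(norm x)\<^sup>2 < u\<^sub>0" for x y :: "(real, 'n) vec"
    unfolding cross_chart_first_axis cross_chart_second_axis[OF eps(1)] Lambda'_sheet_iff u(2)[OF s] u(3)[OF s]
    by (auto simp: add.commute)
  have plus: "?\<theta> ` (U \<inter> UNIV \<times> {0}) = Lambda'_sheet \<sigma> \<rho> 1 \<inter> ?\<theta> ` U"
  proof (intro equalityI subsetI)
    fix z assume "z \<in> ?\<theta> ` (U \<inter> UNIV \<times> {0})"
    then obtain x where x: "z = ?\<theta> (x, 0)" "(x, 0) \<in> U" by blast
    have z: "z \<in> ?\<theta> ` U" using x by blast
    have "fst z = x" using x(1) cross_chart_first_axis[of \<epsilon> x] by simp
    then have "z = ?\<theta> (fst z, 0)" using x(1) by simp
    then have "(fst z, snd z) \<in> Lambda'_sheet \<sigma> \<rho> 1" using in_plus[OF small[OF z], of "snd z"] by simp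
    then show "z \<in> Lambda'_sheet \<sigma> \<rho> 1 \<inter> ?\<theta> ` U" using z by simp
  next
    fix z assume z: "z \<in> Lambda'_sheet \<sigma> \<rho> 1 \<inter> ?\<theta> ` U"
    then have "z = ?\<theta> (fst z, 0)" using in_plus[OF small[of z], of "snd z"] by simp
    moreover from this have "(fst z, 0) \<in> U" using z inj by (metis IntD2 inj_image_mem_iff)
    ultimately show "z \<in> ?\<theta> ` (U \<inter> UNIV \<times> {0})" by blast
  qed
  have minus: "?\<theta> ` (U \<inter> {0} \<times> UNIV) = Lambda'_sheet \<sigma> \<rho> (-1) \<inter> ?\<theta> ` U"
  proof (intro equalityI subsetI)
    fix z assume "z \<in> ?\<theta> ` (U \<inter> {0} \<times> UNIV)"
    then obtain y where y: "z = ?\<theta> (0, y)" "(0, y) \<in> U" by blast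
    obtain x where x: "y = - (6 * sqrt (\<epsilon> + (norm x)\<^sup>2)) *\<^sub>R x" using second_axis_cover[OF eps(1)] by blast
    have z: "z \<in> ?\<theta> ` U" using y by blast
    have "fst z = x" using y(1) cross_chart_second_axis[OF eps(1), of x] x by simp
    then have "z = ?\<theta> (0, - (6 * sqrt (\<epsilon> + (norm (fst z))\<^sup>2)) *\<^sub>R fst z)" using y(1) x by simp
    then have "(fst z, snd z) \<in> Lambda'_sheet \<sigma> \<rho> (-1)" using in_minus[OF small[OF z], of "snd z"] by simp
    then show "z \<in> Lambda'_sheet \<sigma> \<rho> (-1) \<inter> ?\<theta> ` U" using z by simp
  next
    fix z assume z: "z \<in> Lambda'_sheet \<sigma> \<rho> (-1) \<inter> ?\<theta> ` U"
    let ?y = "- (6 * sqrt (\<epsilon> + (norm (fst z))\<^sup>2)) *\<^sub>R fst z"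
    have "z = ?\<theta> (0, ?y)" using z in_minus[OF small[of z], of "snd z"] by simp
    moreover from this have "(0, ?y) \<in> U" using z inj by (metis IntD2 inj_image_mem_iff)
    ultimately show "z \<in> ?\<theta> ` (U \<inter> {0} \<times> UNIV)" by blast
  qed
  have in_U: "w \<in> U" if "norm w \<le> \<kappa>" for w :: "'n phase" using that P(2) by (simp add: U_def)
  have R1: "R \<inter> ?\<theta> ` U = ?\<theta> ` (U \<inter> handle \<gamma>)"
  proof (intro equalityI subsetI)
    fix z assume z: "z \<in> R \<inter> ?\<theta> ` U"
    then have "z \<in> R" by blast
    then obtain t w where tw: "z = spin (profile_family X m 1) (t, w)" "norm w = 1" unfolding R_def handle_eq_spin by auto
    have "norm (fst z) = X t" using tw(2) P(6)[of t] unfolding tw(1) fam by simp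
    then have "(X t)\<^sup>2 < u\<^sub>0" using small[of z] z by simp
    then have "z = ?\<theta> (spin \<gamma> (t, - w))" using link tw by blast
    moreover from this have "spin \<gamma> (t, - w) \<in> U" using z inj by (metis IntD2 inj_image_mem_iff)
    moreover have "spin \<gamma> (t, - w) \<in> handle \<gamma>" unfolding handle_eq_spin using tw(2) by (intro imageI) simp
    ultimately show "z \<in> ?\<theta> ` (U \<inter> handle \<gamma>)" by blast
  next
    fix z assume "z \<in> ?\<theta> ` (U \<inter> handle \<gamma>)"
    then obtain t w where tw: "z = ?\<theta> (spin \<gamma> (t, w))" "norm w = 1" "spin \<gamma> (t, w) \<in> U" unfolding handle_eq_spin by auto
    then have z: "z \<in> ?\<theta> ` U" by blast
    have "(X t)\<^sup>2 < u\<^sub>0" using small[OF z] fst_chart[OF tw(2), of t] tw(1) by simp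
    then have "z = spin (profile_family X m 1) (t, - w)" using link[of "- w" t] tw by simp
    then have "z \<in> R" unfolding R_def handle_eq_spin using tw(2) by (auto intro!: imageI)
    then show "z \<in> R \<inter> ?\<theta> ` U" using z by blast
  qed
  have R2: "R - ?\<theta> ` U = Lambda' \<sigma> \<rho> - ?\<theta> ` U"
  proof (intro equalityI subsetI)
    fix z assume z: "z \<in> R - ?\<theta> ` U"
    then have "z \<in> R" by blast
    then obtain t w where tw: "z = spin (profile_family X m 1) (t, w)" "norm w = 1" unfolding R_def handle_eq_spin by auto
    have "\<not> \<bar>t\<bar> \<le> \<kappa>"
    proof
      assume t: "\<bar>t\<bar> \<le> \<kappa>"
      then have "z = ?\<theta> (spin \<gamma> (t, - w))" using link[OF tw(2)] P(12) tw(1) by blast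
      moreover have "spin \<gamma> (t, - w) \<in> U" using in_U norm_spin[of "- w" \<gamma> t] tw(2) core\<gamma>[OF t] by simp
      ultimately show False using z by blast
    qed
    then have "m t = - sqrt (f1 ((X t)\<^sup>2)) \<or> m t = sqrt (f1 ((X t)\<^sup>2))"
      using P(10)[of t] P(11)[of t] by (cases "t \<ge> \<kappa>") auto
    moreover have "(norm (X t *\<^sub>R w))\<^sup>2 = (X t)\<^sup>2" using tw(2) by simp
    ultimately show "z \<in> Lambda' \<sigma> \<rho> - ?\<theta> ` U"
      using z unfolding tw(1) fam by (auto simp: Lambda'_iff mult_ac)
  next
    fix z assume z: "z \<in> Lambda' \<sigma> \<rho> - ?\<theta> ` U"
    obtain x y where xy: "z = (x, y)" by (cases z)
    have "x \<noteq> 0"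
    proof
      assume "x = 0"
      then have "z = ?\<theta> 0" using z unfolding xy \<theta>0 by (auto simp: Lambda'_iff zero_prod_def)
      then show False using z U(2) by blast
    qed
    define r w where "r = norm x" and "w = x /\<^sub>R norm x"
    have w: "norm w = 1" "x = r *\<^sub>R w" and r: "r > 0" using \<open>x \<noteq> 0\<close> by (auto simp: r_def w_def)
    \<comment> \<open>On the positive sheet t = -r, on the negative one t = 6 sqrt(\<epsilon> + r^2)
      r. If |t| < \<kappa>, the point would be the chart image of an axis point of norm below
      \<kappa>, hence in the part cut out.\<close>
    have "\<exists>t. X t = r \<and> y = (3 * m t * f1' (r\<^sup>2)) *\<^sub>R x"
    proof (cases "z \<in> Lambda'_sheet \<sigma> \<rho> 1")
      case True
      have "r \<ge> \<kappa>"
      proof (rule ccontr)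
        assume r\<kappa>: "\<not> r \<ge> \<kappa>"
        have "X (-\<kappa>) = \<kappa>" "(X (-\<kappa>))\<^sup>2 < u\<^sub>0" using P(11)[of "-\<kappa>"] P(12)[of "-\<kappa>"] P(1) by auto
        moreover have "r\<^sup>2 \<le> \<kappa>\<^sup>2" using r r\<kappa> by (intro power_mono) auto
        ultimately have "(norm x)\<^sup>2 < u\<^sub>0" by (simp add: r_def)
        then have "z = ?\<theta> (x, 0)" using True in_plus unfolding xy by blast
        moreover have "(x, 0) \<in> U" using r\<kappa> by (intro in_U) (simp add: r_def)
        ultimately show False using z by blast
      qed
      then have "X (-r) = r" "m (-r) = sqrt (f1 (r\<^sup>2))" using P(11)[of "-r"] by auto
      moreover have "y = (3 * sqrt (f1 (r\<^sup>2)) * f1' (r\<^sup>2)) *\<^sub>R x" using True by (simp add: xy Lambda'_sheet_iff r_def)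
      ultimately show ?thesis by (intro exI[of _ "-r"]) simp
    next
      case False
      then have neg: "z \<in> Lambda'_sheet \<sigma> \<rho> (-1)" using z by (simp add: Lambda'_def)
      let ?t = "6 * sqrt (\<epsilon> + r\<^sup>2) * r"
      have t: "?t \<ge> \<kappa>"
      proof (rule ccontr)
        assume t\<kappa>: "\<not> ?t \<ge> \<kappa>"
        have "\<kappa> = 6 * sqrt (\<epsilon> + (X \<kappa>)\<^sup>2) * X \<kappa>" "(X \<kappa>)\<^sup>2 < u\<^sub>0" using P(10)[of \<kappa>] P(12)[of \<kappa>] P(1) by auto
        moreover have "6 * sqrt (\<epsilon> + (X \<kappa>)\<^sup>2) * X \<kappa> \<le> ?t" if "X \<kappa> \<le> r"
          using that P(6)[of \<kappa>] eps by (intro mult_mono) (auto intro: power_mono)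
        ultimately have "r < X \<kappa>" using t\<kappa> by linarith
        then have "r\<^sup>2 \<le> (X \<kappa>)\<^sup>2" using r by (intro power_mono) auto
        then have s: "(norm x)\<^sup>2 < u\<^sub>0" using \<open>(X \<kappa>)\<^sup>2 < u\<^sub>0\<close> by (simp add: r_def)
        then have "z = ?\<theta> (0, - (6 * sqrt (\<epsilon> + (norm x)\<^sup>2)) *\<^sub>R x)" using neg in_minus unfolding xy by blast
        moreover have "norm (- (6 * sqrt (\<epsilon> + (norm x)\<^sup>2)) *\<^sub>R x) = ?t" using eps by (simp add: r_def)
        then have "(0, - (6 * sqrt (\<epsilon> + (norm x)\<^sup>2)) *\<^sub>R x) \<in> U" using t\<kappa> by (intro in_U) simp
        ultimately show False using z by blast
      qed
      have "X ?t = r" by (rule X_of[OF r t])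
      moreover from this have "m ?t = - sqrt (f1 (r\<^sup>2))" using P(10)[OF t] by simp
      moreover have "y = (- 3 * sqrt (f1 (r\<^sup>2)) * f1' (r\<^sup>2)) *\<^sub>R x" using neg by (simp add: xy Lambda'_sheet_iff r_def)
      ultimately show ?thesis by (intro exI[of _ ?t]) simp
    qed
    then obtain t where t: "X t = r" "y = (3 * m t * f1' (r\<^sup>2)) *\<^sub>R x" by blast
    then have "z = spin (profile_family X m 1) (t, w)" unfolding fam xy using w(2) by simp
    then have "z \<in> R" unfolding R_def handle_eq_spin using w(1) by (auto intro!: imageI)
    then show "z \<in> R - ?\<theta> ` U" using z by blast
  qed
  have Req: "R = (Lambda' \<sigma> \<rho> - ?\<theta> ` U) \<union> ?\<theta> ` (U \<inter> handle \<gamma>)" using R1 R2 by blast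
  have sU: "symplectomorphism cotangent cotangent U (?\<theta> ` U) ?\<theta>"
    by (rule symplectomorphism_subset[OF _ sy U(1)]) (auto simp: atlas_of_cotangent smooth_atlas_euclid)
  show ?thesis
  proof (rule that[OF U P(3) _ sU \<theta>0 _ plus minus Req])
    show "cball 0 \<kappa> \<subseteq> U" using in_U by auto
    show "?\<theta> ` U \<subseteq> ball 0 d" using Ue e(2) by auto
    show "lagrangian cotangent R" unfolding R_def by (rule lagrangian_handle[OF profile_curve_family]) auto
    show "local_lagrangian_isotopy W\<^sub>0 (Lambda \<sigma> \<rho>) R" if "closure (model_box \<epsilon>) \<subseteq> W\<^sub>0" for W\<^sub>0
      unfolding R_def by (rule isotopy[OF that])
  qed
qed

section \<open>Comparison of the ends and embeddedness of arbitrary resolutions\<close>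

lemma Lambda'_near_core:
  fixes z :: "'n::finite phase"
  assumes "z \<in> Lambda' \<sigma> \<rho>" "(norm (fst z))\<^sup>2 \<le> 1 + 2 * \<epsilon>"
  shows "z \<in> model_core \<epsilon>"
proof -
  obtain x y where z: "z = (x, y)" by (cases z)
  let ?q = "(norm x)\<^sup>2"
  have q: "?q \<le> 1 + 2 * \<epsilon>" using assms(2) by (simp add: z)
  have "\<not> f1 (1 + 2 * \<epsilon>) < f1 ?q" using q f1_less_iff by (simp add: not_less)
  then have f: "f1 ?q \<le> 2 * \<epsilon>" "f1 ?q > 0" using f1_far[of "1 + 2 * \<epsilon>"] f1_pos by auto
  have "(f1' ?q)\<^sup>2 \<le> 1" using f1'_pos[of ?q] f1'_le[of ?q] by (simp add: power_le_one)
  then have "f1 ?q * ((f1' ?q)\<^sup>2 * ?q) \<le> (2 * \<epsilon>) * (1 * (1 + 2 * \<epsilon>))"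
    using f q eps by (intro mult_mono) auto
  moreover have "(norm y)\<^sup>2 = 9 * (f1 ?q * ((f1' ?q)\<^sup>2 * ?q))"
    using assms(1) f(2) unfolding z Lambda'_iff by (auto simp: power_mult_distrib)
  ultimately have "(norm y)\<^sup>2 \<le> 18 * \<epsilon> * (1 + 2 * \<epsilon>)" by linarith
  then show ?thesis using q unfolding z model_core_iff[OF eps(1)] by blast
qed

text \<open>Beyond r^2 = 1 + 2\<epsilon> one has f1 q = q - 1 and f1' q = 1, so both sets satisfy
  the same equation; over smaller radii both lie in the core.\<close>

lemma Lambda_Lambda'_off_core:
  "(Lambda \<sigma> \<rho> :: 'n::finite phase set) - model_core \<epsilon> = Lambda' \<sigma> \<rho> - model_core \<epsilon>"
proof -
  have far: "(x, y) \<in> Lambda \<sigma> \<rho> \<longleftrightarrow> (x, y) \<in> Lambda' \<sigma> \<rho>" if "(norm x)\<^sup>2 > 1 + 2 * \<epsilon>" for x y :: "(real, 'n) vec"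
  proof -
    have "1 \<le> norm x"
    proof (rule ccontr)
      assume "\<not> 1 \<le> norm x"
      then have "(norm x)\<^sup>2 \<le> 1" by (intro power_le_one) auto
      then show False using that eps by simp
    qed
    then show ?thesis
      using that by (simp add: Lambda_iff Lambda'_iff f1_far f1'_far)
  qed
  have near: "(x, y) \<in> model_core \<epsilon>" if "(x, y) \<in> Lambda \<sigma> \<rho>" and q: "(norm x)\<^sup>2 \<le> 1 + 2 * \<epsilon>" for x y :: "(real, 'n) vec"
  proof -
    have n: "norm x \<ge> 1" and y: "y = (3 * sqrt ((norm x)\<^sup>2 - 1)) *\<^sub>R x \<or> y = (- 3 * sqrt ((norm x)\<^sup>2 - 1)) *\<^sub>R x"
      using that(1) by (auto simp: Lambda_iff)
    have q1: "(norm x)\<^sup>2 - 1 \<ge> 0" using n by (simp add: one_le_power)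
    then have "(norm y)\<^sup>2 = 9 * (((norm x)\<^sup>2 - 1) * (norm x)\<^sup>2)" using y by (auto simp: power_mult_distrib)
    moreover have "((norm x)\<^sup>2 - 1) * (norm x)\<^sup>2 \<le> (2 * \<epsilon>) * (1 + 2 * \<epsilon>)"
      using q q1 eps by (intro mult_mono) auto
    ultimately have "(norm y)\<^sup>2 \<le> 18 * \<epsilon> * (1 + 2 * \<epsilon>)" by linarith
    then show ?thesis using q unfolding model_core_iff[OF eps(1)] by blast
  qed
  show ?thesis
  proof (intro equalityI subsetI)
    fix z :: "'n phase" assume z: "z \<in> Lambda \<sigma> \<rho> - model_core \<epsilon>"
    then have "(norm (fst z))\<^sup>2 > 1 + 2 * \<epsilon>" using near[of "fst z" "snd z"] by force
    then show "z \<in> Lambda' \<sigma> \<rho> - model_core \<epsilon>" using far[of "fst z" "snd z"] z by simp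
  next
    fix z :: "'n phase" assume z: "z \<in> Lambda' \<sigma> \<rho> - model_core \<epsilon>"
    then have "(norm (fst z))\<^sup>2 > 1 + 2 * \<epsilon>" using Lambda'_near_core[of z] by force
    then show "z \<in> Lambda \<sigma> \<rho> - model_core \<epsilon>" using far[of "fst z" "snd z"] z by simp
  qed
qed

text \<open>Away from the double point \<open>\<Lambda>'\<close> agrees with a sufficiently small resolution, which is embedded.\<close>

lemma Lambda'_regular:
  fixes z :: "'n::finite phase"
  assumes "z \<noteq> 0"
  obtains Q R where "open Q" "z \<in> Q" "embedded_submanifold euclid CARD('n) R" "Lambda' \<sigma> \<rho> \<inter> Q = R \<inter> Q"
proof -
  have d: "norm z / 2 > 0" using assms by simp
  obtain U R :: "'n phase set" and \<kappa> \<gamma> and \<theta> :: "'n phase \<Rightarrow> 'n phase" where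
    "\<theta> ` U \<subseteq> ball 0 (norm z / 2)" "R = (Lambda' \<sigma> \<rho> - \<theta> ` U) \<union> \<theta> ` (U \<inter> handle \<gamma>)" "lagrangian cotangent R"
    by (rule local_resolution[OF d, where 'n='n]) blast
  then show ?thesis
    using assms by (intro that[of "- cball 0 (norm z / 2)" R])
      (auto simp: lagrangian_def atlas_of_cotangent intro!: open_Compl)
qed

lemma handle_off_ball:
  fixes v :: "'n::finite phase"
  assumes "handle_curve \<kappa> \<gamma>" "norm v > \<kappa>"
  shows "v \<in> handle \<gamma> \<longleftrightarrow> v \<in> UNIV \<times> {0} \<union> {0} \<times> UNIV"
proof
  have h: "0 < \<kappa>" "\<And>t. t \<le> -\<kappa> \<Longrightarrow> \<gamma> t = (t, 0)" "\<And>t. t \<ge> \<kappa> \<Longrightarrow> \<gamma> t = (0, t)"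
    "\<And>t. \<bar>t\<bar> \<le> \<kappa> \<Longrightarrow> norm (\<gamma> t) \<le> \<kappa>"
    using assms(1) by (auto simp: handle_curve_def)
  {
    assume "v \<in> handle \<gamma>"
    then obtain t x where tx: "v = spin \<gamma> (t, x)" "norm x = 1" unfolding handle_eq_spin by auto
    then have "\<not> \<bar>t\<bar> \<le> \<kappa>" using h(4)[of t] assms(2) norm_spin[of x \<gamma> t] by auto
    then show "v \<in> UNIV \<times> {0} \<union> {0} \<times> UNIV"
      using h(2)[of t] h(3)[of t] unfolding tx(1) spin_def by (cases "t \<ge> \<kappa>") auto
  next
    assume "v \<in> UNIV \<times> {0} \<union> {0} \<times> UNIV"
    then consider x where "v = (x, 0)" | y where "v = (0, y)" by blast
    then show "v \<in> handle \<gamma>"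
    proof cases
      case 1
      then have x: "norm x > \<kappa>" using assms(2) by simp
      then have "norm x \<noteq> 0" using h(1) by linarith
      \<comment> \<open>On this arm the curve is (t, 0) with t < 0, which reverses the unit
        vector.\<close>
      then have "v = spin \<gamma> (- norm x, - (x /\<^sub>R norm x))" using x h(2)[of "- norm x"] 1 by (simp add: spin_def)
      moreover have "norm (- (x /\<^sub>R norm x)) = 1" using \<open>norm x \<noteq> 0\<close> by simp
      ultimately show ?thesis unfolding handle_eq_spin by (metis UNIV_I imageI mem_sphere_0 mem_Sigma_iff)
    next
      case 2
      then have y: "norm y > \<kappa>" using assms(2) by simp
      then have "norm y \<noteq> 0" using h(1) by linarith
      then have "v = spin \<gamma> (norm y, y /\<^sub>R norm y)" using y h(3)[of "norm y"] 2 by (simp add: spin_def)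
      moreover have "norm (y /\<^sub>R norm y) = 1" using \<open>norm y \<noteq> 0\<close> by simp
      ultimately show ?thesis unfolding handle_eq_spin by (metis UNIV_I imageI mem_sphere_0 mem_Sigma_iff)
    qed
  }
qed

text \<open>Inside U' the set is the image of a handle. At a point outside U', the compact image of
  \<open>cball 0 \<kappa>\<close> can be removed from a neighbourhood, and off that image R and
  \<Lambda>' coincide even within U'; there \<Lambda>' is known to be embedded.\<close>

lemma embedded_resolution:
  fixes \<theta> :: "'n::finite phase \<Rightarrow> 'n phase"
  assumes sy: "symplectomorphism cotangent cotangent U U' \<theta>" and "0 \<in> U" "\<theta> 0 = 0"
    and hc: "handle_curve \<kappa> \<gamma>" "cball 0 \<kappa> \<subseteq> U"
    and ax: "\<theta> ` (U \<inter> (UNIV \<times> {0} \<union> {0} \<times> UNIV)) = Lambda' \<sigma> \<rho> \<inter> U'"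
    and R: "R = (Lambda' \<sigma> \<rho> - U') \<union> \<theta> ` (U \<inter> handle \<gamma>)"
  shows "embedded_submanifold euclid CARD('n) R"
proof (rule embedded_submanifold_local[OF smooth_atlas_euclid])
  fix z assume z: "z \<in> R"
  have op: "open U" "open U'" and d: "diffeomorphism euclid euclid U U' \<theta>"
    using sy by (auto simp: symplectomorphism_def atlas_of_cotangent)
  have b: "inj_on \<theta> U" "\<theta> ` U = U'" using diffeomorphism_bij[OF d] by (auto simp: bij_betw_def)
  show "\<exists>Q L2. open Q \<and> z \<in> Q \<and> embedded_submanifold euclid CARD('n) L2 \<and> R \<inter> Q = L2 \<inter> Q"
  proof (cases "z \<in> U'")
    case True
    have "embedded_submanifold euclid CARD('n) (\<theta> ` (handle \<gamma> \<inter> U))"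
      by (rule embedded_submanifold_image[OF smooth_atlas_euclid d op embedded_handle[OF profile_curve_handle_curve[OF hc(1)]]])
    moreover have "R \<inter> U' = \<theta> ` (handle \<gamma> \<inter> U) \<inter> U'" unfolding R by blast
    ultimately show ?thesis using op(2) True by blast
  next
    case False
    have "0 \<in> U'" using b(2) assms(2,3) by force
    then have "z \<noteq> 0" using False by blast
    then obtain Q L2 where Q: "open Q" "z \<in> Q" "embedded_submanifold euclid CARD('n) L2" "Lambda' \<sigma> \<rho> \<inter> Q = L2 \<inter> Q"
      by (rule Lambda'_regular)
    let ?C = "\<theta> ` cball 0 \<kappa>"
    have "smooth_on U \<theta>" using d by (simp add: diffeomorphism_def smooth_map_euclid)
    then have "continuous_on (cball 0 \<kappa>) \<theta>" using hc(2) smooth_on_imp_continuous_on continuous_on_subset by blast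
    then have "closed ?C" by (intro compact_imp_closed compact_continuous_image compact_cball)
    then have "open (Q - ?C)" using Q(1) by (rule open_Diff[rotated])
    moreover have "z \<in> Q - ?C" using Q(2) False b(2) hc(2) by blast
    moreover have "w \<in> R \<longleftrightarrow> w \<in> Lambda' \<sigma> \<rho>" if w: "w \<notin> ?C" for w
    proof (cases "w \<in> U'")
      case True
      then obtain v where v: "v \<in> U" "w = \<theta> v" using b(2) by blast
      then have "norm v > \<kappa>" using w by force
      then have "v \<in> handle \<gamma> \<longleftrightarrow> v \<in> UNIV \<times> {0} \<union> {0} \<times> UNIV" by (rule handle_off_ball[OF hc(1)])
      moreover have "w \<in> R \<longleftrightarrow> v \<in> handle \<gamma>"
        unfolding R v(2) using v(1) True b(1) v(2) by (auto dest: inj_onD)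
      moreover have "w \<in> Lambda' \<sigma> \<rho> \<longleftrightarrow> v \<in> UNIV \<times> {0} \<union> {0} \<times> UNIV"
      proof -
        have "w \<in> Lambda' \<sigma> \<rho> \<longleftrightarrow> \<theta> v \<in> \<theta> ` (U \<inter> (UNIV \<times> {0} \<union> {0} \<times> UNIV))"
          unfolding ax using True v(2) by simp
        also have "\<dots> \<longleftrightarrow> v \<in> U \<inter> (UNIV \<times> {0} \<union> {0} \<times> UNIV)"
          by (rule inj_on_image_mem_iff[OF b(1) v(1)]) blast
        finally show ?thesis using v(1) by blast
      qed
      ultimately show ?thesis by blast
    next
      case False
      then show ?thesis unfolding R using b(2) by blast
    qed
    then have "R \<inter> (Q - ?C) = L2 \<inter> (Q - ?C)" using Q(4) by blast
    ultimately show ?thesis using Q(3) by blast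
  qed
qed

end

section \<open>The ends of the cobordism\<close>

context antisurgery_model
begin

text \<open>Near \<open>x\<^sub>0\<close> = 1 the model function does not depend on
  \<open>x\<^sub>0\<close>, so dF has no component in that direction and restricts to the
  differential of the slice.\<close>

lemma Gamma_sheet_end:
  fixes w :: "'n::finite phase"
  shows "((1, 0), w) \<in> Gamma_sheet \<sigma> \<rho> s \<longleftrightarrow> w \<in> Lambda'_sheet \<sigma> \<rho> s"
proof -
  obtain x y where w: "w = (x, y)" by (cases w)
  let ?G = "\<lambda>z. s * (case z of (x\<^sub>0, x) \<Rightarrow> model_f \<sigma> \<rho> x\<^sub>0 x) powr (3/2)" and ?g = "\<lambda>x. s * model_f \<sigma> \<rho> 1 x powr (3/2)"
  have pos: "model_f \<sigma> \<rho> 1 x > 0" using delta f1_pos by (simp add: model_f_1)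
  have "((1, 0), w) \<in> Gamma_sheet \<sigma> \<rho> s \<longleftrightarrow> ((1, x), (0, y)) \<in> graph_d32 (\<lambda>(x\<^sub>0, x). model_f \<sigma> \<rho> x\<^sub>0 x) s"
    unfolding Gamma_sheet_def w by (force simp: image_iff)
  also have "\<dots> \<longleftrightarrow> (?G has_derivative (\<lambda>h. (0, y) \<bullet> h)) (at (1, x))"
    using pos by (simp add: graph_d32_def)
  also have "\<dots> \<longleftrightarrow> (?g has_derivative (\<lambda>h. y \<bullet> h)) (at x)"
  proof
    assume "(?G has_derivative (\<lambda>h. (0, y) \<bullet> h)) (at (1, x))"
    moreover have "((\<lambda>x. (1::real, x)) has_derivative (\<lambda>h. (0, h))) (at x)"
      by (intro has_derivative_Pair has_derivative_const has_derivative_ident)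
    ultimately have "((\<lambda>x. ?G (1, x)) has_derivative (\<lambda>h. (0, y) \<bullet> (0::real, h))) (at x)"
      by (rule has_derivative_compose[rotated])
    then show "(?g has_derivative (\<lambda>h. y \<bullet> h)) (at x)" by simp
  next
    assume "(?g has_derivative (\<lambda>h. y \<bullet> h)) (at x)"
    then have "((\<lambda>z::real \<times> (real, 'n) vec. ?g (snd z)) has_derivative (\<lambda>h. y \<bullet> snd h)) (at (1, x))"
      by (intro has_derivative_compose[where g="?g", OF has_derivative_snd[OF has_derivative_ident]]) simp
    then have "(?G has_derivative (\<lambda>h. y \<bullet> snd h)) (at (1, x))"
    proof (rule has_derivative_transform_within_open[of _ _ _ _ "{1 - \<delta><..} \<times> UNIV"])
      show "open ({1 - \<delta><..} \<times> (UNIV :: (real, 'n) vec set))" by (intro open_Times) auto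
      show "?g (snd z) = ?G z" if "z \<in> {1 - \<delta><..} \<times> UNIV" for z
        using that delta by (cases z) (simp add: model_f_1)
    qed (use delta in auto)
    moreover have "(\<lambda>h::real \<times> (real, 'n) vec. y \<bullet> snd h) = (\<lambda>h. (0, y) \<bullet> h)" by (auto simp: inner_prod_def)
    ultimately show "(?G has_derivative (\<lambda>h. (0, y) \<bullet> h)) (at (1, x))" by simp
  qed
  also have "\<dots> \<longleftrightarrow> w \<in> Lambda'_sheet \<sigma> \<rho> s"
    using pos by (simp add: w Lambda'_sheet_def graph_d32_def)
  finally show ?thesis .
qed

text \<open>Over (1, 0) the splitting is a symplectomorphism \<open>\<psi>\<close> of phase space
  taking each sheet of \<Lambda>' to its tangent plane. The end of the one-handle is a 0-surgery on
  these planes in the order (\<lambda>-, \<lambda>+), and \<psi> pulls it back to a resolution of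
  \<Lambda>' in the same order.\<close>

lemma desingularized_end:
  fixes Ls :: "'n::finite phase set"
  assumes "desingularized_model \<epsilon> \<delta> \<sigma> \<rho> Gs Ls"
  obtains U U' :: "'n phase set" and \<theta> \<kappa> \<gamma>
  where "symplectomorphism cotangent cotangent U U' \<theta>" "U' \<subseteq> model_box \<epsilon>" "0 \<in> U" "\<theta> 0 = 0"
    "handle_curve \<kappa> \<gamma>" "cball 0 \<kappa> \<subseteq> U"
    "\<theta> ` (U \<inter> UNIV \<times> {0}) = Lambda'_sheet \<sigma> \<rho> (-1) \<inter> U'"
    "\<theta> ` (U \<inter> {0} \<times> UNIV) = Lambda'_sheet \<sigma> \<rho> 1 \<inter> U'"
    "Ls = (Lambda' \<sigma> \<rho> - U') \<union> \<theta> ` (U \<inter> handle \<gamma>)"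
proof -
  obtain t\<^sub>0 \<Phi> N N' C B H where ds: "darboux_splitting \<epsilon> \<delta> \<sigma> \<rho> t\<^sub>0 \<Phi> N N' C B"
    and oh: "lagrangian_one_handle \<sigma> \<rho> t\<^sub>0 C B H"
    and Gs: "Gs = (Gamma_model \<sigma> \<rho> - N) \<union> {z\<in>N. \<Phi> z \<in> H}"
    and cob: "lagrangian_cobordism cotangent Gs Ls (Lambda \<sigma> \<rho>)"
    using assms unfolding desingularized_model_def by blast
  let ?lam = "\<lambda>s. lambda_tangent \<sigma> \<rho> s :: 'n phase set"
  have t\<^sub>0: "t\<^sub>0 < 1 - \<delta>" and sy\<Phi>: "symplectomorphism (prod_symplectic cotangent cotangent) (prod_symplectic cotangent cotangent) N N' \<Phi>"
    and sing: "singular_locus \<delta> \<subseteq> N" "N \<subseteq> ({\<delta><..} \<times> UNIV) \<times> model_box \<epsilon>" "\<And>z. z \<in> singular_locus \<delta> \<Longrightarrow> \<Phi> z = z"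
    using ds by (auto simp: darboux_splitting_def)
  note D = ds[unfolded darboux_splitting_def]
  have "\<exists>r>0. \<forall>s\<in>{1, -1}.
        \<Phi> ` (Gamma_sheet \<sigma> \<rho> s \<inter> N) = eta_curve \<sigma> t\<^sub>0 s \<times> (?lam s \<inter> ball 0 r) \<and>
        eta_lambda \<sigma> \<rho> t\<^sub>0 s \<inter> N' = eta_curve \<sigma> t\<^sub>0 s \<times> (?lam s \<inter> ball 0 r)"
    using D by (elim conjE)
  then obtain r where r: "\<And>s. s \<in> {1, -1} \<Longrightarrow>
        \<Phi> ` (Gamma_sheet \<sigma> \<rho> s \<inter> N) = eta_curve \<sigma> t\<^sub>0 s \<times> (?lam s \<inter> ball 0 r)"
     "\<And>s. s \<in> {1, -1} \<Longrightarrow> eta_lambda \<sigma> \<rho> t\<^sub>0 s \<inter> N' = eta_curve \<sigma> t\<^sub>0 s \<times> (?lam s \<inter> ball 0 r)"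
    by blast
  have "\<exists>J Q \<psi>. 0 \<in> J \<and> symplectomorphism cotangent cotangent Q B \<psi> \<and>
        N \<inter> ({1 - \<delta>..} \<times> UNIV) \<times> UNIV = ({1 - \<delta>..} \<times> J) \<times> Q \<and>
        N' \<inter> ({1 - \<delta>..} \<times> UNIV) \<times> UNIV = ({1 - \<delta>..} \<times> J) \<times> B \<and>
        (\<forall>a\<in>{1 - \<delta>..} \<times> J. \<forall>w\<in>Q. \<Phi> (a, w) = (a, \<psi> w))"
    using D by (elim conjE)
  then obtain J Q \<psi> where J: "0 \<in> J" and sy\<psi>: "symplectomorphism cotangent cotangent Q B \<psi>"
    and NQ: "N \<inter> ({1 - \<delta>..} \<times> UNIV) \<times> UNIV = ({1 - \<delta>..} \<times> J) \<times> Q"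
    and NB: "N' \<inter> ({1 - \<delta>..} \<times> UNIV) \<times> UNIV = ({1 - \<delta>..} \<times> J) \<times> B"
    and \<Phi>\<psi>: "\<forall>a\<in>{1 - \<delta>..} \<times> J. \<forall>w\<in>Q. \<Phi> (a, w) = (a, \<psi> w)"
    by (elim exE conjE) (rule that)
  obtain c K where c: "c < 1" and K: "K \<in> resolution_family cotangent B (?lam (-1) \<union> ?lam 1) 0 (?lam (-1), ?lam 1)"
    and HK: "H \<inter> ({c..} \<times> UNIV) \<times> UNIV = ({c..} \<times> {0}) \<times> K"
    using oh unfolding lagrangian_one_handle_def by blast
  obtain d where d: "0 < d" "Gs \<inter> ({1 - d..} \<times> UNIV) \<times> UNIV = ({1 - d..} \<times> {0}) \<times> Ls"
    using cob unfolding lagrangian_cobordism_def by blast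
  have a: "(1, 0) \<in> {1 - \<delta>..} \<times> J" using J delta by simp
  \<comment> \<open>Evaluating each product description at (1, 0) turns it into a statement about
    subsets of phase space.\<close>
  have slice: "w \<in> S \<longleftrightarrow> ((1, 0), w) \<in> A" if "A \<inter> ({b..} \<times> UNIV) \<times> UNIV = ({b..} \<times> Z) \<times> S" "b \<le> 1" "0 \<in> Z"
    for A :: "((real \<times> real) \<times> 'n phase) set" and b Z S w
  proof -
    have "((1, 0), w) \<in> A \<longleftrightarrow> ((1, 0), w) \<in> A \<inter> ({b..} \<times> UNIV) \<times> UNIV" using that(2) by auto
    also have "\<dots> \<longleftrightarrow> w \<in> S" unfolding that(1) using that(2,3) by auto
    finally show ?thesis by simp
  qed
  have QN: "w \<in> Q \<longleftrightarrow> ((1, 0), w) \<in> N" for w by (rule slice[OF NQ _ J]) (use delta in simp)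
  have BN: "w \<in> B \<longleftrightarrow> ((1, 0), w) \<in> N'" for w by (rule slice[OF NB _ J]) (use delta in simp)
  have KH: "w \<in> K \<longleftrightarrow> ((1, 0), w) \<in> H" for w by (rule slice[OF HK]) (use c in auto)
  have LsG: "w \<in> Ls \<longleftrightarrow> ((1, 0), w) \<in> Gs" for w by (rule slice[OF d(2)]) (use d(1) in auto)
  have \<Phi>1: "\<Phi> ((1, 0), w) = ((1, 0), \<psi> w)" if "w \<in> Q" for w using bspec[OF bspec[OF \<Phi>\<psi> a] that] .
  have b\<psi>: "bij_betw \<psi> Q B" using sy\<psi> by (rule symplectomorphism_bij)
  then have inj\<psi>: "inj_on \<psi> Q" and im\<psi>: "\<psi> ` Q = B" by (auto simp: bij_betw_def)
  have inj\<Phi>: "inj_on \<Phi> N" using symplectomorphism_bij[OF sy\<Phi>] by (simp add: bij_betw_def)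
  have Qbox: "Q \<subseteq> model_box \<epsilon>" using QN sing(2) by blast
  have s0: "((1, 0), 0) \<in> singular_locus \<delta>" using delta by (simp add: singular_locus_def)
  then have Q0: "0 \<in> Q" using QN sing(1) by blast
  have \<psi>0: "\<psi> 0 = 0" using \<Phi>1[OF Q0] sing(3)[OF s0] by simp
  \<comment> \<open>\<sigma> is constant near 1, so both curves pass through (1, 0).\<close>
  have eta: "(1, 0) \<in> eta_curve \<sigma> t\<^sub>0 s" for s
  proof -
    have "((\<lambda>_. 1 + \<epsilon>) has_real_derivative 0) (at 1)" by simp
    then have "(\<sigma> has_real_derivative 0) (at 1)"
      by (rule has_field_derivative_transform_within_open[of _ _ _ "{1 - \<delta><..}"]) (use delta sigma(3) in auto)
    then have "deriv \<sigma> 1 = 0" by (rule DERIV_imp_deriv)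
    then show ?thesis unfolding eta_curve_def using t\<^sub>0 delta by (auto intro!: exI[of _ 1])
  qed
  \<comment> \<open>One inclusion is the image of the sheet of \<Gamma> under the splitting; the
    other uses the description of the product inside N' and injectivity of \<Phi>.\<close>
  have sheets: "\<psi> ` (Lambda'_sheet \<sigma> \<rho> s \<inter> Q) = ?lam s \<inter> B" if s: "s \<in> {1, -1}" for s
  proof (intro equalityI subsetI)
    fix v assume "v \<in> \<psi> ` (Lambda'_sheet \<sigma> \<rho> s \<inter> Q)"
    then obtain w where w: "v = \<psi> w" "w \<in> Lambda'_sheet \<sigma> \<rho> s" "w \<in> Q" by blast
    then have "((1, 0), w) \<in> Gamma_sheet \<sigma> \<rho> s \<inter> N" using Gamma_sheet_end QN by blast
    then have "\<Phi> ((1, 0), w) \<in> eta_curve \<sigma> t\<^sub>0 s \<times> (?lam s \<inter> ball 0 r)" using r(1)[OF s] by blast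
    then have "v \<in> ?lam s" using \<Phi>1[OF w(3)] w(1) by simp
    then show "v \<in> ?lam s \<inter> B" using w im\<psi> by blast
  next
    fix v assume v: "v \<in> ?lam s \<inter> B"
    then have "((1, 0), v) \<in> eta_lambda \<sigma> \<rho> t\<^sub>0 s \<inter> N'" using eta BN by (simp add: eta_lambda_def)
    then have "((1, 0), v) \<in> \<Phi> ` (Gamma_sheet \<sigma> \<rho> s \<inter> N)" using r[OF s] by simp
    then obtain z where zv: "((1, 0), v) = \<Phi> z" and "z \<in> Gamma_sheet \<sigma> \<rho> s \<inter> N" by (rule imageE)
    then have z: "z \<in> Gamma_sheet \<sigma> \<rho> s" "z \<in> N" by auto
    obtain w where w: "w \<in> Q" "v = \<psi> w" using v im\<psi> by blast
    have "z = ((1, 0), w)"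
      using inj_onD[OF inj\<Phi>, of z "((1, 0), w)"] z zv[symmetric] \<Phi>1[OF w(1)] w QN by simp
    then show "v \<in> \<psi> ` (Lambda'_sheet \<sigma> \<rho> s \<inter> Q)" using z(1) w Gamma_sheet_end by blast
  qed
  obtain \<theta>\<^sub>1 and U U\<^sub>1 :: "'n phase set" and \<kappa> \<gamma> where sy1: "symplectomorphism cotangent cotangent U U\<^sub>1 \<theta>\<^sub>1"
    and U0: "0 \<in> U" "\<theta>\<^sub>1 0 = 0" and U1B: "U\<^sub>1 \<subseteq> B"
    and "(?lam (-1) \<union> ?lam 1) \<inter> U\<^sub>1 = (?lam (-1) \<union> ?lam 1) \<inter> U\<^sub>1"
    and ax: "\<theta>\<^sub>1 ` (U \<inter> UNIV \<times> {0}) = ?lam (-1) \<inter> U\<^sub>1" "\<theta>\<^sub>1 ` (U \<inter> {0} \<times> UNIV) = ?lam 1 \<inter> U\<^sub>1"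
    and hc: "handle_curve \<kappa> \<gamma>" "cball 0 \<kappa> \<subseteq> U"
    and Keq: "K = ((?lam (-1) \<union> ?lam 1) - U\<^sub>1) \<union> \<theta>\<^sub>1 ` (U \<inter> handle \<gamma>)"
    using K[unfolded resolution_family_def prod.case mem_Collect_eq] by (elim exE conjE) (rule that)
  define \<psi>' where "\<psi>' = inv_into Q \<psi>"
  \<comment> \<open>The surgery chart for the planes has its image in B, the image of
    \<open>\<psi>\<close>, so it can be pulled back to a chart for \<Lambda>'.\<close>
  define \<theta> where "\<theta> z = \<psi>' (\<theta>\<^sub>1 z)" for z
  define U' where "U' = \<psi>' ` U\<^sub>1"
  have \<psi>'\<psi>: "\<psi>' (\<psi> w) = w" if "w \<in> Q" for w unfolding \<psi>'_def by (rule inv_into_f_f[OF inj\<psi> that])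
  have \<psi>\<psi>': "\<psi> (\<psi>' v) = v" "\<psi>' v \<in> Q" if "v \<in> B" for v
    unfolding \<psi>'_def using that im\<psi> by (auto intro: f_inv_into_f inv_into_into)
  have oU1: "open U\<^sub>1" using sy1 by (simp add: symplectomorphism_def)
  have "symplectomorphism cotangent cotangent U\<^sub>1 (\<psi>' ` U\<^sub>1) \<psi>'"
    by (rule symplectomorphism_subset[OF _ symplectomorphism_inv[OF sy\<psi>, folded \<psi>'_def] oU1 U1B])
      (simp add: atlas_of_cotangent smooth_atlas_euclid)
  then have sy\<theta>: "symplectomorphism cotangent cotangent U U' \<theta>"
    unfolding \<theta>_def[abs_def] U'_def
    by (intro symplectomorphism_compose[OF _ _ sy1]) (auto simp: atlas_of_cotangent smooth_atlas_euclid)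
  have U'Q: "U' \<subseteq> Q" using U1B \<psi>\<psi>' by (auto simp: U'_def)
  have U'_iff: "w \<in> U' \<longleftrightarrow> \<psi> w \<in> U\<^sub>1" if "w \<in> Q" for w
    using that \<psi>'\<psi>[OF that] \<psi>\<psi>'(1) U1B by (force simp: U'_def image_iff)
  have pull: "\<psi>' ` (?lam s \<inter> U\<^sub>1) = Lambda'_sheet \<sigma> \<rho> s \<inter> U'" if s: "s \<in> {1, -1}" for s
  proof (intro equalityI subsetI)
    fix w assume "w \<in> \<psi>' ` (?lam s \<inter> U\<^sub>1)"
    then obtain v where v: "w = \<psi>' v" "v \<in> ?lam s" "v \<in> U\<^sub>1" by blast
    then have "v \<in> \<psi> ` (Lambda'_sheet \<sigma> \<rho> s \<inter> Q)" using sheets[OF s] U1B by blast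
    then have "w \<in> Lambda'_sheet \<sigma> \<rho> s" using v(1) \<psi>'\<psi> by auto
    then show "w \<in> Lambda'_sheet \<sigma> \<rho> s \<inter> U'" using v by (simp add: U'_def)
  next
    fix w assume w: "w \<in> Lambda'_sheet \<sigma> \<rho> s \<inter> U'"
    then have wQ: "w \<in> Q" using U'Q by blast
    then have "\<psi> w \<in> ?lam s" using sheets[OF s] w by blast
    moreover have "\<psi> w \<in> U\<^sub>1" using U'_iff[OF wQ] w by blast
    ultimately show "w \<in> \<psi>' ` (?lam s \<inter> U\<^sub>1)" using \<psi>'\<psi>[OF wQ] by (metis IntI imageI)
  qed
  have im1: "\<theta>\<^sub>1 ` U = U\<^sub>1" using symplectomorphism_bij[OF sy1] by (simp add: bij_betw_def)
  have Ls: "Ls = (Lambda' \<sigma> \<rho> - U') \<union> \<theta> ` (U \<inter> handle \<gamma>)"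
  proof (rule set_eqI)
    fix w :: "'n phase"
    have G: "((1, 0), w) \<in> Gamma_model \<sigma> \<rho> \<longleftrightarrow> w \<in> Lambda' \<sigma> \<rho>"
      by (simp add: Gamma_model_def Lambda'_def Gamma_sheet_end)
    show "w \<in> Ls \<longleftrightarrow> w \<in> (Lambda' \<sigma> \<rho> - U') \<union> \<theta> ` (U \<inter> handle \<gamma>)"
    proof (cases "w \<in> Q")
      case False
      moreover have "\<theta> ` U \<subseteq> Q" using im1 U'Q by (auto simp: \<theta>_def[abs_def] U'_def image_image[symmetric])
      ultimately show ?thesis using LsG[of w] Gs G QN[of w] U'Q by blast
    next
      case True
      then have "w \<in> Ls \<longleftrightarrow> \<psi> w \<in> K" using LsG[of w] QN[of w] Gs \<Phi>1[OF True] KH[of "\<psi> w"] by auto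
      moreover have "\<psi> w \<in> ?lam (-1) \<union> ?lam 1 \<longleftrightarrow> w \<in> Lambda' \<sigma> \<rho>"
      proof -
        have "\<psi> w \<in> ?lam s \<longleftrightarrow> w \<in> Lambda'_sheet \<sigma> \<rho> s" if "s \<in> {1, -1}" for s
        proof -
          have "\<psi> w \<in> ?lam s \<longleftrightarrow> \<psi> w \<in> \<psi> ` (Lambda'_sheet \<sigma> \<rho> s \<inter> Q)"
            unfolding sheets[OF that] using True im\<psi> by blast
          also have "\<dots> \<longleftrightarrow> w \<in> Lambda'_sheet \<sigma> \<rho> s \<inter> Q" by (rule inj_on_image_mem_iff[OF inj\<psi> True]) blast
          finally show ?thesis using True by blast
        qed
        then show ?thesis by (auto simp: Lambda'_def)
      qed
      moreover have "\<psi> w \<in> \<theta>\<^sub>1 ` (U \<inter> handle \<gamma>) \<longleftrightarrow> w \<in> \<theta> ` (U \<inter> handle \<gamma>)"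
      proof
        assume "\<psi> w \<in> \<theta>\<^sub>1 ` (U \<inter> handle \<gamma>)"
        then obtain z where z: "z \<in> U \<inter> handle \<gamma>" "\<psi> w = \<theta>\<^sub>1 z" by blast
        then have "w = \<theta> z" using \<psi>'\<psi>[OF True] by (simp add: \<theta>_def)
        then show "w \<in> \<theta> ` (U \<inter> handle \<gamma>)" using z(1) by blast
      next
        assume "w \<in> \<theta> ` (U \<inter> handle \<gamma>)"
        then obtain z where z: "z \<in> U \<inter> handle \<gamma>" "w = \<psi>' (\<theta>\<^sub>1 z)" by (auto simp: \<theta>_def)
        then have "\<theta>\<^sub>1 z \<in> B" using im1 U1B by blast
        then have "\<psi> w = \<theta>\<^sub>1 z" using z(2) \<psi>\<psi>' by simp
        then show "\<psi> w \<in> \<theta>\<^sub>1 ` (U \<inter> handle \<gamma>)" using z(1) by blast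
      qed
      ultimately show ?thesis unfolding Keq using U'_iff[OF True] by blast
    qed
  qed
  show ?thesis
  proof (rule that[OF sy\<theta> _ U0(1) _ hc _ _ Ls])
    show "U' \<subseteq> model_box \<epsilon>" using U'Q Qbox by blast
    show "\<theta> 0 = 0" using \<psi>'\<psi>[OF Q0] by (simp add: \<theta>_def U0(2) \<psi>0)
    show "\<theta> ` (U \<inter> UNIV \<times> {0}) = Lambda'_sheet \<sigma> \<rho> (-1) \<inter> U'"
      using pull[of "-1"] ax(1) by (simp add: \<theta>_def[abs_def] image_image[symmetric])
    show "\<theta> ` (U \<inter> {0} \<times> UNIV) = Lambda'_sheet \<sigma> \<rho> 1 \<inter> U'"
      using pull[of 1] ax(2) by (simp add: \<theta>_def[abs_def] image_image[symmetric])
  qed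
qed

end

section \<open>Transport into the ambient manifold\<close>

text \<open>Composing the chart with \<xi> carries a resolution of the model to one of the implanted
  set; the sign s treats both orderings at once.\<close>

lemma implant_resolution:
  fixes X :: "('m::topological_space, 'n::finite phase) form_chart set" and \<theta> :: "'n phase \<Rightarrow> 'n phase"
  assumes X: "smooth_atlas (atlas_of X)" and \<xi>: "symplectomorphism cotangent X W\<^sub>0 W \<xi>"
    and sy: "symplectomorphism cotangent cotangent U U' \<theta>" and U: "U' \<subseteq> W\<^sub>0" "0 \<in> U" "\<theta> 0 = 0"
    and hc: "handle_curve \<kappa> \<gamma>" "cball 0 \<kappa> \<subseteq> U"
    and ax: "\<theta> ` (U \<inter> UNIV \<times> {0}) = Lambda'_sheet \<sigma> \<rho> s \<inter> U'"
      "\<theta> ` (U \<inter> {0} \<times> UNIV) = Lambda'_sheet \<sigma> \<rho> (- s) \<inter> U'"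
    and s: "s = 1 \<or> s = -1"
    and R: "R = (Lambda' \<sigma> \<rho> - U') \<union> \<theta> ` (U \<inter> handle \<gamma>)"
  shows "implant L \<xi> W\<^sub>0 W R \<in> resolution_family X UNIV (implant L \<xi> W\<^sub>0 W (Lambda' \<sigma> \<rho>)) (\<xi> 0)
    (sheet \<sigma> \<rho> \<xi> W\<^sub>0 s, sheet \<sigma> \<rho> \<xi> W\<^sub>0 (- s))"
proof -
  have oU': "open U'" and imU: "\<theta> ` U = U'"
    using sy symplectomorphism_bij[OF sy] by (auto simp: symplectomorphism_def bij_betw_def)
  have inj: "inj_on \<xi> W\<^sub>0" and imW: "\<xi> ` W\<^sub>0 = W"
    using symplectomorphism_bij[OF \<xi>] by (auto simp: bij_betw_def)
  have L': "Lambda' \<sigma> \<rho> = Lambda'_sheet \<sigma> \<rho> s \<union> (Lambda'_sheet \<sigma> \<rho> (- s) :: 'n phase set)"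
    using s by (auto simp: Lambda'_def)
  have axis: "(\<lambda>z. \<xi> (\<theta> z)) ` (U \<inter> T) = sheet \<sigma> \<rho> \<xi> W\<^sub>0 k \<inter> \<xi> ` U'"
    if "\<theta> ` (U \<inter> T) = Lambda'_sheet \<sigma> \<rho> k \<inter> U'" for T k
  proof -
    have "(\<lambda>z. \<xi> (\<theta> z)) ` (U \<inter> T) = \<xi> ` (Lambda'_sheet \<sigma> \<rho> k \<inter> U')" unfolding that[symmetric] by (simp add: image_image)
    also have "\<dots> = \<xi> ` (Lambda'_sheet \<sigma> \<rho> k \<inter> W\<^sub>0 \<inter> U')" using U(1) by (intro arg_cong[where f="image \<xi>"]) blast
    also have "\<dots> = \<xi> ` (Lambda'_sheet \<sigma> \<rho> k \<inter> W\<^sub>0) \<inter> \<xi> ` U'"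
      by (rule inj_on_image_Int[OF inj _ U(1)]) blast
    finally show ?thesis by (simp add: sheet_def)
  qed
  have UW: "\<xi> ` U' \<subseteq> W" using U(1) imW by blast
  have "symplectomorphism cotangent X U (\<xi> ` U') (\<lambda>z. \<xi> (\<theta> z))"
    by (rule symplectomorphism_compose[OF X symplectomorphism_subset[OF X \<xi> oU' U(1)] sy])
  moreover have "implant L \<xi> W\<^sub>0 W (Lambda' \<sigma> \<rho>) \<inter> \<xi> ` U' = (sheet \<sigma> \<rho> \<xi> W\<^sub>0 s \<union> sheet \<sigma> \<rho> \<xi> W\<^sub>0 (- s)) \<inter> \<xi> ` U'"
    unfolding implant_def sheet_def L' using UW by blast
  moreover have "implant L \<xi> W\<^sub>0 W R =
      (implant L \<xi> W\<^sub>0 W (Lambda' \<sigma> \<rho>) - \<xi> ` U') \<union> (\<lambda>z. \<xi> (\<theta> z)) ` (U \<inter> handle \<gamma>)"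
  proof -
    have "\<xi> ` (R \<inter> W\<^sub>0) = \<xi> ` ((Lambda' \<sigma> \<rho> \<inter> W\<^sub>0) - U') \<union> \<xi> ` \<theta> ` (U \<inter> handle \<gamma>)"
      unfolding R image_Un[symmetric] using imU U(1) by (intro arg_cong[where f="image \<xi>"]) blast
    moreover have "\<xi> ` ((Lambda' \<sigma> \<rho> \<inter> W\<^sub>0) - U') = \<xi> ` (Lambda' \<sigma> \<rho> \<inter> W\<^sub>0) - \<xi> ` U'"
      by (rule inj_on_image_set_diff[OF inj _ U(1)]) blast
    ultimately show ?thesis unfolding implant_def using UW by (auto simp: image_image)
  qed
  ultimately show ?thesis
    unfolding resolution_family_def prod.case mem_Collect_eq
    using U(2,3) hc axis[OF ax(1)] axis[OF ax(2)]
    by (intro exI[of _ "\<lambda>z. \<xi> (\<theta> z)"] exI[of _ U] exI[of _ "\<xi> ` U'"] exI[of _ \<kappa>] exI[of _ \<gamma>]) simp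
qed

text \<open>The constant isotopy, with empty support, for the end that is itself a
  resolution.\<close>

lemma local_lagrangian_isotopy_refl:
  assumes "lagrangian cotangent A"
  shows "local_lagrangian_isotopy W\<^sub>0 A A"
proof -
  have "smooth_on ({0..1} \<times> A) (\<lambda>(t, z). z)" unfolding case_prod_unfold by (intro smooth_intros)
  moreover have "diffeomorphism euclid euclid A A (\<lambda>z. z)"
    by (rule diffeomorphismI[where g="\<lambda>z. z"]) (auto simp: smooth_atlas_euclid smooth_map_euclid intro: smooth_intros)
  ultimately show ?thesis
    unfolding local_lagrangian_isotopy_def using assms
    by (intro exI[of _ "\<lambda>t z. z"] exI[of _ "{}"]) auto
qed

text \<open>Inside W the set is an image of P. A point outside W has a neighbourhood avoiding the
  image of C, which is closed because the space is Hausdorff, and there the set coincides with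
  L.\<close>

lemma embedded_implant:
  fixes A :: "('m::t2_space, 'e::euclidean_space) atlas" and P \<Lambda> :: "'e set"
  assumes A: "smooth_atlas A" and \<xi>: "diffeomorphism euclid A W\<^sub>0 W \<xi>" and op: "open W\<^sub>0" "open W"
    and L: "embedded_submanifold A k L" and P: "embedded_submanifold euclid k P"
    and \<Lambda>: "\<xi> ` (\<Lambda> \<inter> W\<^sub>0) = L \<inter> W"
    and C: "compact C" "C \<subseteq> W\<^sub>0" and eq: "P - C = \<Lambda> - C"
  shows "embedded_submanifold A k ((L - W) \<union> \<xi> ` (P \<inter> W\<^sub>0))"
proof (rule embedded_submanifold_local[OF A])
  fix z assume z: "z \<in> (L - W) \<union> \<xi> ` (P \<inter> W\<^sub>0)"
  have imW: "\<xi> ` W\<^sub>0 = W" using diffeomorphism_bij[OF \<xi>] by (simp add: bij_betw_def)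
  show "\<exists>Q L2. open Q \<and> z \<in> Q \<and> embedded_submanifold A k L2 \<and> ((L - W) \<union> \<xi> ` (P \<inter> W\<^sub>0)) \<inter> Q = L2 \<inter> Q"
  proof (cases "z \<in> W")
    case True
    then show ?thesis
      using op(2) embedded_submanifold_image[OF A \<xi> op P]
      by (intro exI[of _ W] exI[of _ "\<xi> ` (P \<inter> W\<^sub>0)"]) blast
  next
    case False
    have "continuous_on C \<xi>"
      using smooth_map_imp_continuous_on[OF smooth_atlas_euclid A diffeomorphism_smooth[OF \<xi>]] C(2) continuous_on_subset by blast
    then have "closed (\<xi> ` C)" using C(1) by (intro compact_imp_closed compact_continuous_image)
    then have "open (- \<xi> ` C)" by (simp add: open_Compl)
    moreover have "z \<in> - \<xi> ` C" using False C(2) imW by blast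
    moreover have "((L - W) \<union> \<xi> ` (P \<inter> W\<^sub>0)) \<inter> - \<xi> ` C = L \<inter> - \<xi> ` C"
    proof -
      have "\<xi> ` (P \<inter> W\<^sub>0) - \<xi> ` C = \<xi> ` (\<Lambda> \<inter> W\<^sub>0) - \<xi> ` C" using eq by blast
      then show ?thesis unfolding \<Lambda> by blast
    qed
    ultimately show ?thesis using L by blast
  qed
qed

theorem proposition1p3:
  fixes X :: "('m::{t2_space,second_countable_topology}, 'n::finite phase) form_chart set"
    and L S D W L' Ls :: "'m set" and p :: 'm
    and \<epsilon> \<delta> :: real and \<sigma> \<rho> :: "real \<Rightarrow> real"
    and \<xi> :: "'n phase \<Rightarrow> 'm" and W\<^sub>0 :: "'n phase set"
    and Vs :: "((real \<times> real) \<times> 'm) set"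
  assumes "symplectic_manifold X"
    and "lagrangian X L"
    and "surgery_disc X L S D"
    and "antisurgery X L D \<epsilon> \<delta> \<sigma> \<rho> \<xi> W\<^sub>0 W L' p"
    and "desingularized_cobordism X L \<epsilon> \<delta> \<sigma> \<rho> \<xi> W\<^sub>0 W Vs Ls"
  shows "\<exists>\<tau> \<in> sheet_orderings \<sigma> \<rho> \<xi> W\<^sub>0. \<exists>\<tau>' \<in> sheet_orderings \<sigma> \<rho> \<xi> W\<^sub>0. \<tau> \<noteq> \<tau>' \<and>
    belongs_to_family X L \<xi> W\<^sub>0 W L' p \<tau> L \<and>
    belongs_to_family X L \<xi> W\<^sub>0 W L' p \<tau>' Ls"
proof -
  have X: "smooth_atlas (atlas_of X)" using assms(1) by (simp add: symplectic_manifold_def)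
  have model: "model_parameters \<epsilon> \<delta> \<sigma> \<rho>" and \<xi>: "symplectomorphism cotangent X W\<^sub>0 W \<xi>"
    and disc: "model_disc \<subseteq> W\<^sub>0" and LW: "\<xi> ` (Lambda \<sigma> \<rho> \<inter> W\<^sub>0) = L \<inter> W"
    and box: "closure (model_box \<epsilon>) \<subseteq> W\<^sub>0"
    and L': "L' = implant L \<xi> W\<^sub>0 W (Lambda' \<sigma> \<rho>)" and p: "p = \<xi> 0"
    using assms(4) by (auto simp: antisurgery_def)
  interpret antisurgery_model \<epsilon> \<delta> \<sigma> \<rho> by unfold_locales (rule model)
  have op: "open W\<^sub>0" "open W" and d\<xi>: "diffeomorphism euclid (atlas_of X) W\<^sub>0 W \<xi>"
    using \<xi> by (auto simp: symplectomorphism_def atlas_of_cotangent)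
  have inj: "inj_on \<xi> W\<^sub>0" using diffeomorphism_bij[OF d\<xi>] by (simp add: bij_betw_def)
  have "0 \<in> W\<^sub>0" using disc by (auto simp: model_disc_def zero_prod_def)
  then obtain d where d: "d > 0" "ball 0 d \<subseteq> W\<^sub>0" using op(1) open_contains_ball by blast
  let ?p = "sheet \<sigma> \<rho> \<xi> W\<^sub>0 1" and ?m = "sheet \<sigma> \<rho> \<xi> W\<^sub>0 (-1)"
  have "belongs_to_family X L \<xi> W\<^sub>0 W L' p (?p, ?m) L"
  proof -
    obtain U R :: "'n phase set" and \<kappa> \<gamma> and \<theta> :: "'n phase \<Rightarrow> 'n phase"
      where "open U" and R: "0 \<in> U" "handle_curve \<kappa> \<gamma>" "cball 0 \<kappa> \<subseteq> U"
        "symplectomorphism cotangent cotangent U (\<theta> ` U) \<theta>" "\<theta> 0 = 0" "\<theta> ` U \<subseteq> ball 0 d"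
        "\<theta> ` (U \<inter> UNIV \<times> {0}) = Lambda'_sheet \<sigma> \<rho> 1 \<inter> \<theta> ` U"
        "\<theta> ` (U \<inter> {0} \<times> UNIV) = Lambda'_sheet \<sigma> \<rho> (-1) \<inter> \<theta> ` U"
        "R = (Lambda' \<sigma> \<rho> - \<theta> ` U) \<union> \<theta> ` (U \<inter> handle \<gamma>)"
        and "lagrangian cotangent R"
        and iso: "\<And>W\<^sub>0. closure (model_box \<epsilon>) \<subseteq> W\<^sub>0 \<Longrightarrow> local_lagrangian_isotopy W\<^sub>0 (Lambda \<sigma> \<rho>) R"
      by (rule local_resolution[OF d(1), where 'n='n]) (rule that)
    have "implant L \<xi> W\<^sub>0 W R \<in> resolution_family X UNIV L' p (?p, ?m)"
      unfolding L' p
      by (rule implant_resolution[OF X \<xi> R(4) _ R(1,5,2,3,7,8) _ R(9)]) (use R(6) d(2) in auto)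
    moreover have "L = implant L \<xi> W\<^sub>0 W (Lambda \<sigma> \<rho>)" unfolding implant_def LW by blast
    ultimately show ?thesis unfolding belongs_to_family_def using assms(2) iso[OF box] by blast
  qed
  moreover have "belongs_to_family X L \<xi> W\<^sub>0 W L' p (?m, ?p) Ls"
  proof -
    obtain \<Gamma>s and \<Lambda>s :: "'n phase set" where M: "desingularized_model \<epsilon> \<delta> \<sigma> \<rho> \<Gamma>s \<Lambda>s"
      and Ls: "Ls = implant L \<xi> W\<^sub>0 W \<Lambda>s" and cobX: "lagrangian_cobordism X Vs Ls L"
      using assms(5) unfolding desingularized_cobordism_def by blast
    obtain U U' :: "'n phase set" and \<theta> \<kappa> \<gamma>
      where R: "symplectomorphism cotangent cotangent U U' \<theta>" "U' \<subseteq> model_box \<epsilon>" "0 \<in> U" "\<theta> 0 = 0"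
        "handle_curve \<kappa> \<gamma>" "cball 0 \<kappa> \<subseteq> U"
        "\<theta> ` (U \<inter> UNIV \<times> {0}) = Lambda'_sheet \<sigma> \<rho> (-1) \<inter> U'"
        "\<theta> ` (U \<inter> {0} \<times> UNIV) = Lambda'_sheet \<sigma> \<rho> 1 \<inter> U'"
        "\<Lambda>s = (Lambda' \<sigma> \<rho> - U') \<union> \<theta> ` (U \<inter> handle \<gamma>)"
      by (rule desingularized_end[OF M]) blast
    have U'W: "U' \<subseteq> W\<^sub>0" using R(2) box closure_subset by blast
    have emb: "embedded_submanifold euclid CARD('n) \<Lambda>s"
    proof (rule embedded_resolution[OF R(1,3,4,5,6) _ R(9)])
      show "\<theta> ` (U \<inter> (UNIV \<times> {0} \<union> {0} \<times> UNIV)) = Lambda' \<sigma> \<rho> \<inter> U'"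
        using R(7,8) unfolding Lambda'_def Int_Un_distrib image_Un by blast
    qed
    have "lagrangian_cobordism cotangent \<Gamma>s \<Lambda>s (Lambda \<sigma> \<rho>)" using M by (simp add: desingularized_model_def)
    then have lag: "lagrangian cotangent \<Lambda>s"
      \<comment> \<open>Isotropy is read off from the model cobordism; embeddedness comes from the
        explicit form of the resolution.\<close>
      using emb isotropic_cobordism_end by (auto simp: lagrangian_def atlas_of_cotangent)
    have imU: "\<theta> ` U = U'" using symplectomorphism_bij[OF R(1)] by (simp add: bij_betw_def)
    let ?C = "closure (model_box \<epsilon>) :: 'n phase set"
    have "model_box \<epsilon> \<subseteq> (cball 0 (sqrt (1 + 2 * \<epsilon>)) \<times> cball 0 (sqrt (6 * sqrt (2 * \<epsilon>) * (1 + 4 * \<epsilon>))) :: 'n phase set)"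
      by (auto simp: model_box_def intro!: real_le_rsqrt)
    then have "bounded (model_box \<epsilon> :: 'n phase set)"
      by (rule bounded_subset[rotated]) (intro bounded_Times bounded_cball)
    then have C: "compact ?C" by (rule compact_closure[THEN iffD2])
    have "\<Lambda>s - ?C = Lambda' \<sigma> \<rho> - ?C"
      unfolding R(9) using imU R(2) closure_subset[of "model_box \<epsilon> :: 'n phase set"] by blast
    also have "\<dots> = Lambda \<sigma> \<rho> - ?C"
      using Lambda_Lambda'_off_core model_core_subset[OF eps, where 'n='n] by blast
    \<comment> \<open>The closed box is compact and contains both the core and the surgery domain
      U', so outside it nothing has changed.\<close>
    finally have off: "\<Lambda>s - ?C = Lambda \<sigma> \<rho> - ?C" .
    have "embedded_submanifold (atlas_of X) CARD('n) L" using assms(2) by (simp add: lagrangian_def)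
    then have "embedded_submanifold (atlas_of X) CARD('n) Ls"
      unfolding Ls implant_def by (rule embedded_implant[OF X d\<xi> op _ emb LW C box off])
    then have "lagrangian X Ls" using isotropic_cobordism_end[OF cobX] by (simp add: lagrangian_def)
    moreover have "implant L \<xi> W\<^sub>0 W \<Lambda>s \<in> resolution_family X UNIV L' p (?m, sheet \<sigma> \<rho> \<xi> W\<^sub>0 (- (-1)))"
      unfolding L' p
      by (rule implant_resolution[OF X \<xi> R(1) U'W R(3-7) _ _ R(9)]) (use R(8) in auto)
    ultimately show ?thesis
      unfolding belongs_to_family_def using Ls local_lagrangian_isotopy_refl[OF lag] by auto
  qed
  \<comment> \<open>Orderings are pairs of sets, so the two sheets must be told apart: over |x| = 1
    they have opposite nonzero heights, and \<xi> is injective there.\<close>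
  moreover have "(?p, ?m) \<noteq> (?m, ?p)"
  proof -
    obtain x :: "(real, 'n) vec" where x: "norm x = 1" using vector_choose_size[of 1] by auto
    define h where "h = 3 * sqrt (f1 1) * f1' 1"
    have h: "h > 0" using f1_pos[of 1] f1'_pos by (simp add: h_def)
    have plus: "(x, h *\<^sub>R x) \<in> Lambda'_sheet \<sigma> \<rho> 1" using x by (simp add: Lambda'_sheet_iff h_def)
    then have "(x, h *\<^sub>R x) \<in> model_core \<epsilon>" using x eps by (intro Lambda'_near_core) (auto simp: Lambda'_def)
    then have W: "(x, h *\<^sub>R x) \<in> W\<^sub>0" using model_core_subset[OF eps] box by blast
    have "(x, h *\<^sub>R x) \<notin> Lambda'_sheet \<sigma> \<rho> (-1)"
    proof
      assume "(x, h *\<^sub>R x) \<in> Lambda'_sheet \<sigma> \<rho> (-1)"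
      then have "h *\<^sub>R x = (- h) *\<^sub>R x" using x by (simp add: Lambda'_sheet_iff h_def)
      then have "h = - h" using x by (metis norm_zero scaleR_cancel_right zero_neq_one)
      then show False using h by linarith
    qed
    then have "\<xi> (x, h *\<^sub>R x) \<notin> ?m" unfolding sheet_def using inj W by (auto dest: inj_onD)
    moreover have "\<xi> (x, h *\<^sub>R x) \<in> ?p" unfolding sheet_def using plus W by blast
    ultimately show ?thesis by blast
  qed
  ultimately show ?thesis unfolding sheet_orderings_def by blast
qed

end
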